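(* Let $U\subset\mathbb{R}^m$ be a bounded domain, $0\le k\le n$, let $f:U\to\mathbb{R}^n$ be $k^\dagger$-stable, and let $\alpha\in C^1_b(\mathbb{R}^n,\Lambda^k)$. Then $f^*\alpha\in L^1(U,\Lambda^k)$, $f^*d\alpha\in L^1(U,\Lambda^{k+1})$, and $d(f^*\alpha)=f^*(d\alpha)$ in the weak sense, i.e. $$\int_Uf^*\alpha\wedge d\phi=(-1)^{k+1}\int_Uf^*(d\alpha)\wedge\phi\quad\text{for all }\phi\in C^1_0(U,\Lambda^{m-k-1}).$$
   Context: For $f\in W^{1,1}(U,\mathbb{R}^n)$, $|\Lambda^kf|(x)$ is the maximum of the absolute values of all $k\times k$ minors of the Jacobian matrix $Df(x)=(\partial f_\nu/\partial x_\mu)$ ($0$ if $k>\min(m,n)$; $|\Lambda^0f|=1$). For $\alpha=\sum_{i_1<\dots<i_k}a_{i_1\dots i_k}(y)\,dy_{i_1}\wedge\dots\wedge dy_{i_k}$ on $\mathbb{R}^n$, $f^*\alpha=\sum a_{i_1\dots i_k}(f(x))\,df_{i_1}\wedge\dots\wedge df_{i_k}$, $df_\nu=\sum_\mu\frac{\partial f_\nu}{\partial x_\mu}dx_\mu$. $C^1_b(\mathbb{R}^n,\Lambda^k)$: $C^1$ $k$-forms on $\mathbb{R}^n$ with bounded coefficients and bounded first derivatives of coefficients; $C^1_0(U,\Lambda^j)$: $C^1$ forms on $U$ with compactly supported coefficients. $\mathcal{F}^k(U,\mathbb{R}^n)=\{f\in W^{1,1}(U,\mathbb{R}^n): |\Lambda^kf|\in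 L^1(U)\}$. A sequence $f_j\in\mathcal{F}^k$ converges to $f\in\mathcal{F}^k$ in the $\tau^k$ topology if $f_j\to f$ in $W^{1,1}$ and $\int_Uf_j^*\alpha\wedge\omega\to\int_Uf^*\alpha\wedge\omega$ for all $\alpha\in C^1_b(\mathbb{R}^n,\Lambda^k)$, $\omega\in C^1_0(U,\Lambda^{m-k})$. For $k<n$, a map $f$ is $k^\dagger$-stable if $f\in\mathcal{F}^k(U,\mathbb{R}^n)\cap\mathcal{F}^{k+1}(U,\mathbb{R}^n)$ and there is a single sequence $f_j\in C^1(U,\mathbb{R}^n)\cap\mathcal{F}^k\cap\mathcal{F}^{k+1}$ converging to $f$ both in the $\tau^k$ topology and in the $\tau^{k+1}$ topology; for $k=n$, $n^\dagger$-stable means $n$-stable (there is a sequence in $C^1(U,\mathbb{R}^n)\cap\mathcal{F}^n$ converging to $f\in\mathcal{F}^n$ in $\tau^n$). *)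

theory Defs
  imports "HOL-Analysis.Analysis"
begin

(* Conventions.
   R^m = (real, 'm) vec, R^n = (real, 'n) vec, with 'm, 'n finite linearly ordered index types
   (the order fixes the orientation dx_{i1} /\ ... /\ dx_{ik}, i1 < ... < ik).
   A k-form on R^d is represented by its coefficient family
     beta :: 'd set => (real, 'd) vec => real,
   beta I being the coefficient of dx_I for card I = k (values at other I are ignored). *)


definition pd :: "((real, 'd) vec \<Rightarrow> real) \<Rightarrow> 'd::finite \<Rightarrow> (real, 'd) vec \<Rightarrow> real" where
  "pd g i x = frechet_derivative g (at x) (axis i 1)"

definition C1_on :: "((real, 'd) vec) set \<Rightarrow> ((real, 'd::finite) vec \<Rightarrow> real) \<Rightarrow> bool" where
  "C1_on S g \<longleftrightarrow> (\<exists>g'. (\<forall>x\<in>S. (g has_derivative g' x) (at x)) \<and> (\<forall>v. continuous_on S (\<lambda>x. g' x v)))"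

definition C1b :: "((real, 'd::finite) vec \<Rightarrow> real) \<Rightarrow> bool" where
  "C1b g \<longleftrightarrow> C1_on UNIV g \<and> bounded (range g) \<and> (\<forall>i. bounded (range (pd g i)))"

definition C1_0 :: "((real, 'd) vec) set \<Rightarrow> ((real, 'd::finite) vec \<Rightarrow> real) \<Rightarrow> bool" where
  "C1_0 U g \<longleftrightarrow> C1_on UNIV g \<and> (\<exists>K. compact K \<and> K \<subseteq> U \<and> (\<forall>x. x \<notin> K \<longrightarrow> g x = 0))"

definition C1b_form :: "nat \<Rightarrow> ('d::finite set \<Rightarrow> (real, 'd) vec \<Rightarrow> real) \<Rightarrow> bool" where
  "C1b_form k \<alpha> \<longleftrightarrow> (\<forall>I. card I = k \<longrightarrow> C1b (\<alpha> I))"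

definition C1_0_form :: "((real, 'd) vec) set \<Rightarrow> nat \<Rightarrow> ('d::finite set \<Rightarrow> (real, 'd) vec \<Rightarrow> real) \<Rightarrow> bool" where
  "C1_0_form U j \<omega> \<longleftrightarrow> (\<forall>J. card J = j \<longrightarrow> C1_0 U (\<omega> J))"

(* dx_I /\ dx_J = sgn_pair I J * dx_{I \<union> J}  for disjoint I, J *)
definition sgn_pair :: "'d::linorder set \<Rightarrow> 'd set \<Rightarrow> real" where
  "sgn_pair I J = (-1) ^ card {(i, j). i \<in> I \<and> j \<in> J \<and> j < i}"

definition extd :: "('d::{finite,linorder} set \<Rightarrow> (real, 'd) vec \<Rightarrow> real) \<Rightarrow> ('d set \<Rightarrow> (real, 'd) vec \<Rightarrow> real)" where
  "extd \<beta> K x = (\<Sum>i\<in>K. sgn_pair {i} (K - {i}) * pd (\<beta> (K - {i})) i x)"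

definition wedge :: "nat \<Rightarrow> ('d::{finite,linorder} set \<Rightarrow> 'a \<Rightarrow> real) \<Rightarrow> nat \<Rightarrow> ('d set \<Rightarrow> 'a \<Rightarrow> real) \<Rightarrow> ('d set \<Rightarrow> 'a \<Rightarrow> real)" where
  "wedge k \<beta> j \<omega> L x =
     (\<Sum>I\<in>{I. I \<subseteq> L \<and> card I = k \<and> card (L - I) = j}. sgn_pair I (L - I) * \<beta> I x * \<omega> (L - I) x)"

definition sgn_bij :: "('a::linorder \<Rightarrow> 'b::linorder) \<Rightarrow> 'a set \<Rightarrow> real" where
  "sgn_bij \<sigma> J = (-1) ^ card {(a, b). a \<in> J \<and> b \<in> J \<and> a < b \<and> \<sigma> b < \<sigma> a}"

definition minor :: "((real, 'm) vec, 'n) vec \<Rightarrow> 'n::{finite,linorder} set \<Rightarrow> 'm::{finite,linorder} set \<Rightarrow> real" where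
  "minor M I J = (\<Sum>\<sigma>\<in>{\<sigma>\<in>J \<rightarrow>\<^sub>E I. bij_betw \<sigma> J I}. sgn_bij \<sigma> J * (\<Prod>j\<in>J. M $ \<sigma> j $ j))"

definition Lam :: "nat \<Rightarrow> ((real, 'm::{finite,linorder}) vec, 'n::{finite,linorder}) vec \<Rightarrow> real" where
  "Lam k M = (let S = {\<bar>minor M I J\<bar> | I J. card I = k \<and> card J = k} in if S = {} then 0 else Max S)"

(* pullback f^* alpha, with D x = Df(x), (D x) $ nu $ mu = d f_nu / d x_mu *)
definition pullback :: "((real, 'm) vec \<Rightarrow> (real, 'n) vec) \<Rightarrow> ((real, 'm) vec \<Rightarrow> ((real, 'm) vec, 'n) vec) \<Rightarrow> nat
     \<Rightarrow> ('n::{finite,linorder} set \<Rightarrow> (real, 'n) vec \<Rightarrow> real) \<Rightarrow> ('m::{finite,linorder} set \<Rightarrow> (real, 'm) vec \<Rightarrow> real)" where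
  "pullback f D k \<alpha> J x = (\<Sum>I\<in>{I. card I = k}. \<alpha> I (f x) * minor (D x) I J)"

definition weak_jacobian :: "((real, 'm::finite) vec) set \<Rightarrow> ((real, 'm) vec \<Rightarrow> (real, 'n::finite) vec) \<Rightarrow> ((real, 'm) vec \<Rightarrow> ((real, 'm) vec, 'n) vec) \<Rightarrow> bool" where
  "weak_jacobian U f D \<longleftrightarrow>
     (\<forall>\<nu>. integrable (lebesgue_on U) (\<lambda>x. f x $ \<nu>)) \<and>
     (\<forall>\<nu> \<mu>. integrable (lebesgue_on U) (\<lambda>x. D x $ \<nu> $ \<mu>)) \<and>
     (\<forall>\<nu> \<mu> \<phi>. C1_0 U \<phi> \<longrightarrow>
        integral\<^sup>L (lebesgue_on U) (\<lambda>x. f x $ \<nu> * pd \<phi> \<mu> x)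
          = - integral\<^sup>L (lebesgue_on U) (\<lambda>x. D x $ \<nu> $ \<mu> * \<phi> x))"

definition Fk :: "((real, 'm::{finite,linorder}) vec) set \<Rightarrow> nat \<Rightarrow> ((real, 'm) vec \<Rightarrow> (real, 'n::{finite,linorder}) vec) \<Rightarrow> ((real, 'm) vec \<Rightarrow> ((real, 'm) vec, 'n) vec) \<Rightarrow> bool" where
  "Fk U k f D \<longleftrightarrow> weak_jacobian U f D \<and> integrable (lebesgue_on U) (\<lambda>x. Lam k (D x))"

definition jac :: "((real, 'm) vec \<Rightarrow> (real, 'n) vec) \<Rightarrow> (real, 'm) vec \<Rightarrow> ((real, 'm::finite) vec, 'n::finite) vec" where
  "jac f x = (\<chi> \<nu> \<mu>. pd (\<lambda>y. f y $ \<nu>) \<mu> x)"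

definition C1_map :: "((real, 'm::finite) vec) set \<Rightarrow> ((real, 'm) vec \<Rightarrow> (real, 'n::finite) vec) \<Rightarrow> bool" where
  "C1_map U f \<longleftrightarrow> (\<forall>\<nu>. C1_on U (\<lambda>x. f x $ \<nu>))"

definition int_wedge :: "((real, 'm) vec) set \<Rightarrow> nat \<Rightarrow> ('m::{finite,linorder} set \<Rightarrow> (real, 'm) vec \<Rightarrow> real) \<Rightarrow> nat \<Rightarrow> ('m set \<Rightarrow> (real, 'm) vec \<Rightarrow> real) \<Rightarrow> real" where
  "int_wedge U k \<beta> j \<omega> = integral\<^sup>L (lebesgue_on U) (wedge k \<beta> j \<omega> UNIV)"

definition tau_conv :: "((real, 'm::{finite,linorder}) vec) set \<Rightarrow> nat \<Rightarrow> (nat \<Rightarrow> (real, 'm) vec \<Rightarrow> (real, 'n::{finite,linorder}) vec) \<Rightarrow> (nat \<Rightarrow> (real, 'm) vec \<Rightarrow> ((real, 'm) vec, 'n) vec)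
     \<Rightarrow> ((real, 'm) vec \<Rightarrow> (real, 'n) vec) \<Rightarrow> ((real, 'm) vec \<Rightarrow> ((real, 'm) vec, 'n) vec) \<Rightarrow> bool" where
  "tau_conv U k fs Ds f D \<longleftrightarrow>
     (\<lambda>j. integral\<^sup>L (lebesgue_on U) (\<lambda>x. norm (fs j x - f x))) \<longlonglongrightarrow> 0 \<and>
     (\<lambda>j. integral\<^sup>L (lebesgue_on U) (\<lambda>x. norm (Ds j x - D x))) \<longlonglongrightarrow> 0 \<and>
     (\<forall>\<alpha> \<omega>. k \<le> CARD('m) \<longrightarrow> C1b_form k \<alpha> \<longrightarrow> C1_0_form U (CARD('m) - k) \<omega> \<longrightarrow>
        (\<lambda>j. int_wedge U k (pullback (fs j) (Ds j) k \<alpha>) (CARD('m) - k) \<omega>)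
          \<longlonglongrightarrow> int_wedge U k (pullback f D k (\<alpha> :: ('n::{finite,linorder} set \<Rightarrow> (real, 'n) vec \<Rightarrow> real))) (CARD('m) - k) \<omega>)"

definition dagger_stable :: "((real, 'm::{finite,linorder}) vec) set \<Rightarrow> nat \<Rightarrow> ((real, 'm) vec \<Rightarrow> (real, 'n::{finite,linorder}) vec)
     \<Rightarrow> ((real, 'm) vec \<Rightarrow> ((real, 'm) vec, 'n) vec) \<Rightarrow> bool" where
  "dagger_stable U k f D \<longleftrightarrow>
     (if k < CARD('n) then
        Fk U k f D \<and> Fk U (k + 1) f D \<and>
        (\<exists>fs. (\<forall>j. C1_map U (fs j) \<and> Fk U k (fs j) (jac (fs j)) \<and> Fk U (k + 1) (fs j) (jac (fs j))) \<and>
              tau_conv U k fs (\<lambda>j. jac (fs j)) f D \<and> tau_conv U (k + 1) fs (\<lambda>j. jac (fs j)) f D)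
      else if k = CARD('n) then
        Fk U k f D \<and>
        (\<exists>fs. (\<forall>j. C1_map U (fs j) \<and> Fk U k (fs j) (jac (fs j))) \<and> tau_conv U k fs (\<lambda>j. jac (fs j)) f D)
      else False)"

end

theory Submission
  imports Defs "HOL-Library.Option_ord"
begin

text \<open>
  The topology \<open>\<tau>\<^sup>k\<close> only tests against \<open>C\<^sup>1\<close> forms, whereas \<open>d\<alpha>\<close> and \<open>d\<phi>\<close> are merely
  continuous. So \<open>\<alpha>\<close> and \<open>\<phi>\<close> are mollified first; since \<open>f\<^sup>*\<alpha>\<close> and \<open>f\<^sup>*d\<alpha>\<close> are dominated by
  \<open>|\<Lambda>\<^sup>kf|\<close> and \<open>|\<Lambda>\<^sup>k\<^sup>+\<^sup>1f|\<close>, bounded pointwise convergence of the mollifications and of their first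
  derivatives is enough to remove the mollification again. For mollified data, passing to the limit along
  the \<open>C\<^sup>1\<close> maps of the stability hypothesis reduces the claim to a \<open>C\<^sup>1\<close> map \<open>g\<close>. Cutting \<open>g\<close> off
  near the support of \<open>\<phi>\<close> and mollifying it reduces further to \<open>C\<^sup>2\<close> maps, where \<open>d(g\<^sup>*\<alpha>) = g\<^sup>*d\<alpha>\<close>
  holds pointwise (Laplace expansion, and cancellation of the symmetric second derivatives of \<open>g\<close>),
  and Stokes' theorem is the vanishing of integrals of partial derivatives of compactly supported functions.
\<close>

section \<open>Alternating sums and Laplace expansion\<close>

text \<open>Mollifying \<open>f\<close> itself would not do: W^{1,1} convergence does not control
  minors of degree at least two, so the minors of the mollified maps need not converge to those of
  \<open>f\<close>. Hence only the forms are regularised at the outer level, and the approximation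
  of \<open>f\<close> is left to the stability hypothesis. The limits are nested and never
  interchanged. For each fixed pair of mollified forms the stable sequence is exhausted first, with
  no uniformity in the mollification. The outer limit then concerns the single map \<open>f\<close>,
  so \<open>Lam k\<close> and \<open>Lam (k + 1)\<close> of its Jacobian are fixed integrable
  majorants. Bounds on second derivatives of the mollified forms may depend on the mollification;
  they only serve to make d\<alpha> and d\<phi> admissible test forms. One sequence has to serve
  both topologies, because the identity for a C1 map ties its degree k integral to its degree k + 1
  integral. If k is the dimension of the target, (k+1)-forms pull back to 0, and convergence in
  degree k is enough.\<close>

definition inv_sgn :: "'a::linorder \<Rightarrow> 'a \<Rightarrow> real" where
  "inv_sgn x y = (if y < x then -1 else 1)"

lemma inv_sgn_swap: "x \<noteq> y \<Longrightarrow> inv_sgn y x = - inv_sgn x y"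
  by (auto simp: inv_sgn_def)

text \<open>As a product of local signs, the parity of the inversion count can be reindexed along a
  permutation of pairs and split over subsets of pairs, the two moves made below.\<close>

lemma sgn_bij_eq_prod:
  assumes "finite J"
  shows "sgn_bij \<sigma> J = (\<Prod>(a, b)\<in>{(a, b). a \<in> J \<and> b \<in> J \<and> a < b}. inv_sgn (\<sigma> a) (\<sigma> b))"
proof -
  let ?P = "{(a, b). a \<in> J \<and> b \<in> J \<and> a < b}"
  have fin: "finite ?P"
    by (rule finite_subset[of _ "J \<times> J"]) (use assms in auto)
  have "(\<Prod>(a, b)\<in>?P. inv_sgn (\<sigma> a) (\<sigma> b)) = (\<Prod>p\<in>?P. if \<sigma> (snd p) < \<sigma> (fst p) then -1 else 1)"
    by (rule prod.cong) (auto simp: inv_sgn_def)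
  also have "\<dots> = (\<Prod>p\<in>{p \<in> ?P. \<sigma> (snd p) < \<sigma> (fst p)}. -1)"
    by (rule prod.inter_filter[OF fin, symmetric])
  also have "{p \<in> ?P. \<sigma> (snd p) < \<sigma> (fst p)} = {(a, b). a \<in> J \<and> b \<in> J \<and> a < b \<and> \<sigma> b < \<sigma> a}"
    by auto
  finally show ?thesis unfolding sgn_bij_def by simp
qed

lemma sgn_bij_cong: "(\<And>a. a \<in> J \<Longrightarrow> \<sigma> a = \<tau> a) \<Longrightarrow> sgn_bij \<sigma> J = sgn_bij \<tau> J"
  unfolding sgn_bij_def by (intro arg_cong[where f="\<lambda>A. (-1) ^ card A"]) auto

lemma sgn_bij_strict_mono_comp:
  assumes "\<And>x y. g x < g y \<longleftrightarrow> x < y"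
  shows "sgn_bij (\<lambda>x. g (\<sigma> x)) J = sgn_bij \<sigma> J"
  unfolding sgn_bij_def by (simp add: assms)

text \<open>The inversions are the pair (j, l) itself and, for each b strictly between j and l, the
  two pairs (j, b) and (b, l): an odd number.\<close>

lemma sgn_bij_transpose_aux:
  assumes K: "finite K" "j \<in> K" "l \<in> K" "j < l"
  shows "sgn_bij (Transposition.transpose j l) K = -1"
proof -
  define B where "B = {b \<in> K. j < b \<and> b < l}"
  let ?S = "{(a, b). a \<in> K \<and> b \<in> K \<and> a < b \<and> Transposition.transpose j l b < Transposition.transpose j l a}"
  have "?S = insert (j, l) ({j} \<times> B \<union> B \<times> {l})"
    using assms unfolding B_def by (auto simp: Transposition.transpose_def split: if_splits)
  moreover have "card ({j} \<times> B \<union> B \<times> {l}) = card B + card B"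
    using K unfolding B_def by (subst card_Un_disjoint) (auto simp: card_cartesian_product)
  moreover have "(j, l) \<notin> {j} \<times> B \<union> B \<times> {l}" by (auto simp: B_def)
  moreover have "finite ({j} \<times> B \<union> B \<times> {l})" using K by (auto simp: B_def)
  ultimately have "card ?S = Suc (card B + card B)" by simp
  then show ?thesis unfolding sgn_bij_def by (simp flip: mult_2)
qed

lemma sgn_bij_transpose:
  assumes K: "finite K" "j \<in> K" "l \<in> K" "j \<noteq> l"
  shows "sgn_bij (Transposition.transpose j l) K = -1"
  using sgn_bij_transpose_aux[of K j l] sgn_bij_transpose_aux[of K l j] assms
  by (cases "j < l") (auto simp: Transposition.transpose_commute)

text \<open>The map \<open>r\<close> transposes both entries of a pair and sorts the result, an
  involution on the increasing pairs. Since \<open>inv_sgn\<close> changes sign when distinct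
  arguments are exchanged, the factor of the composite at a pair is the factor of \<sigma> at the
  image pair times the factor of the transposition. Injectivity of \<sigma> keeps the arguments
  distinct.\<close>

lemma sgn_bij_comp_transpose:
  assumes K: "finite K" "j \<in> K" "l \<in> K" "j \<noteq> l" and inj: "inj_on \<sigma> K"
  shows "sgn_bij (\<sigma> \<circ> Transposition.transpose j l) K = - sgn_bij \<sigma> K"
proof -
  let ?t = "Transposition.transpose j l"
  define P where "P = {(a, b). a \<in> K \<and> b \<in> K \<and> a < b}"
  have tK: "?t a \<in> K" if "a \<in> K" for a using that K by (auto simp: Transposition.transpose_def)
  have tne: "?t a \<noteq> ?t b" if "a < b" for a b
    using that Transposition.transpose_eq_imp_eq[of j l a b] by auto
  define r where "r = (\<lambda>(a, b). (min (?t a) (?t b), max (?t a) (?t b)))"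
  have rr: "r (r p) = p" if "p \<in> P" for p
    using that tne unfolding P_def r_def by (auto simp: min_def max_def)
  have rP: "r p \<in> P" if "p \<in> P" for p
    using that tne tK unfolding P_def r_def by (fastforce simp: min_def max_def)
  have step: "inv_sgn ((\<sigma> \<circ> ?t) a) ((\<sigma> \<circ> ?t) b) = (case r (a, b) of (x, y) \<Rightarrow> inv_sgn (\<sigma> x) (\<sigma> y)) * inv_sgn (?t a) (?t b)"
    if "(a, b) \<in> P" for a b
  proof -
    have "\<sigma> (?t a) \<noteq> \<sigma> (?t b)"
      using that tne[of a b] tK inj_onD[OF inj] unfolding P_def by blast
    then show ?thesis
      by (auto simp: r_def min_def max_def inv_sgn_def)
  qed
  have "sgn_bij (\<sigma> \<circ> ?t) K = (\<Prod>p\<in>P. case p of (a, b) \<Rightarrow> inv_sgn ((\<sigma> \<circ> ?t) a) ((\<sigma> \<circ> ?t) b))"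
    unfolding P_def using K by (simp add: sgn_bij_eq_prod)
  also have "\<dots> = (\<Prod>p\<in>P. (case r p of (x, y) \<Rightarrow> inv_sgn (\<sigma> x) (\<sigma> y)) * (case p of (a, b) \<Rightarrow> inv_sgn (?t a) (?t b)))"
    by (rule prod.cong) (use step in auto)
  also have "\<dots> = (\<Prod>p\<in>P. case r p of (x, y) \<Rightarrow> inv_sgn (\<sigma> x) (\<sigma> y)) * (\<Prod>(a, b)\<in>P. inv_sgn (?t a) (?t b))"
    by (rule prod.distrib)
  also have "(\<Prod>p\<in>P. case r p of (x, y) \<Rightarrow> inv_sgn (\<sigma> x) (\<sigma> y)) = (\<Prod>p\<in>P. case p of (x, y) \<Rightarrow> inv_sgn (\<sigma> x) (\<sigma> y))"
    by (rule prod.reindex_bij_witness[of _ r r]) (auto simp: rr rP)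
  also have "(\<Prod>(a, b)\<in>P. inv_sgn (?t a) (?t b)) = -1"
    using sgn_bij_transpose[OF K] K unfolding P_def by (simp add: sgn_bij_eq_prod)
  finally show ?thesis unfolding P_def using K by (simp add: sgn_bij_eq_prod)
qed

lemma sgn_pair_sing: "sgn_pair {i} A = (-1) ^ card {a \<in> A. a < i}"
proof -
  have "{(x, y). x \<in> {i} \<and> y \<in> A \<and> y < x} = Pair i ` {a \<in> A. a < i}" by auto
  then show ?thesis unfolding sgn_pair_def by (simp add: card_image inj_on_def)
qed

text \<open>The pairs containing j are (a, j) with a < j and (j, a) with j < a. Turning the former
  around costs one sign each, which gives the first factor. What remains is the product of
  \<open>inv_sgn (\<sigma> j) (\<sigma> a)\<close> over all other a, and it counts the elements of L
  below \<sigma> j. This is the sign of a Laplace expansion.\<close>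

lemma sgn_bij_split:
  assumes K: "finite K" "j \<in> K" and bij: "bij_betw \<sigma> K L"
  shows "sgn_bij \<sigma> K = sgn_pair {j} (K - {j}) * sgn_pair {\<sigma> j} (L - {\<sigma> j}) * sgn_bij \<sigma> (K - {j})"
proof -
  have inj: "inj_on \<sigma> K" and L: "L = \<sigma> ` K" using bij by (auto simp: bij_betw_def)
  let ?A = "{a \<in> K - {j}. a < j}"
  let ?B = "{a \<in> K - {j}. j < a}"
  define P where "P = {(a, b). a \<in> K - {j} \<and> b \<in> K - {j} \<and> a < b}"
  have split: "{(a, b). a \<in> K \<and> b \<in> K \<and> a < b} = P \<union> ((\<lambda>a. (a, j)) ` ?A \<union> (\<lambda>a. (j, a)) ` ?B)"
    using K unfolding P_def by auto
  have fin: "finite P" unfolding P_def by (rule finite_subset[of _ "K \<times> K"]) (use K in auto)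
  have p1: "(\<Prod>(a, b)\<in>(\<lambda>a. (a, j)) ` ?A. inv_sgn (\<sigma> a) (\<sigma> b)) = (\<Prod>a\<in>?A. inv_sgn (\<sigma> a) (\<sigma> j))"
    by (subst prod.reindex) (auto simp: inj_on_def)
  have p2: "(\<Prod>(a, b)\<in>(\<lambda>a. (j, a)) ` ?B. inv_sgn (\<sigma> a) (\<sigma> b)) = (\<Prod>a\<in>?B. inv_sgn (\<sigma> j) (\<sigma> a))"
    by (subst prod.reindex) (auto simp: inj_on_def)
  have ne: "\<sigma> a \<noteq> \<sigma> j" if "a \<in> K" "a \<noteq> j" for a using that inj K by (auto simp: inj_on_def)
  have "(\<Prod>a\<in>?A. inv_sgn (\<sigma> a) (\<sigma> j)) = (\<Prod>a\<in>?A. - inv_sgn (\<sigma> j) (\<sigma> a))"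
  proof (rule prod.cong)
    fix a assume "a \<in> ?A"
    then have "\<sigma> a \<noteq> \<sigma> j" using ne by auto
    then show "inv_sgn (\<sigma> a) (\<sigma> j) = - inv_sgn (\<sigma> j) (\<sigma> a)" by (metis inv_sgn_swap)
  qed simp
  also have "\<dots> = (-1) ^ card ?A * (\<Prod>a\<in>?A. inv_sgn (\<sigma> j) (\<sigma> a))"
    by (simp add: prod_uminus)
  finally have q: "(\<Prod>a\<in>?A. inv_sgn (\<sigma> a) (\<sigma> j)) * (\<Prod>a\<in>?B. inv_sgn (\<sigma> j) (\<sigma> a))
      = (-1) ^ card ?A * (\<Prod>a\<in>?A \<union> ?B. inv_sgn (\<sigma> j) (\<sigma> a))"
    using K by (subst prod.union_disjoint) auto
  have AB: "?A \<union> ?B = K - {j}" by auto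
  have "(\<Prod>a\<in>K - {j}. inv_sgn (\<sigma> j) (\<sigma> a)) = (\<Prod>b\<in>L - {\<sigma> j}. inv_sgn (\<sigma> j) b)"
  proof -
    have "L - {\<sigma> j} = \<sigma> ` (K - {j})" using L inj K by (auto simp: inj_on_def)
    moreover have "inj_on \<sigma> (K - {j})" using inj by (auto simp: inj_on_def)
    ultimately show ?thesis by (simp add: prod.reindex)
  qed
  also have "\<dots> = sgn_pair {\<sigma> j} (L - {\<sigma> j})"
  proof -
    have "finite L" using L K by simp
    then have "(\<Prod>b\<in>L - {\<sigma> j}. inv_sgn (\<sigma> j) b) = (\<Prod>b\<in>{b \<in> L - {\<sigma> j}. b < \<sigma> j}. -1)"
      unfolding inv_sgn_def by (subst prod.inter_filter) auto
    then show ?thesis by (simp add: sgn_pair_sing)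
  qed
  finally have r: "(\<Prod>a\<in>K - {j}. inv_sgn (\<sigma> j) (\<sigma> a)) = sgn_pair {\<sigma> j} (L - {\<sigma> j})" .
  have "sgn_bij \<sigma> K = (\<Prod>(a, b)\<in>P. inv_sgn (\<sigma> a) (\<sigma> b)) *
     ((\<Prod>a\<in>?A. inv_sgn (\<sigma> a) (\<sigma> j)) * (\<Prod>a\<in>?B. inv_sgn (\<sigma> j) (\<sigma> a)))"
    using K fin
    by (subst sgn_bij_eq_prod, simp, subst split, subst prod.union_disjoint,
        simp, simp, force simp: P_def, subst prod.union_disjoint)
       (auto simp only: p1 p2, auto)
  also have "\<dots> = sgn_bij \<sigma> (K - {j}) * (sgn_pair {j} (K - {j}) * sgn_pair {\<sigma> j} (L - {\<sigma> j}))"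
    unfolding q AB r using K by (simp add: sgn_bij_eq_prod P_def sgn_pair_sing)
  finally show ?thesis by (simp add: mult_ac)
qed

text \<open>The index set of the sum in \<open>minor\<close>. Extensionality makes each bijection
  count once; this is why \<open>restrict\<close> and \<open>undefined\<close> occur in the
  reindexings below.\<close>

abbreviation bijs :: "'a set \<Rightarrow> 'b set \<Rightarrow> ('a \<Rightarrow> 'b) set" where
  "bijs J I \<equiv> {\<sigma> \<in> J \<rightarrow>\<^sub>E I. bij_betw \<sigma> J I}"

lemma finite_bijs: "finite J \<Longrightarrow> finite (bijs J (I :: 'n::finite set))"
  by (rule finite_subset[of _ "J \<rightarrow>\<^sub>E I"]) (auto intro: finite_PiE)

text \<open>Adjoining \<open>None\<close> as a least row label turns the signs of an expansion along a new first row
  into \<open>sgn_bij\<close> of a bijection on all of \<open>K\<close>, so that exchanging two columns is a transposition.\<close>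
lemma sgn_bij_swap:
  fixes \<sigma> :: "'a::linorder \<Rightarrow> 'b::linorder"
  assumes K: "finite K" "j \<in> K" "l \<in> K" "j \<noteq> l" and bij: "bij_betw \<sigma> (K - {j}) I"
    and \<sigma>': "\<And>x. x \<in> K - {l} \<Longrightarrow> \<sigma>' x = \<sigma> (Transposition.transpose j l x)"
  shows "sgn_pair {l} (K - {l}) * sgn_bij \<sigma>' (K - {l}) = - (sgn_pair {j} (K - {j}) * sgn_bij \<sigma> (K - {j}))"
proof -
  have key: "sgn_bij (\<lambda>x. if x = i then None else Some (\<tau> x)) K = sgn_pair {i} (K - {i}) * sgn_bij \<tau> (K - {i})"
    if i: "i \<in> K" and b: "bij_betw \<tau> (K - {i}) I" for i and \<tau> :: "'a \<Rightarrow> 'b"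
  proof -
    let ?s = "\<lambda>x. if x = i then None else Some (\<tau> x)"
    have bb: "bij_betw ?s K (insert None (Some ` I))"
      using b i unfolding bij_betw_def inj_on_def by (force simp: image_iff)
    have "sgn_bij ?s K = sgn_pair {i} (K - {i}) * sgn_pair {None :: 'b option} (Some ` I) * sgn_bij ?s (K - {i})"
      using sgn_bij_split[OF K(1) i bb] by (simp add: insert_Diff_if)
    moreover have "sgn_pair {None :: 'b option} (Some ` I) = 1"
      by (simp add: sgn_pair_sing)
    moreover have "sgn_bij ?s (K - {i}) = sgn_bij (\<lambda>x. Some (\<tau> x)) (K - {i})"
      by (rule sgn_bij_cong) auto
    moreover have "\<dots> = sgn_bij \<tau> (K - {i})"
      by (rule sgn_bij_strict_mono_comp) auto
    ultimately show ?thesis by simp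
  qed
  have tb: "bij_betw (Transposition.transpose j l) (K - {l}) (K - {j})"
    by (rule bij_betw_byWitness[where f'="Transposition.transpose j l"]) (use K in \<open>auto simp: Transposition.transpose_def\<close>)
  have b': "bij_betw \<sigma>' (K - {l}) I"
    using bij_betw_trans[OF tb bij] by (rule bij_betw_cong[THEN iffD2, rotated]) (use \<sigma>' in auto)
  have inj: "inj_on (\<lambda>x. if x = j then None else Some (\<sigma> x)) K"
    using bij by (auto simp: inj_on_def bij_betw_def)
  have "sgn_pair {l} (K - {l}) * sgn_bij \<sigma>' (K - {l}) = sgn_bij (\<lambda>x. if x = l then None else Some (\<sigma>' x)) K"
    using key[OF K(3) b'] by simp
  also have "\<dots> = sgn_bij ((\<lambda>x. if x = j then None else Some (\<sigma> x)) \<circ> Transposition.transpose j l) K"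
    by (rule sgn_bij_cong) (use K \<sigma>' in \<open>auto simp: Transposition.transpose_def\<close>)
  also have "\<dots> = - sgn_bij (\<lambda>x. if x = j then None else Some (\<sigma> x)) K"
    by (rule sgn_bij_comp_transpose[OF K inj])
  finally show ?thesis using key[OF K(2) bij] by simp
qed

text \<open>Expanded over triples (j, \<sigma>, l), the sum is reversed by the involution that
  exchanges the removed column j with the distinguished column l: symmetry of S preserves the
  product, while the sign flips by \<open>sgn_bij_swap\<close>. It is applied with S the second
  derivatives of a map, which is d(dg) = 0, and with S built from a single matrix row, which is the
  vanishing of a determinant with a repeated row.\<close>

lemma alternating_sum_symmetric_eq_0:
  fixes I :: "'n::{finite,linorder} set" and K :: "'m::{finite,linorder} set"
    and S :: "'n \<Rightarrow> 'm \<Rightarrow> 'm \<Rightarrow> real" and M :: "'n \<Rightarrow> 'm \<Rightarrow> real"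
  assumes S_sym: "\<And>i a b. S i a b = S i b a"
  shows "(\<Sum>j\<in>K. sgn_pair {j} (K - {j}) * (\<Sum>\<sigma>\<in>bijs (K - {j}) I. sgn_bij \<sigma> (K - {j}) *
     (\<Sum>l\<in>K - {j}. S (\<sigma> l) j l * (\<Prod>x\<in>K - {j} - {l}. M (\<sigma> x) x)))) = 0" (is "?X = 0")
proof -
  define T where "T = (SIGMA j:K. bijs (K - {j}) I \<times> (K - {j}))"
  define w where "w = (\<lambda>(j, \<sigma>, l). sgn_pair {j} (K - {j}) * sgn_bij \<sigma> (K - {j}) *
      (S (\<sigma> l) j l * (\<Prod>x\<in>K - {j} - {l}. M (\<sigma> x) x)))"
  \<comment> \<open>After the exchange, j inherits the row that l had. Restriction to
    \<open>K - {l}\<close> brings the composite back into the extensional index set.\<close>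
  define r :: "'m \<times> ('m \<Rightarrow> 'n) \<times> 'm \<Rightarrow> 'm \<times> ('m \<Rightarrow> 'n) \<times> 'm" where
    "r = (\<lambda>(j, \<sigma>, l). (l, restrict (\<sigma> \<circ> Transposition.transpose j l) (K - {l}), j))"
  have "sum w T = (\<Sum>j\<in>K. \<Sum>q\<in>bijs (K - {j}) I \<times> (K - {j}). w (j, q))"
    unfolding T_def by (subst sum.Sigma) (auto simp: finite_bijs)
  also have "\<dots> = (\<Sum>j\<in>K. \<Sum>\<sigma>\<in>bijs (K - {j}) I. \<Sum>l\<in>K - {j}. w (j, \<sigma>, l))"
    by (rule sum.cong[OF refl], subst sum.cartesian_product) (rule sum.cong, auto)
  also have "\<dots> = ?X"
    unfolding w_def prod.case sum_distrib_left by (simp only: mult.assoc)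
  finally have X: "?X = sum w T" by (rule sym)
  have rT: "r p \<in> T" and rr: "r (r p) = p" and wr: "w (r p) = - w p" if "p \<in> T" for p
  proof -
    obtain j \<sigma> l where p: "p = (j, \<sigma>, l)" by (metis prod_cases3)
    have jl: "j \<in> K" "l \<in> K" "j \<noteq> l" "\<sigma> \<in> (K - {j}) \<rightarrow>\<^sub>E I" and bij: "bij_betw \<sigma> (K - {j}) I"
      using that unfolding p T_def by auto
    let ?s = "restrict (\<sigma> \<circ> Transposition.transpose j l) (K - {l})"
    have tb: "bij_betw (Transposition.transpose j l) (K - {l}) (K - {j})"
      by (rule bij_betw_byWitness[where f'="Transposition.transpose j l"]) (use jl in \<open>auto simp: Transposition.transpose_def\<close>)
    have sb: "bij_betw ?s (K - {l}) I"
      using bij_betw_trans[OF tb bij] by (simp add: bij_betw_restrict_eq)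
    have s1: "?s \<in> (K - {l}) \<rightarrow>\<^sub>E I"
      using bij_betw_imp_surj_on[OF sb] by (intro PiE_I) (blast, simp only: restrict_apply if_False)
    show "r p \<in> T" unfolding p T_def r_def prod.case
      by (intro SigmaI CollectI conjI jl sb s1) (use jl in auto)
    have "restrict (?s \<circ> Transposition.transpose l j) (K - {j}) = \<sigma>"
    proof
      fix x show "restrict (?s \<circ> Transposition.transpose l j) (K - {j}) x = \<sigma> x"
        using jl(1-3) PiE_arb[OF jl(4), of x]
        by (cases "x \<in> K - {j}"; cases "x = l") (simp_all add: Transposition.transpose_def)
    qed
    then show "r (r p) = p" by (simp only: p r_def prod.case)
    have "(\<Prod>x\<in>K - {l} - {j}. M (?s x) x) = (\<Prod>x\<in>K - {j} - {l}. M (\<sigma> x) x)"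
      by (rule prod.cong) (auto simp: Transposition.transpose_def)
    moreover have "S (?s j) l j = S (\<sigma> l) j l"
      by (subst S_sym) (use jl in simp)
    moreover have "sgn_pair {l} (K - {l}) * sgn_bij ?s (K - {l}) = - (sgn_pair {j} (K - {j}) * sgn_bij \<sigma> (K - {j}))"
      by (rule sgn_bij_swap[OF _ jl(1,2,3) bij]) auto
    ultimately show "w (r p) = - w p"
      unfolding p r_def w_def prod.case by (simp only: mult_minus_left)
  qed
  have "sum w T = sum (\<lambda>p. - w p) T"
    by (rule sum.reindex_bij_witness[of _ r r]) (auto simp: rT rr wr)
  then have "sum w T = 0" by (simp add: sum_negf)
  then show ?thesis using X by simp
qed

text \<open>This is the expansion of a determinant in which row \<nu> occurs twice. The chosen S
  vanishes unless its row argument is \<nu>, so in the inner sum only the unique l with \<sigma> l =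
  \<nu> survives; there S is the product of the entries of row \<nu> in columns j and l, symmetric
  in the two columns.\<close>

lemma laplace_repeated:
  fixes M :: "((real, 'm::{finite,linorder}) vec, 'n::{finite,linorder}) vec"
  assumes "\<nu> \<in> I"
  shows "(\<Sum>j\<in>K. sgn_pair {j} (K - {j}) * (M $ \<nu> $ j * minor M I (K - {j}))) = 0"
proof -
  define S where "S i a b = (if i = \<nu> then M $ \<nu> $ a * M $ \<nu> $ b else 0)" for i a b
  have "(\<Sum>j\<in>K. sgn_pair {j} (K - {j}) * (\<Sum>\<sigma>\<in>bijs (K - {j}) I. sgn_bij \<sigma> (K - {j}) *
     (\<Sum>l\<in>K - {j}. S (\<sigma> l) j l * (\<Prod>x\<in>K - {j} - {l}. M $ \<sigma> x $ x)))) = 0"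
    by (rule alternating_sum_symmetric_eq_0) (simp add: S_def mult.commute)
  moreover have eq: "(\<Sum>l\<in>K - {j}. S (\<sigma> l) j l * (\<Prod>x\<in>K - {j} - {l}. M $ \<sigma> x $ x))
     = M $ \<nu> $ j * (\<Prod>x\<in>K - {j}. M $ \<sigma> x $ x)" if "\<sigma> \<in> bijs (K - {j}) I" for j \<sigma>
  proof -
    have bij: "bij_betw \<sigma> (K - {j}) I" using that by simp
    then obtain l where l: "l \<in> K - {j}" "\<sigma> l = \<nu>" using assms by (auto simp: bij_betw_def)
    have "S (\<sigma> l') j l' = 0" if "l' \<in> K - {j} - {l}" for l'
      using that l bij unfolding S_def bij_betw_def inj_on_def by auto
    then have "(\<Sum>l\<in>K - {j}. S (\<sigma> l) j l * (\<Prod>x\<in>K - {j} - {l}. M $ \<sigma> x $ x))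
      = S (\<sigma> l) j l * (\<Prod>x\<in>K - {j} - {l}. M $ \<sigma> x $ x)"
      using l by (subst sum.remove[of _ l]) (auto intro!: sum.neutral)
    also have "\<dots> = M $ \<nu> $ j * (M $ \<sigma> l $ l * (\<Prod>x\<in>K - {j} - {l}. M $ \<sigma> x $ x))"
      using l by (simp add: S_def)
    also have "M $ \<sigma> l $ l * (\<Prod>x\<in>K - {j} - {l}. M $ \<sigma> x $ x) = (\<Prod>x\<in>K - {j}. M $ \<sigma> x $ x)"
      using l by (subst (2) prod.remove[of _ l]) auto
    finally show ?thesis .
  qed
  have "(\<Sum>\<sigma>\<in>bijs (K - {j}) I. sgn_bij \<sigma> (K - {j}) *
     (\<Sum>l\<in>K - {j}. S (\<sigma> l) j l * (\<Prod>x\<in>K - {j} - {l}. M $ \<sigma> x $ x))) = M $ \<nu> $ j * minor M I (K - {j})" for j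
    unfolding minor_def
    by (subst (2) sum_distrib_left, rule sum.cong[OF refl]) (subst eq, simp_all)
  ultimately show ?thesis by simp
qed

text \<open>A pair of a column j and a bijection from \<open>K - {j}\<close> to I is the same as a
  bijection from K to \<open>insert \<nu> I\<close> sending j to \<nu>. The factor
  \<open>sgn_pair {\<nu>} I\<close> records that \<nu> need not be the first row; it comes from
  \<open>sgn_bij_split\<close> and changes sides because its square is 1.\<close>

lemma laplace_insert:
  fixes M :: "((real, 'm::{finite,linorder}) vec, 'n::{finite,linorder}) vec"
  assumes \<nu>: "\<nu> \<notin> I"
  shows "(\<Sum>j\<in>K. sgn_pair {j} (K - {j}) * (M $ \<nu> $ j * minor M I (K - {j})))
     = sgn_pair {\<nu>} I * minor M (insert \<nu> I) K"
proof -
  define T where "T = (SIGMA j:K. bijs (K - {j}) I)"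
  define w where "w = (\<lambda>(j, \<sigma>). sgn_pair {j} (K - {j}) * (M $ \<nu> $ j * (sgn_bij \<sigma> (K - {j}) * (\<Prod>x\<in>K - {j}. M $ \<sigma> x $ x))))"
  have "(\<Sum>j\<in>K. sgn_pair {j} (K - {j}) * (M $ \<nu> $ j * minor M I (K - {j}))) = sum w T"
    unfolding T_def w_def minor_def
    by (subst sum.Sigma[symmetric]) (auto simp: finite_bijs sum_distrib_left)
  also have "\<dots> = (\<Sum>\<sigma>\<in>bijs K (insert \<nu> I). sgn_pair {\<nu>} I * (sgn_bij \<sigma> K * (\<Prod>x\<in>K. M $ \<sigma> x $ x)))"
  proof (rule sum.reindex_bij_witness[where
        i = "\<lambda>\<sigma>. (inv_into K \<sigma> \<nu>, \<sigma>(inv_into K \<sigma> \<nu> := undefined))" and j = "\<lambda>(j, \<sigma>). \<sigma>(j := \<nu>)"])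
    fix p assume "p \<in> T"
    then obtain j \<sigma> where p: "p = (j, \<sigma>)" and j: "j \<in> K" and \<sigma>: "\<sigma> \<in> (K - {j}) \<rightarrow>\<^sub>E I" "bij_betw \<sigma> (K - {j}) I"
      unfolding T_def by auto
    have bij: "bij_betw (\<sigma>(j := \<nu>)) K (insert \<nu> I)"
      using \<sigma> \<nu> j unfolding bij_betw_def inj_on_def by (auto simp: image_iff)
    then show "(case p of (j, \<sigma>) \<Rightarrow> \<sigma>(j := \<nu>)) \<in> bijs K (insert \<nu> I)"
      using \<sigma> j unfolding p by (auto simp: PiE_def extensional_def Pi_def)
    have iv: "inv_into K (\<sigma>(j := \<nu>)) \<nu> = j"
      using bij j by (intro inv_into_f_eq) (auto simp: bij_betw_def)
    have "\<sigma> j = undefined" using \<sigma> by (auto simp: PiE_def extensional_def)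
    then show "(inv_into K (case p of (j, \<sigma>) \<Rightarrow> \<sigma>(j := \<nu>)) \<nu>, (case p of (j, \<sigma>) \<Rightarrow> \<sigma>(j := \<nu>))(inv_into K (case p of (j, \<sigma>) \<Rightarrow> \<sigma>(j := \<nu>)) \<nu> := undefined)) = p"
      unfolding p by (simp add: iv) (metis fun_upd_triv)
    have "sgn_bij (\<sigma>(j := \<nu>)) K = sgn_pair {j} (K - {j}) * sgn_pair {\<nu>} I * sgn_bij \<sigma> (K - {j})"
    proof -
      have "sgn_bij (\<sigma>(j := \<nu>)) (K - {j}) = sgn_bij \<sigma> (K - {j})"
        by (rule sgn_bij_cong) auto
      then show ?thesis using sgn_bij_split[OF _ j bij] \<nu> by simp
    qed
    moreover have "(\<Prod>x\<in>K. M $ (\<sigma>(j := \<nu>)) x $ x) = M $ \<nu> $ j * (\<Prod>x\<in>K - {j}. M $ \<sigma> x $ x)"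
      using j by (subst prod.remove[of _ j]) auto
    moreover have "sgn_pair {\<nu>} I * sgn_pair {\<nu>} I = 1"
      by (simp add: sgn_pair_sing flip: power_mult_distrib)
    ultimately show "sgn_pair {\<nu>} I * (sgn_bij (case p of (j, \<sigma>) \<Rightarrow> \<sigma>(j := \<nu>)) K * (\<Prod>x\<in>K. M $ (case p of (j, \<sigma>) \<Rightarrow> \<sigma>(j := \<nu>)) x $ x)) = w p"
      unfolding p w_def by simp
  next
    fix \<sigma> assume s: "\<sigma> \<in> bijs K (insert \<nu> I)"
    define j where "j = inv_into K \<sigma> \<nu>"
    have bij: "bij_betw \<sigma> K (insert \<nu> I)" using s by simp
    have j: "j \<in> K" "\<sigma> j = \<nu>" unfolding j_def using bij
      by (auto simp: bij_betw_def inv_into_into f_inv_into_f)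
    show "(case (inv_into K \<sigma> \<nu>, \<sigma>(inv_into K \<sigma> \<nu> := undefined)) of (j, \<sigma>) \<Rightarrow> \<sigma>(j := \<nu>)) = \<sigma>"
      using j by (simp flip: j_def) (metis fun_upd_triv)
    have "bij_betw (\<sigma>(j := undefined)) (K - {j}) I"
    proof -
      have "bij_betw \<sigma> (K - {j}) (insert \<nu> I - {\<nu>})"
        using bij_betw_DiffI[OF bij, of "{j}" "{\<nu>}"] j by auto
      then show ?thesis using \<nu> by (subst bij_betw_cong[where g=\<sigma>]) auto
    qed
    then show "(inv_into K \<sigma> \<nu>, \<sigma>(inv_into K \<sigma> \<nu> := undefined)) \<in> T"
      unfolding T_def j_def[symmetric] using j s
      by (auto simp: PiE_def extensional_def bij_betw_def)
  qed
  also have "\<dots> = sgn_pair {\<nu>} I * minor M (insert \<nu> I) K"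
    unfolding minor_def by (simp add: sum_distrib_left)
  finally show ?thesis .
qed

section \<open>Partial derivatives and convolution\<close>

lemma pd_eq: "(g has_derivative g') (at x) \<Longrightarrow> pd g i x = g' (axis i 1)"
  unfolding pd_def by (metis frechet_derivative_at)

lemma has_derivative_eq_sum_pd:
  fixes g :: "(real, 'd::finite) vec \<Rightarrow> real"
  assumes g: "(g has_derivative g') (at x)"
  shows "g' v = (\<Sum>i\<in>UNIV. v $ i * pd g i x)"
proof -
  interpret g': linear g' using g by (rule has_derivative_linear)
  have "g' v = g' (\<Sum>i\<in>UNIV. v $ i *\<^sub>R axis i 1)"
    using basis_expansion[of v] by (simp add: scalar_mult_eq_scaleR)
  also have "\<dots> = (\<Sum>i\<in>UNIV. v $ i * pd g i x)"
    by (simp add: g'.sum g'.scale pd_eq[OF g])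
  finally show ?thesis .
qed

lemma has_derivative_pd:
  fixes g :: "(real, 'd::finite) vec \<Rightarrow> real"
  assumes "g differentiable at x"
  shows "(g has_derivative (\<lambda>v. \<Sum>i\<in>UNIV. v $ i * pd g i x)) (at x)"
proof -
  obtain g' where g': "(g has_derivative g') (at x)" using assms by (auto simp: differentiable_def)
  moreover have "g' = (\<lambda>v. \<Sum>i\<in>UNIV. v $ i * pd g i x)"
    using has_derivative_eq_sum_pd[OF g'] by (simp add: fun_eq_iff)
  ultimately show ?thesis by simp
qed

text \<open>Trades the derivative family hidden under the existential quantifier for the concrete
  \<open>pd\<close>, so that closure properties reduce to continuity of explicit formulas.\<close>

lemma C1_on_iff:
  fixes g :: "(real, 'd::finite) vec \<Rightarrow> real"
  shows "C1_on S g \<longleftrightarrow> (\<forall>x\<in>S. g differentiable at x) \<and> (\<forall>i. continuous_on S (pd g i))"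
proof (intro iffI conjI ballI allI)
  assume "C1_on S g"
  then obtain g' where g': "\<And>x. x \<in> S \<Longrightarrow> (g has_derivative g' x) (at x)"
    and cont: "\<And>v. continuous_on S (\<lambda>x. g' x v)" unfolding C1_on_def by auto
  show "g differentiable at x" if "x \<in> S" for x using g'[OF that] by (auto simp: differentiable_def)
  show "continuous_on S (pd g i)" for i
    using cont[of "axis i 1"] by (rule continuous_on_eq) (metis g' pd_eq)
next
  assume *: "(\<forall>x\<in>S. g differentiable at x) \<and> (\<forall>i. continuous_on S (pd g i))"
  show "C1_on S g" unfolding C1_on_def
    by (intro exI[of _ "\<lambda>x v. \<Sum>i\<in>UNIV. v $ i * pd g i x"] conjI ballI allI)
      (use * has_derivative_pd in \<open>auto intro!: continuous_intros\<close>)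
qed

lemma C1_on_differentiable: "C1_on S g \<Longrightarrow> x \<in> S \<Longrightarrow> g differentiable at x"
  and C1_on_continuous_pd: "C1_on S g \<Longrightarrow> continuous_on S (pd g i)"
  by (auto simp: C1_on_iff)

lemma C1_on_continuous: "C1_on S g \<Longrightarrow> continuous_on S g"
  by (meson C1_on_differentiable differentiable_imp_continuous_within continuous_at_imp_continuous_on)

lemma pd_const: "pd (\<lambda>y. c) i x = 0"
  by (rule pd_eq[THEN trans]) (auto intro!: derivative_eq_intros)

lemma pd_mult:
  assumes "f differentiable at x" "g differentiable at x"
  shows "pd (\<lambda>y. f y * g y) i x = pd f i x * g x + f x * pd g i x"
proof -
  obtain f' g' where *: "(f has_derivative f') (at x)" "(g has_derivative g') (at x)"
    using assms by (auto simp: differentiable_def)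
  show ?thesis
    by (simp add: pd_eq[OF has_derivative_mult[OF *]] pd_eq[OF *(1)] pd_eq[OF *(2)])
qed

lemma pd_cmult: "f differentiable at x \<Longrightarrow> pd (\<lambda>y. c * f y) i x = c * pd f i x"
  by (simp add: pd_mult pd_const)

lemma pd_sum:
  assumes "\<And>a. a \<in> A \<Longrightarrow> f a differentiable at x"
  shows "pd (\<lambda>y. \<Sum>a\<in>A. f a y) i x = (\<Sum>a\<in>A. pd (f a) i x)"
proof -
  obtain f' where f': "\<And>a. a \<in> A \<Longrightarrow> (f a has_derivative f' a) (at x)"
    using assms unfolding differentiable_def by metis
  have "((\<lambda>y. \<Sum>a\<in>A. f a y) has_derivative (\<lambda>v. \<Sum>a\<in>A. f' a v)) (at x)"
    by (rule has_derivative_sum) (rule f')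
  then show ?thesis by (simp add: pd_eq[OF f'] pd_eq cong: sum.cong)
qed

lemma pd_prod:
  assumes "\<And>a. a \<in> A \<Longrightarrow> f a differentiable at x"
  shows "pd (\<lambda>y. \<Prod>a\<in>A. f a y) i x = (\<Sum>a\<in>A. pd (f a) i x * (\<Prod>b\<in>A - {a}. f b x))"
proof -
  obtain f' where f': "\<And>a. a \<in> A \<Longrightarrow> (f a has_derivative f' a) (at x)"
    using assms unfolding differentiable_def by metis
  have "((\<lambda>y. \<Prod>a\<in>A. f a y) has_derivative (\<lambda>v. \<Sum>a\<in>A. f' a v * (\<Prod>b\<in>A - {a}. f b x))) (at x)"
    by (rule has_derivative_prod) (rule f')
  then show ?thesis by (simp add: pd_eq[OF f'] pd_eq cong: sum.cong)
qed

lemma has_derivative_components: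
  fixes g :: "(real, 'd::finite) vec \<Rightarrow> (real, 'e::finite) vec"
  assumes "\<And>\<nu>. (\<lambda>y. g y $ \<nu>) differentiable at x"
  shows "(g has_derivative (\<lambda>v. \<chi> \<nu>. \<Sum>i\<in>UNIV. v $ i * pd (\<lambda>y. g y $ \<nu>) i x)) (at x)"
  by (subst has_derivative_componentwise_within) (auto simp: Basis_vec_def inner_axis intro!: has_derivative_pd assms)

lemma pd_compose:
  fixes g :: "(real, 'd::finite) vec \<Rightarrow> (real, 'e::finite) vec" and a :: "(real, 'e) vec \<Rightarrow> real"
  assumes g: "\<And>\<nu>. (\<lambda>y. g y $ \<nu>) differentiable at x" and a: "a differentiable at (g x)"
  shows "pd (\<lambda>y. a (g y)) i x = (\<Sum>\<nu>\<in>UNIV. pd (\<lambda>y. g y $ \<nu>) i x * pd a \<nu> (g x))"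
    and "(\<lambda>y. a (g y)) differentiable at x"
proof -
  have *: "((\<lambda>y. a (g y)) has_derivative (\<lambda>v. \<Sum>\<nu>\<in>UNIV. (\<chi> \<nu>. \<Sum>i\<in>UNIV. v $ i * pd (\<lambda>y. g y $ \<nu>) i x) $ \<nu> * pd a \<nu> (g x))) (at x)"
    by (rule has_derivative_compose[OF has_derivative_components[OF g] has_derivative_pd[OF a]])
  then show "(\<lambda>y. a (g y)) differentiable at x" by (auto simp: differentiable_def)
  show "pd (\<lambda>y. a (g y)) i x = (\<Sum>\<nu>\<in>UNIV. pd (\<lambda>y. g y $ \<nu>) i x * pd a \<nu> (g x))"
    by (simp add: pd_eq[OF *] axis_def if_distrib[where f="\<lambda>t. t * _"] cong: if_cong)
qed

text \<open>Locally equal functions satisfy \<open>has_derivative\<close> for the same linear maps,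
  so the choice operator inside \<open>frechet_derivative\<close> picks the same value, even where
  no derivative exists.\<close>

lemma pd_cong_open:
  assumes "open S" "x \<in> S" "\<And>y. y \<in> S \<Longrightarrow> f y = g y"
  shows "pd f i x = pd g i x" and "f differentiable at x \<longleftrightarrow> g differentiable at x"
proof -
  have "(f has_derivative f') (at x) \<longleftrightarrow> (g has_derivative f') (at x)" for f'
    using assms has_derivative_transform_within_open[of _ f' x UNIV S] by (metis)
  then show "pd f i x = pd g i x" "f differentiable at x \<longleftrightarrow> g differentiable at x"
    unfolding pd_def frechet_derivative_def differentiable_def by auto
qed

lemma C1_on_mult: "C1_on S f \<Longrightarrow> C1_on S g \<Longrightarrow> C1_on S (\<lambda>x. f x * g x)"
  unfolding C1_on_iff
  by (auto intro!: continuous_intros simp: pd_mult differentiable_imp_continuous_within continuous_at_imp_continuous_on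
      cong: continuous_on_cong)

lemma C1_on_const: "C1_on S (\<lambda>x. c)"
  unfolding C1_on_iff by (simp add: pd_const)

lemma C1_on_sum: "(\<And>a. a \<in> A \<Longrightarrow> C1_on S (f a)) \<Longrightarrow> C1_on S (\<lambda>x. \<Sum>a\<in>A. f a x)"
proof (induction A rule: infinite_finite_induct)
  case (insert a A)
  have "C1_on S (\<lambda>x. f a x + (\<Sum>a\<in>A. f a x))"
    unfolding C1_on_iff
  proof (intro conjI ballI allI)
    have c: "C1_on S (f a)" "C1_on S (\<lambda>x. \<Sum>a\<in>A. f a x)" using insert by auto
    show "(\<lambda>x. f a x + (\<Sum>a\<in>A. f a x)) differentiable at x" if "x \<in> S" for x
      using c that by (intro differentiable_add C1_on_differentiable)
    have "pd (\<lambda>x. f a x + (\<Sum>a\<in>A. f a x)) i x = pd (f a) i x + pd (\<lambda>x. \<Sum>a\<in>A. f a x) i x" if x: "x \<in> S" for x i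
    proof -
      obtain f' g' where *: "(f a has_derivative f') (at x)" "((\<lambda>x. \<Sum>a\<in>A. f a x) has_derivative g') (at x)"
        using C1_on_differentiable[OF c(1) x] C1_on_differentiable[OF c(2) x] by (auto simp: differentiable_def)
      show ?thesis by (simp add: pd_eq[OF has_derivative_add[OF *]] pd_eq[OF *(1)] pd_eq[OF *(2)])
    qed
    then show "continuous_on S (pd (\<lambda>x. f a x + (\<Sum>a\<in>A. f a x)) i)" for i
      using c by (auto intro!: continuous_intros C1_on_continuous_pd cong: continuous_on_cong)
  qed
  then show ?case using insert by simp
qed (auto simp: C1_on_const)

lemma C1_on_prod: "(\<And>a. a \<in> A \<Longrightarrow> C1_on S (f a)) \<Longrightarrow> C1_on S (\<lambda>x. \<Prod>a\<in>A. f a x)"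
  by (induction A rule: infinite_finite_induct) (auto simp: C1_on_const C1_on_mult)

lemma C1_on_compose:
  fixes g :: "(real, 'd::finite) vec \<Rightarrow> (real, 'e::finite) vec" and a :: "(real, 'e) vec \<Rightarrow> real"
  assumes g: "\<And>\<nu>. C1_on S (\<lambda>y. g y $ \<nu>)" and a: "C1_on UNIV a"
  shows "C1_on S (\<lambda>x. a (g x))"
proof -
  have dg: "(\<lambda>y. g y $ \<nu>) differentiable at x" if "x \<in> S" for x \<nu> using g that by (auto simp: C1_on_iff)
  have da: "a differentiable at y" for y using a by (auto simp: C1_on_iff)
  have cg: "continuous_on S g"
    using continuous_on_vec_lambda[of S "\<lambda>\<nu> x. g x $ \<nu>"] C1_on_continuous[OF g] by simp
  have ca: "continuous_on S (\<lambda>x. pd a \<nu> (g x))" for \<nu>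
    by (rule continuous_on_compose2[OF C1_on_continuous_pd[OF a] cg]) simp
  have "continuous_on S (\<lambda>x. \<Sum>\<nu>\<in>UNIV. pd (\<lambda>y. g y $ \<nu>) i x * pd a \<nu> (g x))" for i
    by (intro continuous_intros ca C1_on_continuous_pd g)
  then have "continuous_on S (pd (\<lambda>x. a (g x)) i)" for i
    by (rule continuous_on_eq) (simp add: pd_compose(1)[OF dg da])
  then show ?thesis
    unfolding C1_on_iff using pd_compose(2)[OF dg da] by blast
qed

section \<open>Convolution with a compactly supported kernel\<close>

definition conv :: "('a::euclidean_space \<Rightarrow> real) \<Rightarrow> ('a \<Rightarrow> real) \<Rightarrow> 'a \<Rightarrow> real" where
  "conv \<kappa> h x = (\<integral>y. \<kappa> (x - y) * h y \<partial>lborel)"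

definition supp_ball :: "real \<Rightarrow> ('a::euclidean_space \<Rightarrow> real) \<Rightarrow> bool" where
  "supp_ball r \<kappa> \<longleftrightarrow> (\<forall>y. r < norm y \<longrightarrow> \<kappa> y = 0)"

lemma supp_ballD: "supp_ball r \<kappa> \<Longrightarrow> r < norm y \<Longrightarrow> \<kappa> y = 0"
  by (simp add: supp_ball_def)

text \<open>A bridge from the Bochner integral over the whole space to the gauge integral over a
  box, the setting in which continuity in a parameter and differentiation under the integral sign
  are applied below.\<close>

lemma integral_cont_compact_support:
  fixes f :: "'a::euclidean_space \<Rightarrow> real"
  assumes f: "continuous_on UNIV f" and f0: "\<And>x. x \<notin> cbox a b \<Longrightarrow> f x = 0"
  shows "integrable lborel f" and "integral\<^sup>L lborel f = integral (cbox a b) f"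
proof -
  have eq: "(\<lambda>x. indicator (cbox a b) x *\<^sub>R f x) = f" by (rule ext) (use f0 in \<open>auto simp: indicator_def\<close>)
  have "integrable lborel (\<lambda>x. indicator (cbox a b) x *\<^sub>R f x)"
    by (rule borel_integrable_compact) (auto intro: continuous_on_subset[OF f])
  then show "integrable lborel f" by (simp only: eq)
  have "set_integrable lborel (cbox a b) f"
    unfolding set_integrable_def by (simp only: eq \<open>integrable lborel f\<close>)
  from set_borel_integral_eq_integral(2)[OF this]
  show "integral\<^sup>L lborel f = integral (cbox a b) f"
    unfolding set_lebesgue_integral_def by (simp only: eq)
qed

lemma integrable_supp_ball:
  fixes f :: "'a::euclidean_space \<Rightarrow> real"
  assumes "continuous_on UNIV f" "supp_ball r f"
  shows "integrable lborel f"
proof -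
  obtain a where a: "cball (0::'a) r \<subseteq> cbox (-a) a" using bounded_subset_cbox_symmetric[OF bounded_cball] by blast
  show ?thesis
    by (rule integral_cont_compact_support(1)[OF assms(1), of "-a" a])
      (use a assms(2) in \<open>force simp: supp_ball_def\<close>)
qed

lemma integral_lborel_reflect:
  fixes F :: "'a::euclidean_space \<Rightarrow> real" assumes "F \<in> borel_measurable borel"
  shows "(\<integral>y. F (x - y) \<partial>lborel) = integral\<^sup>L lborel F"
proof -
  have "lborel = distr lborel borel (\<lambda>y. x - y)"
    using lborel_affine[of "-1" x] by (simp add: density_1)
  then have "integral\<^sup>L lborel F = integral\<^sup>L (distr lborel borel (\<lambda>y. x - y)) F" by simp
  also have "\<dots> = (\<integral>y. F (x - y) \<partial>lborel)"
    by (rule integral_distr) (use assms in auto)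
  finally show ?thesis by simp
qed

lemma continuous_conv_integrand:
  fixes \<kappa> h :: "'a::euclidean_space \<Rightarrow> real"
  assumes "continuous_on UNIV \<kappa>" "continuous_on UNIV h"
  shows "continuous_on UNIV (\<lambda>y. \<kappa> (x - y) * h y)"
  by (rule continuous_on_mult[OF continuous_on_compose2[OF assms(1)] assms(2)]) (auto intro!: continuous_intros)

lemma conv_eq_integral:
  assumes "continuous_on UNIV \<kappa>" "continuous_on UNIV h" "supp_ball r \<kappa>" "cball x r \<subseteq> cbox a b"
  shows "conv \<kappa> h x = integral (cbox a b) (\<lambda>y. \<kappa> (x - y) * h y)"
  unfolding conv_def
  by (rule integral_cont_compact_support(2)[OF continuous_conv_integrand[OF assms(1,2)]])
    (use assms(3,4) in \<open>force simp: supp_ball_def dist_norm\<close>)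

lemma integrable_conv:
  assumes "continuous_on UNIV \<kappa>" "continuous_on UNIV h" "supp_ball r \<kappa>"
  shows "integrable lborel (\<lambda>y. \<kappa> (x - y) * h y)"
proof -
  obtain a where a: "cball x r \<subseteq> cbox (-a) a" using bounded_subset_cbox_symmetric[OF bounded_cball] by blast
  show ?thesis
    by (rule integral_cont_compact_support(1)[OF continuous_conv_integrand[OF assms(1,2)], of "-a" a])
      (use a assms(3) in \<open>force simp: supp_ball_def dist_norm\<close>)
qed

text \<open>Only values of h within distance r of x enter. With B = 0 this later shows that
  mollifications vanish away from the support of h.\<close>

lemma conv_bound:
  assumes \<kappa>: "continuous_on UNIV \<kappa>" "supp_ball r \<kappa>" and h: "continuous_on UNIV h"
    and B: "\<And>y. dist x y \<le> r \<Longrightarrow> \<bar>h y\<bar> \<le> B"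
  shows "\<bar>conv \<kappa> h x\<bar> \<le> B * (\<integral>y. \<bar>\<kappa> y\<bar> \<partial>lborel)"
proof -
  have abs: "continuous_on UNIV (\<lambda>y. \<bar>\<kappa> y\<bar>)" "supp_ball r (\<lambda>y. \<bar>\<kappa> y\<bar>)"
    using \<kappa> by (auto intro!: continuous_intros simp: supp_ball_def)
  have "\<bar>conv \<kappa> h x\<bar> \<le> (\<integral>y. \<bar>\<kappa> (x - y) * h y\<bar> \<partial>lborel)"
    unfolding conv_def by (rule integral_abs_bound)
  also have "\<dots> \<le> (\<integral>y. \<bar>\<kappa> (x - y)\<bar> * B \<partial>lborel)"
  proof (rule integral_mono)
    show "integrable lborel (\<lambda>y. \<bar>\<kappa> (x - y) * h y\<bar>)"
      using integrable_conv[OF \<kappa>(1) h \<kappa>(2)] by simp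
    show "integrable lborel (\<lambda>y. \<bar>\<kappa> (x - y)\<bar> * B)"
      using integrable_conv[OF abs(1) continuous_on_const abs(2)] .
    show "\<bar>\<kappa> (x - y) * h y\<bar> \<le> \<bar>\<kappa> (x - y)\<bar> * B" for y
      using B[of y] supp_ballD[OF \<kappa>(2), of "x - y"]
      by (cases "dist x y \<le> r") (auto simp: abs_mult dist_norm intro!: mult_left_mono)
  qed
  also have "\<dots> = B * (\<integral>y. \<bar>\<kappa> (x - y)\<bar> \<partial>lborel)" by simp
  also have "(\<integral>y. \<bar>\<kappa> (x - y)\<bar> \<partial>lborel) = (\<integral>y. \<bar>\<kappa> y\<bar> \<partial>lborel)"
    by (rule integral_lborel_reflect) (intro borel_measurable_continuous_onI abs)
  finally show ?thesis .
qed

text \<open>For x within distance 1 of a fixed point, all the shifted kernels live in one common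
  box, so that the domain of integration no longer depends on x.\<close>

lemma conv_continuous:
  fixes \<kappa> :: "'a::euclidean_space \<Rightarrow> real"
  assumes \<kappa>: "continuous_on UNIV \<kappa>" "supp_ball r \<kappa>" and h: "continuous_on UNIV h"
  shows "continuous_on UNIV (conv \<kappa> h)"
proof (clarsimp simp: continuous_on_eq_continuous_at)
  fix x0 :: 'a
  obtain a where a: "cball x0 (1 + r) \<subseteq> cbox (-a) a" using bounded_subset_cbox_symmetric[OF bounded_cball] by blast
  have eq: "conv \<kappa> h x = integral (cbox (-a) a) (\<lambda>y. \<kappa> (x - y) * h y)" if "x \<in> ball x0 1" for x
  proof (rule conv_eq_integral[OF \<kappa>(1) h \<kappa>(2)])
    have "dist x0 y \<le> 1 + r" if "dist x y \<le> r" for y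
      using dist_triangle[of x0 y x] that \<open>x \<in> ball x0 1\<close> by auto
    then show "cball x r \<subseteq> cbox (-a) a" using a by auto
  qed
  have "continuous_on (ball x0 1) (\<lambda>x. integral (cbox (-a) a) (\<lambda>y. \<kappa> (x - y) * h y))"
    by (rule integral_continuous_on_param)
      (auto simp: split_beta intro!: continuous_intros continuous_on_compose2[OF \<kappa>(1)] continuous_on_compose2[OF h])
  then have "continuous_on (ball x0 1) (conv \<kappa> h)" by (rule continuous_on_eq) (simp add: eq)
  then show "isCont (conv \<kappa> h) x0" by (simp add: continuous_on_eq_continuous_at)
qed

lemma supp_ball_pd:
  fixes \<kappa> :: "(real, 'd::finite) vec \<Rightarrow> real"
  assumes "supp_ball r \<kappa>" shows "supp_ball r (pd \<kappa> i)"
  unfolding supp_ball_def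
proof (intro allI impI)
  fix y :: "(real, 'd) vec" assume "r < norm y"
  then have "pd \<kappa> i y = pd (\<lambda>_. 0) i y"
    using assms by (intro pd_cong_open[of "- cball 0 r"]) (auto simp: supp_ball_def)
  then show "pd \<kappa> i y = 0" by (simp add: pd_const)
qed

text \<open>Every derivative falls on the kernel, so continuity of h suffices; this is the
  regularising effect. As for continuity, a common box makes the domain of integration locally
  constant.\<close>

lemma conv_C1:
  fixes \<kappa> :: "(real, 'd::finite) vec \<Rightarrow> real"
  assumes \<kappa>: "C1_on UNIV \<kappa>" "supp_ball r \<kappa>" and h: "continuous_on UNIV h"
  shows "C1_on UNIV (conv \<kappa> h)" and "pd (conv \<kappa> h) i = conv (pd \<kappa> i) h"
proof -
  have c\<kappa>: "continuous_on UNIV \<kappa>" using \<kappa>(1) by (rule C1_on_continuous)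
  have cp: "continuous_on UNIV (pd \<kappa> i)" for i using \<kappa>(1) by (rule C1_on_continuous_pd)
  have main: "(conv \<kappa> h has_derivative (\<lambda>v. \<Sum>i\<in>UNIV. v $ i * conv (pd \<kappa> i) h x0)) (at x0)" for x0
  proof -
    obtain a where a: "cball x0 (1 + r) \<subseteq> cbox (-a) a" using bounded_subset_cbox_symmetric[OF bounded_cball] by blast
    have sub: "cball x r \<subseteq> cbox (-a) a" if "x \<in> ball x0 1" for x
    proof -
      have "dist x0 y \<le> 1 + r" if "dist x y \<le> r" for y
        using dist_triangle[of x0 y x] that \<open>x \<in> ball x0 1\<close> by auto
      then show ?thesis using a by auto
    qed
    \<comment> \<open>The derivative of the integrand in x, namely the inner product with its
      gradient, packaged as a bounded linear map because \<open>leibniz_rule\<close> works with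
      \<open>blinfun\<close>.\<close>
    define G where "G x t = blinfun_inner_left (\<chi> i. pd \<kappa> i (x - t) * h t)" for x t
    have G: "blinfun_apply (G x t) v = (\<Sum>i\<in>UNIV. v $ i * (pd \<kappa> i (x - t) * h t))" for x t v
      unfolding G_def by (simp add: inner_vec_def)
    have contG: "continuous_on A (\<lambda>(x, t). G x t)" for A
      unfolding G_def split_beta
      by (intro bounded_linear.continuous_on[OF bounded_linear_blinfun_inner_left] continuous_intros
          continuous_on_compose2[OF cp] continuous_on_compose2[OF h]) auto
    have "((\<lambda>x. integral (cbox (-a) a) (\<lambda>t. \<kappa> (x - t) * h t)) has_derivative
        blinfun_apply (integral (cbox (-a) a) (G x0))) (at x0 within ball x0 1)"
    proof (rule leibniz_rule)
      fix x t :: "(real, 'd) vec"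
      have "((\<lambda>x. x - t) has_derivative (\<lambda>v. v)) (at x)"
        by (auto intro!: derivative_eq_intros)
      from has_derivative_compose[OF this has_derivative_pd[OF C1_on_differentiable[OF \<kappa>(1) UNIV_I]]]
      have "((\<lambda>x. \<kappa> (x - t)) has_derivative (\<lambda>v. \<Sum>i\<in>UNIV. v $ i * pd \<kappa> i (x - t))) (at x)" .
      then have "((\<lambda>x. \<kappa> (x - t) * h t) has_derivative (\<lambda>v. (\<Sum>i\<in>UNIV. v $ i * pd \<kappa> i (x - t)) * h t)) (at x)"
        by (rule has_derivative_mult_left)
      moreover have "(\<lambda>v. (\<Sum>i\<in>UNIV. v $ i * pd \<kappa> i (x - t)) * h t) = blinfun_apply (G x t)"
        by (simp add: G sum_distrib_right mult.assoc fun_eq_iff)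
      ultimately show "((\<lambda>x. \<kappa> (x - t) * h t) has_derivative blinfun_apply (G x t)) (at x within ball x0 1)"
        by (simp add: has_derivative_at_withinI)
    next
      show "(\<lambda>t. \<kappa> (x - t) * h t) integrable_on cbox (-a) a" for x
        by (intro integrable_continuous continuous_on_subset[OF continuous_conv_integrand[OF c\<kappa> h]]) auto
    qed (use contG in auto)
    moreover have "blinfun_apply (integral (cbox (-a) a) (G x0)) = (\<lambda>v. \<Sum>i\<in>UNIV. v $ i * conv (pd \<kappa> i) h x0)"
    proof
      fix v
      have "continuous_on (cbox (-a) a) (G x0)"
        using continuous_on_compose2[OF contG[of UNIV] continuous_on_Pair[OF continuous_on_const continuous_on_id], where ?s = "cbox (-a) a"]
        by simp
      then have "blinfun_apply (integral (cbox (-a) a) (G x0)) v = integral (cbox (-a) a) (\<lambda>t. blinfun_apply (G x0 t) v)"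
        by (intro blinfun_apply_integral integrable_continuous)
      also have "\<dots> = integral (cbox (-a) a) (\<lambda>t. \<Sum>i\<in>UNIV. v $ i * (pd \<kappa> i (x0 - t) * h t))"
        by (simp add: G)
      also have "\<dots> = (\<Sum>i\<in>UNIV. integral (cbox (-a) a) (\<lambda>t. v $ i * (pd \<kappa> i (x0 - t) * h t)))"
        by (intro integral_sum integrable_continuous continuous_intros
            continuous_on_subset[OF continuous_conv_integrand[OF cp h]]) auto
      also have "\<dots> = (\<Sum>i\<in>UNIV. v $ i * conv (pd \<kappa> i) h x0)"
        using conv_eq_integral[OF cp h supp_ball_pd[OF \<kappa>(2)] sub[of x0]] by simp
      finally show "blinfun_apply (integral (cbox (-a) a) (G x0)) v = (\<Sum>i\<in>UNIV. v $ i * conv (pd \<kappa> i) h x0)" .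
    qed
    ultimately have "((\<lambda>x. integral (cbox (-a) a) (\<lambda>t. \<kappa> (x - t) * h t)) has_derivative
        (\<lambda>v. \<Sum>i\<in>UNIV. v $ i * conv (pd \<kappa> i) h x0)) (at x0)"
      by (simp add: at_within_open[of x0 "ball x0 1"])
    then show ?thesis
      by (rule has_derivative_transform_within_open[of _ _ _ _ "ball x0 1"])
        (use conv_eq_integral[OF c\<kappa> h \<kappa>(2) sub] in auto)
  qed
  show pd: "pd (conv \<kappa> h) i = conv (pd \<kappa> i) h" for i
    by (rule ext, subst pd_eq[OF main]) (simp add: axis_def if_distrib[where f="\<lambda>t. t * _"] cong: if_cong)
  show "C1_on UNIV (conv \<kappa> h)"
    unfolding C1_on_iff pd using main conv_continuous[OF cp supp_ball_pd[OF \<kappa>(2)] h]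
    by (auto simp: differentiable_def)
qed

text \<open>By translation invariance, convolution with the constant 1 is constant.\<close>
lemma integral_pd_eq_0:
  fixes u :: "(real, 'd::finite) vec \<Rightarrow> real"
  assumes u: "C1_on UNIV u" "supp_ball r u"
  shows "(\<integral>y. pd u i y \<partial>lborel) = 0"
proof -
  have m: "u \<in> borel_measurable borel" "pd u i \<in> borel_measurable borel"
    using u(1) by (auto intro!: borel_measurable_continuous_onI C1_on_continuous C1_on_continuous_pd)
  have "conv u (\<lambda>_. 1) = (\<lambda>x. integral\<^sup>L lborel u)"
    unfolding conv_def using integral_lborel_reflect[OF m(1)] by simp
  then have "0 = pd (conv u (\<lambda>_. 1)) i 0" by (simp add: pd_const)
  also have "\<dots> = conv (pd u i) (\<lambda>_. 1) 0"
    by (simp add: conv_C1(2)[OF u continuous_on_const])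
  also have "\<dots> = integral\<^sup>L lborel (pd u i)"
    unfolding conv_def using integral_lborel_reflect[OF m(2), of 0] by simp
  finally show ?thesis by simp
qed

text \<open>Integration by parts: the product of h with the reflected kernel has compact support, so
  its partial derivative integrates to 0. The reflection y to x - y supplies the minus sign that
  turns the two terms of the product rule into an equality.\<close>

lemma conv_pd:
  fixes \<kappa> :: "(real, 'd::finite) vec \<Rightarrow> real"
  assumes \<kappa>: "C1_on UNIV \<kappa>" "supp_ball r \<kappa>" and h: "C1_on UNIV h"
  shows "conv (pd \<kappa> i) h x = conv \<kappa> (pd h i) x"
proof -
  have refl: "((\<lambda>y. \<kappa> (x - y)) has_derivative (\<lambda>v. \<Sum>i\<in>UNIV. (- v) $ i * pd \<kappa> i (x - y))) (at y)" for y
    by (rule has_derivative_compose[OF _ has_derivative_pd[OF C1_on_differentiable[OF \<kappa>(1) UNIV_I]]])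
      (auto intro!: derivative_eq_intros)
  have pdr: "pd (\<lambda>y. \<kappa> (x - y)) j y = - pd \<kappa> j (x - y)" for j y
    by (subst pd_eq[OF refl]) (simp add: axis_def if_distrib[where f="\<lambda>t. - (t * _)"] cong: if_cong)
  have C: "C1_on UNIV (\<lambda>y. \<kappa> (x - y))"
    unfolding C1_on_iff pdr using refl
    by (auto simp: differentiable_def pdr intro!: continuous_intros continuous_on_compose2[OF C1_on_continuous_pd[OF \<kappa>(1)]]
        cong: continuous_on_cong)
  define u where "u y = \<kappa> (x - y) * h y" for y
  have Cu: "C1_on UNIV u" unfolding u_def by (rule C1_on_mult[OF C h])
  \<comment> \<open>The reflected kernel is supported around x, while \<open>supp_ball\<close> is
    centred at the origin.\<close>
  have "supp_ball (r + norm x) u"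
    unfolding supp_ball_def u_def
  proof (intro allI impI)
    fix y :: "(real, 'd) vec" assume "r + norm x < norm y"
    then have "r < norm (x - y)" using norm_triangle_ineq2[of y x] by (simp add: norm_minus_commute)
    then show "\<kappa> (x - y) * h y = 0" using \<kappa>(2) by (simp add: supp_ball_def)
  qed
  from integral_pd_eq_0[OF Cu this] have "(\<integral>y. pd u i y \<partial>lborel) = 0" .
  moreover have "pd u i y = \<kappa> (x - y) * pd h i y - pd \<kappa> i (x - y) * h y" for y
    unfolding u_def
    using pd_mult[OF C1_on_differentiable[OF C] C1_on_differentiable[OF h], of y i] by (simp add: pdr)
  ultimately show ?thesis
    unfolding conv_def
    using integrable_conv[OF C1_on_continuous[OF \<kappa>(1)] C1_on_continuous_pd[OF h] \<kappa>(2), of x i]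
      integrable_conv[OF C1_on_continuous_pd[OF \<kappa>(1)] C1_on_continuous[OF h] supp_ball_pd[OF \<kappa>(2)], of i x]
    by simp
qed

section \<open>Mollification and cutoff functions\<close>

text \<open>The exponent is at least 2, so at t = 0 the difference quotient is bounded by a positive
  power of |h| and tends to 0, the common value of the formulas on the two sides.\<close>

lemma DERIV_max_0_power:
  "((\<lambda>t::real. max 0 t ^ Suc (Suc n)) has_real_derivative (real (Suc (Suc n)) * max 0 t ^ Suc n)) (at t)"
proof (cases t "0::real" rule: linorder_cases)
  case less
  have "((\<lambda>t::real. 0) has_real_derivative (real (Suc (Suc n)) * max 0 t ^ Suc n)) (at t)"
    using less by (simp add: max_def)
  then show ?thesis
    by (rule has_field_derivative_transform_within_open[of _ _ _ "{..<0}"]) (use less in \<open>auto simp: max_def\<close>)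
next
  case greater
  have "((\<lambda>t::real. t ^ Suc (Suc n)) has_real_derivative (real (Suc (Suc n)) * max 0 t ^ Suc n)) (at t)"
    using DERIV_pow[of "Suc (Suc n)" t] greater by (simp add: max_def)
  then show ?thesis
    by (rule has_field_derivative_transform_within_open[of _ _ _ "{0<..}"]) (use greater in \<open>auto simp: max_def\<close>)
next
  case equal
  have "(\<lambda>h::real. \<bar>h\<bar> ^ Suc n) \<midarrow>0\<rightarrow> 0" by (auto intro!: tendsto_eq_intros)
  moreover have "norm (max 0 h ^ Suc (Suc n) / h) \<le> \<bar>h\<bar> ^ Suc n" for h :: real
  proof (cases "h > 0")
    case False
    then show ?thesis by (simp add: max_def del: power_Suc)
  qed (simp add: max_def)
  ultimately have "(\<lambda>h::real. max 0 h ^ Suc (Suc n) / h) \<midarrow>0\<rightarrow> 0"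
    by (intro Lim_null_comparison[of "\<lambda>h. max 0 h ^ Suc (Suc n) / h" "\<lambda>h. \<bar>h\<bar> ^ Suc n"] always_eventually allI)
  then show ?thesis unfolding equal DERIV_def by simp
qed

text \<open>The explicit kernel makes the symmetry of its second derivatives visible, so no general
  theorem on mixed partial derivatives is needed.\<close>
definition radial :: "real \<Rightarrow> nat \<Rightarrow> (real, 'd::finite) vec \<Rightarrow> real" where
  "radial e n y = max 0 (e\<^sup>2 - y \<bullet> y) ^ n"

lemma continuous_radial: "continuous_on S (radial e n)"
  unfolding radial_def by (intro continuous_intros)

lemma supp_ball_radial: "0 < e \<Longrightarrow> supp_ball e (radial e (Suc n))"
  unfolding supp_ball_def radial_def
  by (auto simp: max_def dot_square_norm power_mono_iff)

lemma radial_C1: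
  fixes y :: "(real, 'd::finite) vec"
  shows "pd (radial e (Suc (Suc n))) i y = - 2 * real (Suc (Suc n)) * (radial e (Suc n) y * y $ i)"
    and "C1_on UNIV (radial e (Suc (Suc n)) :: (real, 'd) vec \<Rightarrow> real)"
proof -
  have d: "(radial e (Suc (Suc n)) has_derivative
      (\<lambda>v. (real (Suc (Suc n)) * max 0 (e\<^sup>2 - y \<bullet> y) ^ Suc n) * (- (y \<bullet> v + v \<bullet> y)))) (at y)" for y :: "(real, 'd) vec"
    unfolding radial_def
    by (rule has_derivative_compose[OF _ DERIV_max_0_power[unfolded has_field_derivative_def]])
      (auto intro!: derivative_eq_intros)
  show p: "pd (radial e (Suc (Suc n))) i y = - 2 * real (Suc (Suc n)) * (radial e (Suc n) y * y $ i)" for i and y :: "(real, 'd) vec"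
    by (subst pd_eq[OF d]) (simp add: radial_def inner_axis inner_axis' algebra_simps)
  have "pd (radial e (Suc (Suc n))) i = (\<lambda>y. - 2 * real (Suc (Suc n)) * (radial e (Suc n) y * y $ i))" for i :: 'd
    using p by blast
  then show "C1_on UNIV (radial e (Suc (Suc n)) :: (real, 'd) vec \<Rightarrow> real)"
    unfolding C1_on_iff using d
    by (auto simp: differentiable_def intro!: continuous_intros continuous_radial)
qed

lemma coord_C1: "pd (\<lambda>y. y $ i) j x = (if i = j then 1 else 0)" "C1_on S (\<lambda>y :: (real, 'd::finite) vec. y $ i)"
proof -
  have d: "((\<lambda>y :: (real, 'd) vec. y $ i) has_derivative (\<lambda>v. v $ i)) (at x)" for x
    by (rule bounded_linear_imp_has_derivative) (rule bounded_linear_vec_nth)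
  show p: "pd (\<lambda>y. y $ i) j x = (if i = j then 1 else 0)" for j x
    by (subst pd_eq[OF d]) (simp add: axis_def)
  show "C1_on S (\<lambda>y :: (real, 'd::finite) vec. y $ i)"
    unfolding C1_on_iff p using d by (auto simp: differentiable_def continuous_on_const cong: continuous_on_cong)
qed

text \<open>Two derivatives suffice, as the exterior derivative of a pullback involves no higher
  ones. Symmetry of the second derivatives is put into the definition because convolution passes it
  on to every mollified function.\<close>

definition mollifier :: "real \<Rightarrow> ((real, 'd::finite) vec \<Rightarrow> real) \<Rightarrow> bool" where
  "mollifier e \<kappa> \<longleftrightarrow> C1_on UNIV \<kappa> \<and> supp_ball e \<kappa> \<and> (\<forall>i. C1_on UNIV (pd \<kappa> i)) \<and>
     (\<forall>i j y. pd (pd \<kappa> i) j y = pd (pd \<kappa> j) i y) \<and> (\<forall>y. 0 \<le> \<kappa> y) \<and> (\<integral>y. \<kappa> y \<partial>lborel) = 1"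

lemma mollifier_exists:
  assumes e: "0 < e"
  shows "\<exists>\<kappa> :: (real, 'd::finite) vec \<Rightarrow> real. mollifier e \<kappa>"
proof -
  \<comment> \<open>Each differentiation lowers the exponent by one, so exponent 3 leaves continuous
    second derivatives, of exponent 1.\<close>
  let ?r = "radial e 3 :: (real, 'd) vec \<Rightarrow> real"
  have int: "integrable lborel ?r"
    using integrable_supp_ball[OF continuous_radial supp_ball_radial[OF e], of 2] by simp
  have nn: "0 \<le> ?r y" for y by (simp add: radial_def)
  have sb: "supp_ball e ?r" unfolding numeral_3_eq_3 by (rule supp_ball_radial[OF e])
  define I where "I = integral\<^sup>L lborel ?r"
  \<comment> \<open>A continuous nonnegative function with integral 0 over a box vanishes there, but
    at the origin the value is e^6.\<close>
  have "I \<noteq> 0"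
  proof
    assume "I = 0"
    obtain a where a: "cball (0::(real, 'd) vec) e \<subseteq> cbox (-a) a"
      using bounded_subset_cbox_symmetric[OF bounded_cball] by blast
    have z: "?r y = 0" if "y \<notin> cbox (-a) a" for y
      using supp_ball_radial[OF e, of 2] that a by (force simp: supp_ball_def)
    have "integral (cbox (-a) a) ?r = 0"
      using integral_cont_compact_support(2)[OF continuous_radial z] \<open>I = 0\<close> unfolding I_def by simp
    moreover have "(?r has_integral integral (cbox (-a) a) ?r) (cbox (-a) a)"
      by (intro integrable_integral integrable_continuous continuous_radial)
    ultimately have "(?r has_integral 0) (cbox (-a) a)" by simp
    moreover have "0 \<in> box (-a) a"
    proof -
      have "ball (0::(real, 'd) vec) e \<subseteq> interior (cbox (-a) a)"
        by (rule interior_maximal) (use a in auto)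
      then show ?thesis using e by (auto simp: interior_cbox)
    qed
    ultimately have "?r 0 = 0"
      by (intro has_integral_0_cbox_imp_0[OF continuous_radial nn, of "-a" a]) (use box_subset_cbox in blast)+
    then show False using e by (simp add: radial_def)
  qed
  moreover have "0 \<le> I" unfolding I_def using nn by simp
  ultimately have I: "0 < I" by simp
  define \<kappa> where "\<kappa> y = inverse I * ?r y" for y
  have C: "C1_on UNIV ?r" using radial_C1(2)[of e 1] by (simp add: eval_nat_numeral)
  have r3: "pd ?r i y = -6 * (radial e 2 y * y $ i)" for i y
    using radial_C1(1)[of e 1 i y] by (simp add: eval_nat_numeral)
  have r2: "pd (radial e 2) i y = -4 * (radial e 1 y * y $ i)" for i and y :: "(real, 'd) vec"
    using radial_C1(1)[of e 0 i y] by (simp add: eval_nat_numeral)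
  have p1: "pd \<kappa> i = (\<lambda>y. (- 6 * inverse I) * (radial e 2 y * y $ i))" for i
    unfolding \<kappa>_def by (simp add: fun_eq_iff pd_cmult[OF C1_on_differentiable[OF C]] r3)
  have C2: "C1_on UNIV (radial e 2 :: (real, 'd) vec \<Rightarrow> real)" using radial_C1(2)[of e 0] by (simp add: eval_nat_numeral)
  have C3: "C1_on UNIV (\<lambda>y. radial e 2 y * y $ i)" for i :: 'd
    by (rule C1_on_mult[OF C2 coord_C1(2)])
  have p2: "pd (pd \<kappa> i) j y = (- 6 * inverse I) * (-4 * radial e 1 y * y $ j * y $ i + radial e 2 y * (if i = j then 1 else 0))" for i j y
    unfolding p1 pd_cmult[OF C1_on_differentiable[OF C3 UNIV_I]]
      pd_mult[OF C1_on_differentiable[OF C2 UNIV_I] C1_on_differentiable[OF coord_C1(2) UNIV_I]]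
    by (simp add: r2 coord_C1(1))
  have "mollifier e \<kappa>" unfolding mollifier_def
  proof (intro conjI allI)
    show "C1_on UNIV \<kappa>" unfolding \<kappa>_def by (intro C1_on_mult C1_on_const C)
    show "supp_ball e \<kappa>" unfolding \<kappa>_def supp_ball_def
      using supp_ballD[OF sb] by simp
    show "C1_on UNIV (pd \<kappa> i)" for i unfolding p1 by (intro C1_on_mult[OF C1_on_const] C3)
    show "pd (pd \<kappa> i) j y = pd (pd \<kappa> j) i y" for i j y unfolding p2 by simp
    show "0 \<le> \<kappa> y" for y unfolding \<kappa>_def using nn I by simp
    show "(\<integral>y. \<kappa> y \<partial>lborel) = 1" unfolding \<kappa>_def using I by (simp add: I_def)
  qed
  then show ?thesis by blast
qed

lemma mollifierD:
  assumes "mollifier e \<kappa>"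
  shows "C1_on UNIV \<kappa>" "supp_ball e \<kappa>" "continuous_on UNIV \<kappa>" "C1_on UNIV (pd \<kappa> i)"
    "pd (pd \<kappa> i) j y = pd (pd \<kappa> j) i y" "0 \<le> \<kappa> y" "(\<integral>y. \<kappa> y \<partial>lborel) = 1" "(\<integral>y. \<bar>\<kappa> y\<bar> \<partial>lborel) = 1"
  using assms unfolding mollifier_def by (auto intro: C1_on_continuous)

lemma conv_mollifier_bound:
  assumes \<kappa>: "mollifier e \<kappa>" and h: "continuous_on UNIV h" and B: "\<And>y. dist x y \<le> e \<Longrightarrow> \<bar>h y\<bar> \<le> B"
  shows "\<bar>conv \<kappa> h x\<bar> \<le> B"
  using conv_bound[OF mollifierD(3)[OF \<kappa>] mollifierD(2)[OF \<kappa>] h B] by (simp add: mollifierD(8)[OF \<kappa>])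

text \<open>As the kernel has mass 1, the constant h x can be drawn into the integral, and the plain
  bound applies to the difference. With B = 0, mollification is exact wherever h is constant on the
  ball seen by the kernel.\<close>

lemma conv_mollifier_approx:
  assumes \<kappa>: "mollifier e \<kappa>" and h: "continuous_on UNIV h" and B: "\<And>y. dist x y \<le> e \<Longrightarrow> \<bar>h y - h x\<bar> \<le> B"
  shows "\<bar>conv \<kappa> h x - h x\<bar> \<le> B"
proof -
  have i1: "integrable lborel (\<lambda>y. \<kappa> (x - y) * h y)" and i2: "integrable lborel (\<lambda>y. \<kappa> (x - y) * h x)"
    using integrable_conv[OF mollifierD(3)[OF \<kappa>] h mollifierD(2)[OF \<kappa>]]
      integrable_conv[OF mollifierD(3)[OF \<kappa>] continuous_on_const mollifierD(2)[OF \<kappa>]] by auto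
  have m: "\<kappa> \<in> borel_measurable borel" by (rule borel_measurable_continuous_onI[OF mollifierD(3)[OF \<kappa>]])
  have "conv \<kappa> (\<lambda>y. h y - h x) x = conv \<kappa> h x - (\<integral>y. \<kappa> (x - y) * h x \<partial>lborel)"
    unfolding conv_def right_diff_distrib by (rule Bochner_Integration.integral_diff[OF i1 i2])
  also have "(\<integral>y. \<kappa> (x - y) * h x \<partial>lborel) = h x"
    using integral_lborel_reflect[OF m, of x] mollifierD(7)[OF \<kappa>] by simp
  finally show ?thesis
    using conv_mollifier_bound[OF \<kappa> continuous_on_diff[OF h continuous_on_const], of x "h x" B] B by simp
qed

text \<open>The chosen kernel depends on p alone and not on the function, so that
  \<open>moll p\<close> is one operator that can be commuted with \<open>pd\<close>.\<close>

definition moll :: "nat \<Rightarrow> ((real, 'd::finite) vec \<Rightarrow> real) \<Rightarrow> (real, 'd) vec \<Rightarrow> real" where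
  "moll p h = conv (SOME \<kappa>. mollifier (inverse (Suc p)) \<kappa>) h"

lemma moll_conv: obtains \<kappa> :: "(real, 'd::finite) vec \<Rightarrow> real"
  where "mollifier (inverse (Suc p)) \<kappa>" "moll p = conv \<kappa>"
proof -
  have "mollifier (inverse (Suc p)) (SOME \<kappa> :: (real, 'd) vec \<Rightarrow> real. mollifier (inverse (Suc p)) \<kappa>)"
    by (rule someI_ex[of "mollifier (inverse (Suc p))", OF mollifier_exists]) simp
  then show thesis by (rule that) (simp add: moll_def fun_eq_iff)
qed

lemma moll_C1:
  assumes "continuous_on UNIV h" shows "C1_on UNIV (moll p h)"
  by (metis conv_C1(1) mollifierD(1,2) moll_conv assms)

text \<open>Moving the derivative from the kernel to the function lets every bound and limit proved
  for mollifications of continuous functions apply to first derivatives as well.\<close>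

lemma moll_pd:
  assumes "C1_on UNIV h" shows "pd (moll p h) i = moll p (pd h i)"
proof -
  obtain \<kappa> :: "(real, 'a) vec \<Rightarrow> real" where \<kappa>: "mollifier (inverse (Suc p)) \<kappa>" "moll p = conv \<kappa>" by (rule moll_conv)
  show ?thesis unfolding \<kappa>(2) conv_C1(2)[OF mollifierD(1,2)[OF \<kappa>(1)] C1_on_continuous[OF assms]]
    using conv_pd[OF mollifierD(1,2)[OF \<kappa>(1)] assms] by blast
qed

text \<open>Both derivatives are put on the kernel, where symmetry holds by construction; h itself
  has only one derivative.\<close>

lemma moll_pd_pd_commute:
  assumes "C1_on UNIV h" shows "pd (pd (moll p h) i) j x = pd (pd (moll p h) j) i x"
proof -
  obtain \<kappa> :: "(real, 'a) vec \<Rightarrow> real" where \<kappa>: "mollifier (inverse (Suc p)) \<kappa>" "moll p = conv \<kappa>" by (rule moll_conv)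
  note h = C1_on_continuous[OF assms]
  have "pd (pd (moll p h) i) j = conv (pd (pd \<kappa> i) j) h" for i j
    unfolding \<kappa>(2) conv_C1(2)[OF mollifierD(1,2)[OF \<kappa>(1)] h]
    by (rule conv_C1(2)[OF mollifierD(4)[OF \<kappa>(1)] supp_ball_pd[OF mollifierD(2)[OF \<kappa>(1)]] h])
  moreover have "pd (pd \<kappa> i) j = pd (pd \<kappa> j) i" for i j using mollifierD(5)[OF \<kappa>(1)] by blast
  ultimately show ?thesis by simp
qed

lemma moll_bound:
  assumes "continuous_on UNIV h" "\<And>y. dist x y \<le> inverse (Suc p) \<Longrightarrow> \<bar>h y\<bar> \<le> B"
  shows "\<bar>moll p h x\<bar> \<le> B"
  by (metis conv_mollifier_bound moll_conv assms)

lemma moll_approx: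
  assumes "continuous_on UNIV h" "\<And>y. dist x y \<le> inverse (Suc p) \<Longrightarrow> \<bar>h y - h x\<bar> \<le> B"
  shows "\<bar>moll p h x - h x\<bar> \<le> B"
  by (metis conv_mollifier_approx moll_conv assms)

lemma moll_tendsto:
  assumes h: "continuous_on UNIV h"
  shows "(\<lambda>p. moll p h x) \<longlonglongrightarrow> h x"
proof (rule LIMSEQ_I)
  fix r :: real assume r: "0 < r"
  have "isCont h x" using h by (simp add: continuous_on_eq_continuous_at)
  then obtain d where d: "d > 0" "\<And>y. dist y x < d \<Longrightarrow> dist (h y) (h x) < r / 2"
    unfolding continuous_at_eps_delta using r by (metis half_gt_zero)
  obtain N where N: "inverse (Suc N) < d" using reals_Archimedean[OF d(1)] by auto
  show "\<exists>no. \<forall>p\<ge>no. norm (moll p h x - h x) < r"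
  proof (intro exI allI impI)
    fix p assume "p \<ge> N"
    then have "inverse (real (Suc p)) \<le> inverse (Suc N)" by simp
    with N have "inverse (real (Suc p)) < d" by linarith
    then have "\<bar>h y - h x\<bar> \<le> r / 2" if "dist x y \<le> inverse (Suc p)" for y
      using d(2)[of y] that by (simp add: dist_real_def dist_commute less_imp_le)
    then have "\<bar>moll p h x - h x\<bar> \<le> r / 2" by (rule moll_approx[OF h])
    then show "norm (moll p h x - h x) < r" using r by simp
  qed
qed

lemma C1b_iff: "C1b h \<longleftrightarrow> C1_on UNIV h \<and> (\<exists>B. \<forall>x. \<bar>h x\<bar> \<le> B \<and> (\<forall>i. \<bar>pd h i x\<bar> \<le> B))"
proof
  assume h: "C1b h"
  then obtain B0 where B0: "\<And>x. \<bar>h x\<bar> \<le> B0" unfolding C1b_def bounded_iff by auto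
  have "\<forall>i. \<exists>b. \<forall>x. \<bar>pd h i x\<bar> \<le> b" using h unfolding C1b_def bounded_iff by auto
  then obtain b where b: "\<And>i x. \<bar>pd h i x\<bar> \<le> b i" by metis
  have "\<bar>h x\<bar> \<le> \<bar>B0\<bar> + (\<Sum>i\<in>UNIV. \<bar>b i\<bar>)" for x
    using B0[of x] sum_nonneg[of UNIV "\<lambda>i. \<bar>b i\<bar>"] by (meson abs_ge_self abs_ge_zero add_increasing2 order_trans)
  moreover have "\<bar>pd h i x\<bar> \<le> \<bar>B0\<bar> + (\<Sum>i\<in>UNIV. \<bar>b i\<bar>)" for i x
    using b[of i x] member_le_sum[of i UNIV "\<lambda>i. \<bar>b i\<bar>"] by simp
  ultimately show "C1_on UNIV h \<and> (\<exists>B. \<forall>x. \<bar>h x\<bar> \<le> B \<and> (\<forall>i. \<bar>pd h i x\<bar> \<le> B))"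
    using h unfolding C1b_def by blast
qed (auto simp: C1b_def bounded_iff)

text \<open>First derivatives keep the bound of h by \<open>moll_pd\<close>. For second derivatives
  one derivative more than h possesses is taken, so they are put on the kernel; the resulting bound
  depends on p, which is harmless because it only serves to make d\<alpha> a test form for fixed
  p.\<close>

lemma moll_C1b:
  assumes h: "C1b h" shows "C1b (moll p h)" "C1b (pd (moll p h) i)"
proof -
  obtain B where B: "\<And>x. \<bar>h x\<bar> \<le> B" "\<And>x i. \<bar>pd h i x\<bar> \<le> B" and C: "C1_on UNIV h"
    using h unfolding C1b_iff by blast
  have b: "\<bar>moll p h x\<bar> \<le> B" "\<bar>pd (moll p h) i x\<bar> \<le> B" for x i
    unfolding moll_pd[OF C] by (rule moll_bound; use B C in \<open>auto intro: C1_on_continuous C1_on_continuous_pd\<close>)+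
  then show "C1b (moll p h)" unfolding C1b_iff using moll_C1[OF C1_on_continuous[OF C]] by blast
  obtain \<kappa> :: "(real, 'a) vec \<Rightarrow> real" where \<kappa>: "mollifier (inverse (Suc p)) \<kappa>" "moll p = conv \<kappa>" by (rule moll_conv)
  have k2: "continuous_on UNIV (pd (pd \<kappa> i) j)" "supp_ball (inverse (Suc p)) (pd (pd \<kappa> i) j)" for j
    using C1_on_continuous_pd[OF mollifierD(4)[OF \<kappa>(1)]] supp_ball_pd[OF supp_ball_pd[OF mollifierD(2)[OF \<kappa>(1)]]]
    by blast+
  have eq: "pd (pd (moll p h) i) j = conv (pd (pd \<kappa> i) j) h" for j
    unfolding \<kappa>(2) conv_C1(2)[OF mollifierD(1,2)[OF \<kappa>(1)] C1_on_continuous[OF C]]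
    by (rule conv_C1(2)[OF mollifierD(4)[OF \<kappa>(1)] supp_ball_pd[OF mollifierD(2)[OF \<kappa>(1)]] C1_on_continuous[OF C]])
  have "bounded (range (pd (pd (moll p h) i) j))" for j
    unfolding bounded_iff eq using conv_bound[OF k2 C1_on_continuous[OF C] B(1)] by auto
  moreover have "bounded (range (pd (moll p h) i))" unfolding bounded_iff using b by auto
  moreover have "C1_on UNIV (pd (moll p h) i)"
    unfolding moll_pd[OF C] by (rule moll_C1[OF C1_on_continuous_pd[OF C]])
  ultimately show "C1b (pd (moll p h) i)" unfolding C1b_def by blast
qed

lemma C1_0_C1b:
  assumes "C1_0 U g" shows "C1b g"
proof -
  obtain K where C: "C1_on UNIV g" and K: "compact K" "\<And>x. x \<notin> K \<Longrightarrow> g x = 0"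
    using assms unfolding C1_0_def by auto
  have pd0: "pd g i x = 0" if "x \<notin> K" for x i
  proof -
    have "pd g i x = pd (\<lambda>_. 0) i x"
      using K that by (intro pd_cong_open[of "- K"]) (auto simp: compact_imp_closed)
    then show ?thesis by (simp add: pd_const)
  qed
  have *: "bounded (range f)" if f: "continuous_on UNIV f" and 0: "\<And>x. x \<notin> K \<Longrightarrow> f x = 0" for f :: "_ \<Rightarrow> real"
  proof -
    have "bounded (insert 0 (f ` K))"
      using compact_imp_bounded[OF compact_continuous_image[OF continuous_on_subset[OF f] K(1)]] by simp
    then show ?thesis by (rule bounded_subset) (use 0 in auto)
  qed
  show ?thesis unfolding C1b_def
    using C K * pd0 by (simp add: C1_on_continuous C1_on_continuous_pd)
qed

lemma compact_infdist_le:
  fixes K :: "'a::heine_borel set"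
  assumes "compact K" "K \<noteq> {}" shows "compact {x. infdist x K \<le> r}"
proof -
  have "closed {x. infdist x K \<le> r}" by (intro closed_Collect_le continuous_intros)
  moreover obtain a R where R: "K \<subseteq> cball a R" using assms bounded_subset_cball compact_imp_bounded by metis
  have "{x. infdist x K \<le> r} \<subseteq> cball a (R + r)"
  proof
    fix x assume "x \<in> {x. infdist x K \<le> r}"
    moreover obtain y where "y \<in> K" "infdist x K = dist x y"
      using infdist_attains_inf[of K x] assms by (auto simp: compact_imp_closed)
    ultimately show "x \<in> cball a (R + r)" using R dist_triangle[of a x y] by (auto simp: dist_commute)
  qed
  ultimately show ?thesis using bounded_subset[OF bounded_cball] by (auto simp: compact_eq_bounded_closed)
qed

text \<open>Mollifying enlarges the support by at most 1/(p + 1), which must fit inside a closed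
  neighbourhood of the old support contained in U; hence only for large p.\<close>

lemma moll_C1_0:
  assumes U: "open U" and g: "C1_0 U g"
  shows "eventually (\<lambda>p. C1_0 U (moll p g)) sequentially"
proof -
  obtain K where C: "C1_on UNIV g" and K: "compact K" "K \<subseteq> U" "\<And>x. x \<notin> K \<Longrightarrow> g x = 0"
    using g unfolding C1_0_def by auto
  note g_cont = C1_on_continuous[OF C]
  show ?thesis
  \<comment> \<open>The distance \<open>infdist\<close> to the empty set is 0 by convention, so the
    neighbourhoods used below describe nothing in this case.\<close>
  proof (cases "K = {}")
    case True
    have "moll p g x = 0" for p x
      using moll_bound[OF g_cont, of x p 0] K(3) True by simp
    then show ?thesis unfolding C1_0_def using moll_C1[OF g_cont]
      by (intro always_eventually allI conjI exI[of _ "{}"]) auto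
  next
    case False
    obtain e where e: "e > 0" "{x. infdist x K \<le> e} \<subseteq> U"
      using compact_in_open_separated[OF False K(1) U K(2)] by blast
    obtain N where N: "inverse (Suc N) < e" using reals_Archimedean[OF e(1)] by auto
    show ?thesis
    proof (rule eventually_sequentiallyI)
      fix p assume "p \<ge> N"
      then have "inverse (real (Suc p)) \<le> inverse (Suc N)" by simp
      with N have r: "inverse (real (Suc p)) < e" by linarith
      have "moll p g x = 0" if x: "x \<notin> {x. infdist x K \<le> e}" for x
      proof -
        have "g y = 0" if "dist x y \<le> inverse (Suc p)" for y
        proof (rule K(3), rule notI)
          assume "y \<in> K"
          then have "infdist x K \<le> dist x y" by (rule infdist_le)
          then show False using that x r by simp
        qed
        then show ?thesis using moll_bound[OF g_cont, of x p 0] by simp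
      qed
      then show "C1_0 U (moll p g)" unfolding C1_0_def
        using moll_C1[OF g_cont] compact_infdist_le[OF K(1) False] e(2) by blast
    qed
  qed
qed

lemma C1_cutoff:
  fixes K U :: "((real, 'd::finite) vec) set"
  assumes K: "compact K" "K \<subseteq> U" and U: "open U"
  obtains \<psi> V where "C1_0 U \<psi>" "open V" "K \<subseteq> V" "\<And>x. x \<in> V \<Longrightarrow> \<psi> x = 1"
proof (cases "K = {}")
  case True
  have "C1_0 U (\<lambda>_. 0)" unfolding C1_0_def by (auto simp: C1_on_const intro!: exI[of _ "{}"])
  with True show thesis by (intro that[of _ "{}"]) auto
next
  case False
  obtain e where e: "e > 0" "{x. infdist x K \<le> e} \<subseteq> U"
    using compact_in_open_separated[OF False K(1) U K(2)] by blast
  define d where "d = e / 4"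
  obtain N where N: "inverse (Suc N) < d" using reals_Archimedean[of d] e(1) unfolding d_def by auto
  have d0: "d > 0" using e by (simp add: d_def)
  \<comment> \<open>A piecewise linear profile of the distance to K: 1 up to 2d and 0 from 3d on.
    Mollifying at a radius below d leaves it 1 where the distance is less than d and 0 where it
    exceeds 4d = e.\<close>
  define h where "h x = max 0 (min 1 (3 - infdist x K / d))" for x
  have hc: "continuous_on UNIV h" unfolding h_def by (intro continuous_intros) (use d0 in auto)
  have 1: "moll N h x = 1" if "infdist x K < d" for x
  proof -
    have "h y = 1" if y: "dist x y \<le> inverse (Suc N)" for y
    proof -
      have "infdist y K \<le> 2 * d"
        using infdist_triangle[of y K x] y N \<open>infdist x K < d\<close> by (simp add: dist_commute)
      then show ?thesis using d0 by (simp add: h_def field_simps)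
    qed
    then show ?thesis using moll_approx[OF hc, of x N 0] by simp
  qed
  have 0: "moll N h x = 0" if "x \<notin> {x. infdist x K \<le> 4 * d}" for x
  proof -
    have "h y = 0" if y: "dist x y \<le> inverse (Suc N)" for y
    proof -
      have "infdist y K \<ge> 3 * d"
        using infdist_triangle[of x K y] y N that \<open>x \<notin> {x. infdist x K \<le> 4 * d}\<close> by simp
      then show ?thesis using d0 by (simp add: h_def field_simps)
    qed
    then show ?thesis using moll_bound[OF hc, of x N 0] by simp
  qed
  have "{x. infdist x K \<le> 4 * d} \<subseteq> U" using e by (auto simp: d_def)
  then have "C1_0 U (moll N h)" unfolding C1_0_def
    using moll_C1[OF hc] compact_infdist_le[OF K(1) False] 0 by blast
  moreover have "open {x. infdist x K < d}" by (intro open_Collect_less continuous_intros)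
  moreover have "K \<subseteq> {x. infdist x K < d}" using d0 by auto
  ultimately show thesis by (rule that) (use 1 in auto)
qed

section \<open>Pullbacks and Stokes' theorem for smooth data\<close>

lemma minor_jac_C1:
  assumes g2: "\<And>\<nu> \<mu>. C1_on S (pd (\<lambda>x. g x $ \<nu>) \<mu>)"
  shows "C1_on S (\<lambda>x. minor (jac g x) I J)"
  unfolding minor_def jac_def
  by (simp, intro C1_on_sum C1_on_mult C1_on_const C1_on_prod g2)

lemma pd_minor_jac:
  assumes g2: "\<And>\<nu> \<mu>. pd (\<lambda>x. g x $ \<nu>) \<mu> differentiable at x"
  shows "pd (\<lambda>x. minor (jac g x) I J) i x = (\<Sum>\<sigma>\<in>bijs J I. sgn_bij \<sigma> J *
     (\<Sum>l\<in>J. pd (pd (\<lambda>x. g x $ \<sigma> l) l) i x * (\<Prod>y\<in>J - {l}. jac g x $ \<sigma> y $ y)))"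
proof -
  obtain h where h: "\<And>\<nu> \<mu>. (pd (\<lambda>x. g x $ \<nu>) \<mu> has_derivative h \<nu> \<mu>) (at x)"
    using g2 unfolding differentiable_def by metis
  have dp: "(\<lambda>x. \<Prod>j\<in>J. pd (\<lambda>x. g x $ \<sigma> j) j x) differentiable at x" for \<sigma>
    unfolding differentiable_def by (rule exI, rule has_derivative_prod, rule h)
  have "pd (\<lambda>x. minor (jac g x) I J) i x = (\<Sum>\<sigma>\<in>bijs J I. pd (\<lambda>x. sgn_bij \<sigma> J * (\<Prod>j\<in>J. pd (\<lambda>x. g x $ \<sigma> j) j x)) i x)"
    unfolding minor_def jac_def by (simp, rule pd_sum) (intro differentiable_mult dp, simp)
  also have "\<dots> = (\<Sum>\<sigma>\<in>bijs J I. sgn_bij \<sigma> J *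
     (\<Sum>l\<in>J. pd (pd (\<lambda>x. g x $ \<sigma> l) l) i x * (\<Prod>y\<in>J - {l}. pd (\<lambda>x. g x $ \<sigma> y) y x)))"
    by (rule sum.cong[OF refl]) (simp add: pd_cmult[OF dp] pd_prod[OF g2])
  finally show ?thesis by (simp add: jac_def)
qed

text \<open>Both sides range over the same flags, a k-set inside a (k+1)-set. Applied to row sets in
  the pullback formula and to column sets in the Leibniz rule.\<close>

lemma sum_subset_insert_reindex:
  fixes F :: "'a::finite set \<Rightarrow> 'a \<Rightarrow> real"
  shows "(\<Sum>I\<in>{I. card I = k}. \<Sum>\<nu>\<in>- I. F I \<nu>) = (\<Sum>L\<in>{L. card L = k + 1}. \<Sum>\<nu>\<in>L. F (L - {\<nu>}) \<nu>)"
proof -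
  have "(\<Sum>I\<in>{I. card I = k}. \<Sum>\<nu>\<in>- I. F I \<nu>) = (\<Sum>(I, \<nu>)\<in>(SIGMA I:{I. card I = k}. - I). F I \<nu>)"
    by (rule sum.Sigma) auto
  also have "\<dots> = (\<Sum>(L, \<nu>)\<in>(SIGMA L:{L. card L = k + 1}. L). F (L - {\<nu>}) \<nu>)"
    by (rule sum.reindex_bij_witness[where i = "\<lambda>(L, \<nu>). (L - {\<nu>}, \<nu>)" and j = "\<lambda>(I, \<nu>). (insert \<nu> I, \<nu>)"]) auto
  also have "\<dots> = (\<Sum>L\<in>{L. card L = k + 1}. \<Sum>\<nu>\<in>L. F (L - {\<nu>}) \<nu>)"
    by (rule sum.Sigma[symmetric]) auto
  finally show ?thesis .
qed

lemma extd_pullback: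
  fixes g :: "(real, 'm::{finite,linorder}) vec \<Rightarrow> (real, 'n::{finite,linorder}) vec"
  assumes g: "\<And>\<nu>. C1_on UNIV (\<lambda>x. g x $ \<nu>)" "\<And>\<nu> \<mu>. C1_on UNIV (pd (\<lambda>x. g x $ \<nu>) \<mu>)"
    and g_sym: "\<And>\<nu> i j x. pd (pd (\<lambda>x. g x $ \<nu>) i) j x = pd (pd (\<lambda>x. g x $ \<nu>) j) i x"
    and \<alpha>: "\<And>I. card I = k \<Longrightarrow> C1_on UNIV (\<alpha> I)"
  shows "extd (pullback g (jac g) k \<alpha>) K x = pullback g (jac g) (k + 1) (extd \<alpha>) K x"
proof -
  define M where "M = jac g x"
  have M: "M $ \<nu> $ i = pd (\<lambda>x. g x $ \<nu>) i x" for \<nu> i by (simp add: M_def jac_def)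
  have dg: "(\<lambda>x. g x $ \<nu>) differentiable at x" for \<nu> x using g(1) by (simp add: C1_on_iff)
  have dm: "(\<lambda>x. minor (jac g x) I J) differentiable at x" for I J x
    using minor_jac_C1[OF g(2)] by (simp add: C1_on_iff)
  have d\<alpha>: "\<alpha> I differentiable at y" if "card I = k" for I y using \<alpha>[OF that] by (simp add: C1_on_iff)
  note da = pd_compose(2)[OF dg d\<alpha>]
  have "pd (pullback g (jac g) k \<alpha> J) i x = (\<Sum>I\<in>{I. card I = k}.
      (\<Sum>\<nu>\<in>UNIV. M $ \<nu> $ i * pd (\<alpha> I) \<nu> (g x)) * minor M I J + \<alpha> I (g x) * pd (\<lambda>x. minor (jac g x) I J) i x)" for J i
  proof -
    have "pd (pullback g (jac g) k \<alpha> J) i x = pd (\<lambda>x. \<Sum>I\<in>{I. card I = k}. \<alpha> I (g x) * minor (jac g x) I J) i x"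
      by (rule arg_cong[where f = "\<lambda>h. pd h i x"]) (simp add: fun_eq_iff pullback_def)
    also have "\<dots> = (\<Sum>I\<in>{I. card I = k}. pd (\<lambda>x. \<alpha> I (g x) * minor (jac g x) I J) i x)"
      by (rule pd_sum) (auto intro!: differentiable_mult da dm)
    also have "\<dots> = (\<Sum>I\<in>{I. card I = k}. (\<Sum>\<nu>\<in>UNIV. M $ \<nu> $ i * pd (\<alpha> I) \<nu> (g x)) * minor M I J + \<alpha> I (g x) * pd (\<lambda>x. minor (jac g x) I J) i x)"
      by (rule sum.cong[OF refl], subst pd_mult[OF da dm]) (simp_all add: pd_compose(1)[OF dg d\<alpha>] M M_def[symmetric])
    finally show ?thesis .
  qed
  then have "extd (pullback g (jac g) k \<alpha>) K x = (\<Sum>i\<in>K. sgn_pair {i} (K - {i}) * (\<Sum>I\<in>{I. card I = k}.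
      (\<Sum>\<nu>\<in>UNIV. M $ \<nu> $ i * pd (\<alpha> I) \<nu> (g x)) * minor M I (K - {i}) + \<alpha> I (g x) * pd (\<lambda>x. minor (jac g x) I (K - {i})) i x))"
    by (simp add: extd_def)
  also have "\<dots> = (\<Sum>I\<in>{I. card I = k}. \<Sum>\<nu>\<in>UNIV. pd (\<alpha> I) \<nu> (g x) * (\<Sum>i\<in>K. sgn_pair {i} (K - {i}) * (M $ \<nu> $ i * minor M I (K - {i}))))
      + (\<Sum>I\<in>{I. card I = k}. \<alpha> I (g x) * (\<Sum>i\<in>K. sgn_pair {i} (K - {i}) * pd (\<lambda>x. minor (jac g x) I (K - {i})) i x))" (is "_ = ?A + ?B")
  proof -
    have "?A = (\<Sum>i\<in>K. \<Sum>I\<in>{I. card I = k}. sgn_pair {i} (K - {i}) * ((\<Sum>\<nu>\<in>UNIV. M $ \<nu> $ i * pd (\<alpha> I) \<nu> (g x)) * minor M I (K - {i})))"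
      unfolding sum_distrib_left sum_distrib_right
      by (subst (3) sum.swap, subst (2) sum.swap) (simp add: mult_ac)
    moreover have "?B = (\<Sum>i\<in>K. \<Sum>I\<in>{I. card I = k}. sgn_pair {i} (K - {i}) * (\<alpha> I (g x) * pd (\<lambda>x. minor (jac g x) I (K - {i})) i x))"
      unfolding sum_distrib_left by (subst sum.swap) (simp add: mult_ac)
    ultimately show ?thesis
      by (simp add: sum_distrib_left distrib_left sum.distrib)
  qed
  also have "?B = 0"
  proof (rule sum.neutral, intro ballI)
    fix I
    have "(\<Sum>i\<in>K. sgn_pair {i} (K - {i}) * pd (\<lambda>x. minor (jac g x) I (K - {i})) i x)
       = (\<Sum>i\<in>K. sgn_pair {i} (K - {i}) * (\<Sum>\<sigma>\<in>bijs (K - {i}) I. sgn_bij \<sigma> (K - {i}) *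
     (\<Sum>l\<in>K - {i}. pd (pd (\<lambda>x. g x $ \<sigma> l) l) i x * (\<Prod>y\<in>K - {i} - {l}. jac g x $ \<sigma> y $ y))))"
      using g(2) by (simp add: pd_minor_jac C1_on_iff)
    also have "\<dots> = 0"
      by (rule alternating_sum_symmetric_eq_0[where S = "\<lambda>\<nu> i l. pd (pd (\<lambda>x. g x $ \<nu>) l) i x" and M = "\<lambda>\<nu> y. jac g x $ \<nu> $ y"])
        (rule g_sym)
    finally show "\<alpha> I (g x) * (\<Sum>i\<in>K. sgn_pair {i} (K - {i}) * pd (\<lambda>x. minor (jac g x) I (K - {i})) i x) = 0" by simp
  qed
  \<comment> \<open>In \<open>?A\<close> the derivative falls on the coefficients. An index \<nu> in
    I repeats a row and drops out; an index outside I completes I to a minor of size k + 1.\<close>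
  also have "?A = (\<Sum>I\<in>{I. card I = k}. \<Sum>\<nu>\<in>- I. pd (\<alpha> I) \<nu> (g x) * (sgn_pair {\<nu>} I * minor M (insert \<nu> I) K))"
  proof (rule sum.cong[OF refl])
    fix I
    show "(\<Sum>\<nu>\<in>UNIV. pd (\<alpha> I) \<nu> (g x) * (\<Sum>i\<in>K. sgn_pair {i} (K - {i}) * (M $ \<nu> $ i * minor M I (K - {i}))))
      = (\<Sum>\<nu>\<in>- I. pd (\<alpha> I) \<nu> (g x) * (sgn_pair {\<nu>} I * minor M (insert \<nu> I) K))"
      by (rule sum.mono_neutral_cong_right) (auto simp: laplace_repeated laplace_insert)
  qed
  also have "\<dots> = (\<Sum>L\<in>{L. card L = k + 1}. \<Sum>\<nu>\<in>L. pd (\<alpha> (L - {\<nu>})) \<nu> (g x) * (sgn_pair {\<nu>} (L - {\<nu>}) * minor M (insert \<nu> (L - {\<nu>})) K))"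
    by (rule sum_subset_insert_reindex)
  also have "\<dots> = pullback g (jac g) (k + 1) (extd \<alpha>) K x"
    unfolding pullback_def extd_def sum_distrib_right M_def[symmetric]
    by (intro sum.cong refl) (simp add: insert_absorb mult_ac)
  finally show ?thesis by simp
qed

section \<open>Signs of the wedge product, the Leibniz rule and Stokes' theorem\<close>

lemma sgn_pair_Un_left:
  assumes "finite A" "finite B" "finite C" "A \<inter> B = {}"
  shows "sgn_pair (A \<union> B) C = sgn_pair A C * sgn_pair B C"
proof -
  have "{(i, j). i \<in> A \<union> B \<and> j \<in> C \<and> j < i} = {(i, j). i \<in> A \<and> j \<in> C \<and> j < i} \<union> {(i, j). i \<in> B \<and> j \<in> C \<and> j < i}" by auto
  moreover have "finite {(i, j). i \<in> A \<and> j \<in> C \<and> j < i}" "finite {(i, j). i \<in> B \<and> j \<in> C \<and> j < i}"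
    by (rule finite_subset[of _ "A \<times> C"] finite_subset[of _ "B \<times> C"]; use assms in auto)+
  moreover have "{(i, j). i \<in> A \<and> j \<in> C \<and> j < i} \<inter> {(i, j). i \<in> B \<and> j \<in> C \<and> j < i} = {}" using assms by auto
  ultimately show ?thesis unfolding sgn_pair_def by (simp add: card_Un_disjoint power_add)
qed

lemma sgn_pair_Un_right:
  assumes "finite A" "finite B" "finite C" "A \<inter> B = {}"
  shows "sgn_pair C (A \<union> B) = sgn_pair C A * sgn_pair C B"
proof -
  have "{(i, j). i \<in> C \<and> j \<in> A \<union> B \<and> j < i} = {(i, j). i \<in> C \<and> j \<in> A \<and> j < i} \<union> {(i, j). i \<in> C \<and> j \<in> B \<and> j < i}" by auto
  moreover have "finite {(i, j). i \<in> C \<and> j \<in> A \<and> j < i}" "finite {(i, j). i \<in> C \<and> j \<in> B \<and> j < i}"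
    by (rule finite_subset[of _ "C \<times> A"] finite_subset[of _ "C \<times> B"]; use assms in auto)+
  moreover have "{(i, j). i \<in> C \<and> j \<in> A \<and> j < i} \<inter> {(i, j). i \<in> C \<and> j \<in> B \<and> j < i} = {}" using assms by auto
  ultimately show ?thesis unfolding sgn_pair_def by (simp add: card_Un_disjoint power_add)
qed

text \<open>Each element of I is an inversion on exactly one of the two sides, according to whether
  it lies above or below i; this is the cost of moving dx_i past dx_I.\<close>

lemma sgn_pair_sing_swap:
  assumes "finite I" "i \<notin> I"
  shows "sgn_pair I {i} * sgn_pair {i} I = (-1) ^ card I"
proof -
  have "{(x, y). x \<in> I \<and> y \<in> {i} \<and> y < x} = (\<lambda>x. (x, i)) ` {x \<in> I. i < x}" by auto
  then have 1: "sgn_pair I {i} = (-1) ^ card {x \<in> I. i < x}"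
    unfolding sgn_pair_def by (simp add: card_image inj_on_def)
  have "I = {x \<in> I. i < x} \<union> {x \<in> I. x < i}" using assms by (auto simp: not_less_iff_gr_or_eq)
  then have "card I = card {x \<in> I. i < x} + card {x \<in> I. x < i}"
    using assms(1) by (metis (no_types, lifting) card_Un_disjoint disjoint_iff finite_Un mem_Collect_eq order_less_asym)
  then show ?thesis by (simp add: 1 sgn_pair_sing power_add)
qed

lemma sgn_pair_sq: "sgn_pair A B * sgn_pair A B = 1"
  unfolding sgn_pair_def by (simp flip: power_mult_distrib)

lemma sgn_pair_move:
  fixes I :: "'m::{finite,linorder} set"
  assumes "i \<notin> I"
  shows "sgn_pair I (UNIV - I) * sgn_pair {i} (UNIV - I - {i})
    = (-1) ^ card I * (sgn_pair (insert i I) (UNIV - insert i I) * sgn_pair {i} I)"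
proof -
  define J where "J = UNIV - insert i I"
  have "UNIV - I = {i} \<union> J" "UNIV - I - {i} = J" using assms by (auto simp: J_def)
  moreover have "sgn_pair I ({i} \<union> J) = sgn_pair I {i} * sgn_pair I J"
    by (rule sgn_pair_Un_right) (auto simp: J_def)
  moreover have "sgn_pair ({i} \<union> I) J = sgn_pair {i} J * sgn_pair I J"
    by (rule sgn_pair_Un_left) (use assms in auto)
  moreover have "sgn_pair I {i} = (-1) ^ card I * sgn_pair {i} I"
    using sgn_pair_sing_swap[OF _ assms] sgn_pair_sq[of "{i}" I] by (metis finite mult.assoc mult.right_neutral)
  ultimately show ?thesis by (simp flip: J_def)
qed

text \<open>The Leibniz rule \<open>d(\<beta> \<and> \<phi>) = d\<beta> \<and> \<phi> + (-1)^k \<beta> \<and> d\<phi>\<close> in top degree.\<close>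
lemma wedge_extd:
  fixes \<beta> \<phi> :: "'m::{finite,linorder} set \<Rightarrow> (real, 'm) vec \<Rightarrow> real"
  assumes k: "k + 1 \<le> CARD('m)"
    and \<beta>: "\<And>I. card I = k \<Longrightarrow> \<beta> I differentiable at x"
    and \<phi>: "\<And>J. card J = CARD('m) - k - 1 \<Longrightarrow> \<phi> J differentiable at x"
  shows "wedge k \<beta> (CARD('m) - k) (extd \<phi>) UNIV x - (-1) ^ (k + 1) * wedge (k + 1) (extd \<beta>) (CARD('m) - k - 1) \<phi> UNIV x
    = (\<Sum>I\<in>{I. card I = k}. \<Sum>i\<in>- I. sgn_pair I (UNIV - I) * sgn_pair {i} (UNIV - I - {i}) * pd (\<lambda>x. \<beta> I x * \<phi> (UNIV - I - {i}) x) i x)"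
proof -
  let ?s = "\<lambda>I i. sgn_pair I (UNIV - I) * sgn_pair {i} (UNIV - I - {i})"
  have card: "card (UNIV - I) = CARD('m) - card I" for I :: "'m set" by (simp add: card_Diff_subset)
  have card': "card (UNIV - I - {i}) = CARD('m) - card I - 1" if "i \<notin> I" for I :: "'m set" and i
    using that by (subst card_Diff_singleton) (auto simp: card)
  have "wedge k \<beta> (CARD('m) - k) (extd \<phi>) UNIV x = (\<Sum>I\<in>{I. card I = k}. \<Sum>i\<in>- I. ?s I i * (\<beta> I x * pd (\<phi> (UNIV - I - {i})) i x))"
    unfolding wedge_def extd_def
    by (rule sum.cong) (auto simp: card sum_distrib_left mult_ac Compl_eq_Diff_UNIV)
  \<comment> \<open>Reindexing from (k+1)-sets to k-sets produces (-1)^k through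
    \<open>sgn_pair_move\<close>; against (-1)^(k + 1) this leaves the single minus sign.\<close>
  moreover have "(-1) ^ (k + 1) * wedge (k + 1) (extd \<beta>) (CARD('m) - k - 1) \<phi> UNIV x
    = - (\<Sum>I\<in>{I. card I = k}. \<Sum>i\<in>- I. ?s I i * (pd (\<beta> I) i x * \<phi> (UNIV - I - {i}) x))"
  proof -
    have "wedge (k + 1) (extd \<beta>) (CARD('m) - k - 1) \<phi> UNIV x
      = (\<Sum>L\<in>{L. card L = k + 1}. \<Sum>i\<in>L. sgn_pair L (UNIV - L) * sgn_pair {i} (L - {i}) * (pd (\<beta> (L - {i})) i x * \<phi> (UNIV - L) x))"
      unfolding wedge_def extd_def
      by (rule sum.cong) (auto simp: card sum_distrib_left sum_distrib_right mult_ac)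
    also have "\<dots> = (\<Sum>L\<in>{L. card L = k + 1}. \<Sum>i\<in>L. (-1) ^ k * (?s (L - {i}) i * (pd (\<beta> (L - {i})) i x * \<phi> (UNIV - (L - {i}) - {i}) x)))"
    proof (intro sum.cong refl)
      fix L :: "'m set" and i assume L: "L \<in> {L. card L = k + 1}" "i \<in> L"
      have ins: "insert i (L - {i}) = L" "UNIV - (L - {i}) - {i} = UNIV - L" and c: "card (L - {i}) = k"
        using L by auto
      have "?s (L - {i}) i = (-1) ^ k * (sgn_pair L (UNIV - L) * sgn_pair {i} (L - {i}))"
        using sgn_pair_move[of i "L - {i}"] unfolding ins c by simp
      moreover have "(-1) ^ k * ((-1) ^ k * a) = a" for a :: real
        by (simp flip: mult.assoc power_mult_distrib)
      ultimately show "sgn_pair L (UNIV - L) * sgn_pair {i} (L - {i}) * (pd (\<beta> (L - {i})) i x * \<phi> (UNIV - L) x)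
        = (-1) ^ k * (?s (L - {i}) i * (pd (\<beta> (L - {i})) i x * \<phi> (UNIV - (L - {i}) - {i}) x))"
        unfolding ins by (simp only: mult.assoc)
    qed
    also have "\<dots> = (\<Sum>I\<in>{I. card I = k}. \<Sum>i\<in>- I. (-1) ^ k * (?s I i * (pd (\<beta> I) i x * \<phi> (UNIV - I - {i}) x)))"
      by (rule sum_subset_insert_reindex[symmetric])
    also have "\<dots> = (-1) ^ k * (\<Sum>I\<in>{I. card I = k}. \<Sum>i\<in>- I. ?s I i * (pd (\<beta> I) i x * \<phi> (UNIV - I - {i}) x))"
      by (simp add: sum_distrib_left)
    finally show ?thesis by (simp flip: mult.assoc power_mult_distrib)
  qed
  moreover have "(\<Sum>I\<in>{I. card I = k}. \<Sum>i\<in>- I. ?s I i * pd (\<lambda>x. \<beta> I x * \<phi> (UNIV - I - {i}) x) i x)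
    = (\<Sum>I\<in>{I. card I = k}. \<Sum>i\<in>- I. ?s I i * (\<beta> I x * pd (\<phi> (UNIV - I - {i})) i x))
      + (\<Sum>I\<in>{I. card I = k}. \<Sum>i\<in>- I. ?s I i * (pd (\<beta> I) i x * \<phi> (UNIV - I - {i}) x))"
    unfolding sum.distrib[symmetric]
  proof (intro sum.cong refl)
    fix I i assume "I \<in> {I :: 'm set. card I = k}" "i \<in> - I"
    then have "\<beta> I differentiable at x" "\<phi> (UNIV - I - {i}) differentiable at x"
      using \<beta> \<phi> card' by auto
    then show "?s I i * pd (\<lambda>x. \<beta> I x * \<phi> (UNIV - I - {i}) x) i x
      = ?s I i * (\<beta> I x * pd (\<phi> (UNIV - I - {i})) i x) + ?s I i * (pd (\<beta> I) i x * \<phi> (UNIV - I - {i}) x)"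
      by (simp add: pd_mult distrib_left)
  qed
  ultimately show ?thesis by simp
qed

lemma C1_0_support:
  assumes "C1_0 U \<phi>"
  obtains K where "compact K" "K \<subseteq> U" "\<And>x. x \<notin> K \<Longrightarrow> \<phi> x = 0" "\<And>x i. x \<notin> K \<Longrightarrow> pd \<phi> i x = 0"
proof -
  obtain K where K: "compact K" "K \<subseteq> U" "\<And>x. x \<notin> K \<Longrightarrow> \<phi> x = 0"
    using assms unfolding C1_0_def by auto
  have "pd \<phi> i x = 0" if "x \<notin> K" for x i
  proof -
    have "pd \<phi> i x = pd (\<lambda>_. 0) i x"
      using K that by (intro pd_cong_open[of "- K"]) (auto simp: compact_imp_closed)
    then show ?thesis by (simp add: pd_const)
  qed
  with K show thesis by (rule that)
qed

lemma integrable_compact_support: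
  fixes F :: "'a::euclidean_space \<Rightarrow> real"
  assumes F: "continuous_on UNIV F" and K: "compact K" "\<And>x. x \<notin> K \<Longrightarrow> F x = 0"
  shows "integrable lborel F"
proof -
  obtain a where "K \<subseteq> cbox (-a) a" using bounded_subset_cbox_symmetric[OF compact_imp_bounded[OF K(1)]] by blast
  with K(2) show ?thesis by (intro integral_cont_compact_support(1)[OF F, of "-a" a]) auto
qed

lemma integral_lebesgue_on_compact_support:
  fixes F :: "'a::euclidean_space \<Rightarrow> real"
  assumes F: "continuous_on UNIV F" and K: "K \<subseteq> U" "\<And>x. x \<notin> K \<Longrightarrow> F x = 0" and U: "open U"
  shows "integral\<^sup>L (lebesgue_on U) F = integral\<^sup>L lborel F"
proof -
  have "integral\<^sup>L (lebesgue_on U) F = (\<integral>x. indicator U x *\<^sub>R F x \<partial>lebesgue)"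
    using U by (intro integral_restrict_space) auto
  also have "(\<lambda>x. indicator U x *\<^sub>R F x) = F" by (rule ext) (use K in \<open>auto simp: indicator_def\<close>)
  finally show ?thesis
    using borel_measurable_continuous_onI[OF F] by (simp add: integral_completion)
qed

lemma form_support:
  assumes "C1_0_form U j \<phi>"
  obtains K where "compact K" "K \<subseteq> U" "\<And>J x. card J = j \<Longrightarrow> x \<notin> K \<Longrightarrow> \<phi> J x = 0"
    "\<And>J x i. card J = j \<Longrightarrow> x \<notin> K \<Longrightarrow> pd (\<phi> J) i x = 0"
proof -
  have "\<forall>J. \<exists>K. card J = j \<longrightarrow> compact K \<and> K \<subseteq> U \<and> (\<forall>x. x \<notin> K \<longrightarrow> \<phi> J x = 0) \<and> (\<forall>x i. x \<notin> K \<longrightarrow> pd (\<phi> J) i x = 0)"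
    using assms unfolding C1_0_form_def by (meson C1_0_support)
  then obtain K where K: "\<And>J. card J = j \<Longrightarrow> compact (K J) \<and> K J \<subseteq> U \<and> (\<forall>x. x \<notin> K J \<longrightarrow> \<phi> J x = 0) \<and> (\<forall>x i. x \<notin> K J \<longrightarrow> pd (\<phi> J) i x = 0)"
    by metis
  show thesis
    by (rule that[of "\<Union>J\<in>{J. card J = j}. K J"]) (use K in \<open>fastforce intro!: compact_UN\<close>)+
qed

text \<open>By the Leibniz rule the two integrands differ by a signed sum of partial derivatives of
  products \<beta>_I \<phi>_J. These products inherit compact support from \<phi>, so nothing is
  asked of \<beta> at infinity and each partial derivative integrates to 0.\<close>

lemma stokes_form:
  fixes \<beta> \<phi> :: "'m::{finite,linorder} set \<Rightarrow> (real, 'm) vec \<Rightarrow> real"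
  assumes U: "open U" and k: "k + 1 \<le> CARD('m)"
    and \<beta>: "\<And>I. card I = k \<Longrightarrow> C1_on UNIV (\<beta> I)"
    and \<phi>: "C1_0_form U (CARD('m) - k - 1) \<phi>"
  shows "int_wedge U k \<beta> (CARD('m) - k) (extd \<phi>) = (-1) ^ (k + 1) * int_wedge U (k + 1) (extd \<beta>) (CARD('m) - k - 1) \<phi>"
proof -
  let ?m = "CARD('m)"
  obtain K where K: "compact K" "K \<subseteq> U" "\<And>J x. card J = ?m - k - 1 \<Longrightarrow> x \<notin> K \<Longrightarrow> \<phi> J x = 0"
    "\<And>J x i. card J = ?m - k - 1 \<Longrightarrow> x \<notin> K \<Longrightarrow> pd (\<phi> J) i x = 0"
    by (rule form_support[OF \<phi>]) blast
  have C\<phi>: "C1_on UNIV (\<phi> J)" if "card J = ?m - k - 1" for J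
    using \<phi> that unfolding C1_0_form_def C1_0_def by blast
  have card': "card (UNIV - I - {i}) = ?m - k - 1" if "i \<notin> I" "card I = k" for I :: "'m set" and i
    using that by (subst card_Diff_singleton) (auto simp: card_Diff_subset)
  let ?L = "wedge k \<beta> (?m - k) (extd \<phi>) UNIV" and ?R = "wedge (k + 1) (extd \<beta>) (?m - k - 1) \<phi> UNIV"
  have cont: "continuous_on UNIV ?L" "continuous_on UNIV ?R"
    unfolding wedge_def extd_def
    by (auto intro!: continuous_intros C1_on_continuous[OF \<beta>] C1_on_continuous[OF C\<phi>] C1_on_continuous_pd[OF \<beta>] C1_on_continuous_pd[OF C\<phi>])
  have supp: "?L x = 0" "?R x = 0" if "x \<notin> K" for x
    unfolding wedge_def extd_def using that by (auto intro!: sum.neutral simp: K)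
  have int: "integrable lborel ?L" "integrable lborel ?R"
    by (rule integrable_compact_support[OF cont(1) K(1) supp(1)] integrable_compact_support[OF cont(2) K(1) supp(2)]; assumption)+
  define u where "u I i = (\<lambda>x. \<beta> I x * \<phi> (UNIV - I - {i}) x)" for I i
  have u: "C1_on UNIV (u I i)" "\<And>x. x \<notin> K \<Longrightarrow> u I i x = 0" if "card I = k" "i \<notin> I" for I i
    unfolding u_def using that card' K(3) by (auto intro!: C1_on_mult \<beta> C\<phi>)
  obtain r where r: "\<And>x. x \<in> K \<Longrightarrow> norm x \<le> r" using compact_imp_bounded[OF K(1)] unfolding bounded_iff by blast
  have sb: "supp_ball r (u I i)" if "card I = k" "i \<notin> I" for I i
    unfolding supp_ball_def using u(2)[OF that] r by (meson linorder_not_le)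
  have "integral\<^sup>L lborel ?L - (-1) ^ (k + 1) * integral\<^sup>L lborel ?R = (\<integral>x. ?L x - (-1) ^ (k + 1) * ?R x \<partial>lborel)"
    using int by simp
  also have "\<dots> = (\<integral>x. (\<Sum>I\<in>{I. card I = k}. \<Sum>i\<in>- I. sgn_pair I (UNIV - I) * sgn_pair {i} (UNIV - I - {i}) * pd (u I i) i x) \<partial>lborel)"
    unfolding u_def
    by (rule Bochner_Integration.integral_cong[OF refl], rule wedge_extd[OF k])
      (auto intro!: C1_on_differentiable[OF \<beta>] C1_on_differentiable[OF C\<phi>])
  also have "\<dots> = (\<Sum>I\<in>{I. card I = k}. \<Sum>i\<in>- I. (\<integral>x. sgn_pair I (UNIV - I) * sgn_pair {i} (UNIV - I - {i}) * pd (u I i) i x \<partial>lborel))"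
  proof -
    have i: "integrable lborel (\<lambda>x. sgn_pair I (UNIV - I) * sgn_pair {i} (UNIV - I - {i}) * pd (u I i) i x)"
      if "card I = k" "i \<notin> I" for I i
      using integrable_supp_ball[OF C1_on_continuous_pd[OF u(1)[OF that]] supp_ball_pd[OF sb[OF that]]] by simp
    show ?thesis
    proof (rule trans[OF Bochner_Integration.integral_sum])
      fix I :: "'m set" assume "I \<in> {I. card I = k}"
      then show "integrable lborel (\<lambda>x. \<Sum>i\<in>- I. sgn_pair I (UNIV - I) * sgn_pair {i} (UNIV - I - {i}) * pd (u I i) i x)"
        by (intro Bochner_Integration.integrable_sum i) auto
    qed (intro sum.cong refl Bochner_Integration.integral_sum i, auto)
  qed
  also have "\<dots> = 0"
    using integral_pd_eq_0[OF u(1) sb] by (auto intro!: sum.neutral)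
  finally show ?thesis
    unfolding int_wedge_def
    using integral_lebesgue_on_compact_support[OF cont(1) K(2) supp(1) U] integral_lebesgue_on_compact_support[OF cont(2) K(2) supp(2) U]
    by simp
qed

section \<open>Bounds and dominated convergence\<close>

lemma minor_le_Lam:
  assumes "card I = k" "card J = k"
  shows "\<bar>minor M I J\<bar> \<le> Lam k M"
proof -
  let ?S = "{\<bar>minor M I J\<bar> | I J. card I = k \<and> card J = k}"
  have "?S \<subseteq> (\<lambda>(I, J). \<bar>minor M I J\<bar>) ` UNIV" by auto
  then have "finite ?S" by (rule finite_subset) simp
  moreover have "\<bar>minor M I J\<bar> \<in> ?S" using assms by blast
  ultimately show ?thesis unfolding Lam_def Let_def by (auto intro: Max_ge)
qed

text \<open>The number of bijections is estimated crudely by the number of all functions between the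
  index types; what matters is a constant depending only on E and the dimensions.\<close>

lemma minor_bound:
  fixes M :: "((real, 'm::{finite,linorder}) vec, 'n::{finite,linorder}) vec"
  assumes "\<And>\<nu> \<mu>. \<bar>M $ \<nu> $ \<mu>\<bar> \<le> E"
  shows "\<bar>minor M I J\<bar> \<le> real CARD('m \<Rightarrow> 'n) * E ^ card J"
proof -
  have E: "0 \<le> E" using assms abs_ge_zero order_trans by blast
  have "\<bar>minor M I J\<bar> \<le> (\<Sum>\<sigma>\<in>bijs J I. \<bar>sgn_bij \<sigma> J * (\<Prod>j\<in>J. M $ \<sigma> j $ j)\<bar>)"
    unfolding minor_def by (rule sum_abs)
  also have "\<dots> \<le> (\<Sum>\<sigma>\<in>bijs J I. E ^ card J)"
  proof (rule sum_mono)
    fix \<sigma>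
    have "(\<Prod>j\<in>J. \<bar>M $ \<sigma> j $ j\<bar>) \<le> (\<Prod>j\<in>J. E)" by (rule prod_mono) (use assms in auto)
    then show "\<bar>sgn_bij \<sigma> J * (\<Prod>j\<in>J. M $ \<sigma> j $ j)\<bar> \<le> E ^ card J"
      by (simp add: abs_mult abs_prod sgn_bij_def power_abs)
  qed
  also have "\<dots> = real (card (bijs J I)) * E ^ card J" by simp
  also have "\<dots> \<le> real CARD('m \<Rightarrow> 'n) * E ^ card J"
    using E card_mono[of UNIV "bijs J I"] by (intro mult_right_mono) auto
  finally show ?thesis .
qed

lemma minor_measurable:
  assumes "\<And>\<nu> \<mu>. (\<lambda>x. D x $ \<nu> $ \<mu>) \<in> borel_measurable N"
  shows "(\<lambda>x. minor (D x) I J) \<in> borel_measurable N"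
  unfolding minor_def
proof (rule borel_measurable_sum)
  fix \<sigma>
  have "(\<lambda>x. \<Prod>j\<in>J. D x $ \<sigma> j $ j) \<in> borel_measurable N"
    by (rule borel_measurable_prod) (rule assms)
  then show "(\<lambda>x. sgn_bij \<sigma> J * (\<Prod>j\<in>J. D x $ \<sigma> j $ j)) \<in> borel_measurable N"
    by (rule borel_measurable_times[OF borel_measurable_const])
qed

lemma comp_measurable:
  fixes f :: "'a \<Rightarrow> (real, 'n::finite) vec" and a :: "(real, 'n) vec \<Rightarrow> real"
  assumes "\<And>\<nu>. (\<lambda>x. f x $ \<nu>) \<in> borel_measurable N" "continuous_on UNIV a"
  shows "(\<lambda>x. a (f x)) \<in> borel_measurable N"
proof -
  have "f \<in> borel_measurable N"
    using assms(1) by (subst borel_measurable_euclidean_space) (auto simp: Basis_vec_def inner_axis)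
  then show ?thesis
    by (rule measurable_compose) (rule borel_measurable_continuous_onI[OF assms(2)])
qed

lemma pullback_measurable:
  assumes "\<And>\<nu>. (\<lambda>x. f x $ \<nu>) \<in> borel_measurable N" "\<And>\<nu> \<mu>. (\<lambda>x. D x $ \<nu> $ \<mu>) \<in> borel_measurable N"
    and "\<And>I. card I = k \<Longrightarrow> continuous_on UNIV (\<alpha> I)"
  shows "pullback f D k \<alpha> J \<in> borel_measurable N"
  unfolding pullback_def[abs_def]
  by (rule borel_measurable_sum, rule borel_measurable_times[OF comp_measurable minor_measurable])
    (use assms in auto)

lemma pullback_bound:
  fixes \<alpha> :: "'n::{finite,linorder} set \<Rightarrow> (real, 'n) vec \<Rightarrow> real"
  assumes "\<And>I. card I = k \<Longrightarrow> \<bar>\<alpha> I (f x)\<bar> \<le> a" "\<And>I. card I = k \<Longrightarrow> \<bar>minor (D x) I J\<bar> \<le> C" "0 \<le> a" "0 \<le> C"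
  shows "\<bar>pullback f D k \<alpha> J x\<bar> \<le> real CARD('n set) * (a * C)"
proof -
  have "\<bar>pullback f D k \<alpha> J x\<bar> \<le> (\<Sum>I\<in>{I. card I = k}. \<bar>\<alpha> I (f x) * minor (D x) I J\<bar>)"
    unfolding pullback_def by (rule sum_abs)
  also have "\<dots> \<le> (\<Sum>I\<in>{I :: 'n set. card I = k}. a * C)"
  proof (rule sum_mono)
    fix I :: "'n set" assume "I \<in> {I. card I = k}"
    then show "\<bar>\<alpha> I (f x) * minor (D x) I J\<bar> \<le> a * C"
      unfolding abs_mult using assms by (intro mult_mono) auto
  qed
  also have "\<dots> = real (card {I :: 'n set. card I = k}) * (a * C)" by simp
  also have "\<dots> \<le> real CARD('n set) * (a * C)"
    using card_mono[of UNIV "{I :: 'n set. card I = k}"] assms(3,4) by (intro mult_right_mono) auto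
  finally show ?thesis .
qed

lemma Lam_nonneg:
  fixes M :: "((real, 'm::{finite,linorder}) vec, 'n::{finite,linorder}) vec"
  shows "0 \<le> Lam k M"
proof (cases "(\<exists>I :: 'n set. card I = k) \<and> (\<exists>J :: 'm set. card J = k)")
  case True
  then obtain I :: "'n set" and J :: "'m set" where "card I = k" "card J = k" by blast
  from minor_le_Lam[OF this, of M] show ?thesis by linarith
next
  case False
  then have "{\<bar>minor M I J\<bar> | I J. card I = k \<and> card J = k} = {}" by blast
  then show ?thesis by (simp add: Lam_def)
qed

lemma integrable_pullback:
  assumes "Fk U k f D" and \<alpha>: "\<And>I. card I = k \<Longrightarrow> continuous_on UNIV (\<alpha> I)"
    and b: "\<And>I y. card I = k \<Longrightarrow> \<bar>\<alpha> I y\<bar> \<le> a" "0 \<le> a" and J: "card J = k"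
  shows "integrable (lebesgue_on U) (pullback f D k \<alpha> J)"
proof (rule Bochner_Integration.integrable_bound)
  have w: "weak_jacobian U f D" and L: "integrable (lebesgue_on U) (\<lambda>x. Lam k (D x))"
    using assms(1) unfolding Fk_def by auto
  show "integrable (lebesgue_on U) (\<lambda>x. real CARD('b set) * (a * Lam k (D x)))"
    using L by simp
  show "pullback f D k \<alpha> J \<in> borel_measurable (lebesgue_on U)"
    using w \<alpha> unfolding weak_jacobian_def by (intro pullback_measurable) (auto intro: borel_measurable_integrable)
  show "AE x in lebesgue_on U. norm (pullback f D k \<alpha> J x) \<le> norm (real CARD('b set) * (a * Lam k (D x)))"
  proof (rule AE_I2)
    fix x
    have "\<bar>pullback f D k \<alpha> J x\<bar> \<le> real CARD('b set) * (a * Lam k (D x))"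
      by (rule pullback_bound[OF b(1) minor_le_Lam[OF _ J] b(2) Lam_nonneg])
    then show "norm (pullback f D k \<alpha> J x) \<le> norm (real CARD('b set) * (a * Lam k (D x)))" by simp
  qed
qed

text \<open>Only products of complementary coefficients are compared, so where the test form
  vanishes the other two forms may differ.\<close>

lemma int_wedge_cong:
  fixes \<beta> \<beta>' :: "'m::{finite,linorder} set \<Rightarrow> (real, 'm) vec \<Rightarrow> real"
  assumes "\<And>I x. x \<in> U \<Longrightarrow> card I = k \<Longrightarrow> card (UNIV - I) = j \<Longrightarrow> \<beta> I x * \<omega> (UNIV - I) x = \<beta>' I x * \<omega>' (UNIV - I) x"
  shows "int_wedge U k \<beta> j \<omega> = int_wedge U k \<beta>' j \<omega>'"
  unfolding int_wedge_def wedge_def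
  by (intro Bochner_Integration.integral_cong[OF refl] sum.cong refl)
    (use assms in \<open>simp add: mult.assoc\<close>)

text \<open>One dominated convergence statement for two situations: varying maps with fixed forms
  and a constant majorant C, and a fixed map with varying forms and C the function
  \<open>Lam\<close> of its Jacobian.\<close>

lemma int_wedge_pullback_tendsto:
  fixes F :: "nat \<Rightarrow> (real, 'm::{finite,linorder}) vec \<Rightarrow> (real, 'n::{finite,linorder}) vec"
    and W :: "nat \<Rightarrow> 'm set \<Rightarrow> (real, 'm) vec \<Rightarrow> real"
  assumes F: "\<And>p \<nu>. (\<lambda>x. F p x $ \<nu>) \<in> borel_measurable (lebesgue_on U)"
    and DF: "\<And>p \<nu> \<mu>. (\<lambda>x. DF p x $ \<nu> $ \<mu>) \<in> borel_measurable (lebesgue_on U)"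
    and A: "\<And>p I. card I = k \<Longrightarrow> continuous_on UNIV (A p I)"
    and W: "\<And>p J. card J = j \<Longrightarrow> W p J \<in> borel_measurable (lebesgue_on U)"
    and A_lim: "\<And>x I. x \<in> U \<Longrightarrow> card I = k \<Longrightarrow> (\<lambda>p. A p I (F p x)) \<longlonglongrightarrow> \<alpha> I (f x)"
    and M_lim: "\<And>x I J. x \<in> U \<Longrightarrow> (\<lambda>p. minor (DF p x) I J) \<longlonglongrightarrow> minor (D x) I J"
    and W_lim: "\<And>x J. x \<in> U \<Longrightarrow> card J = j \<Longrightarrow> (\<lambda>p. W p J x) \<longlonglongrightarrow> \<omega> J x"
    and A_bd: "\<And>p I y. card I = k \<Longrightarrow> \<bar>A p I y\<bar> \<le> a" "0 \<le> a"
    and M_bd: "\<And>p x I J. card I = k \<Longrightarrow> card J = k \<Longrightarrow> \<bar>minor (DF p x) I J\<bar> \<le> C x" "\<And>x. 0 \<le> C x"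
    and W_bd: "\<And>p J x. card J = j \<Longrightarrow> \<bar>W p J x\<bar> \<le> b"
    and C: "integrable (lebesgue_on U) C"
  shows "(\<lambda>p. int_wedge U k (pullback (F p) (DF p) k (A p)) j (W p)) \<longlonglongrightarrow> int_wedge U k (pullback f D k \<alpha>) j \<omega>"
proof -
  let ?S = "{I :: 'm set. I \<subseteq> UNIV \<and> card I = k \<and> card (UNIV - I) = j}"
  let ?N = "real CARD('n set)"
  define w where "w x = (\<Sum>I\<in>?S. (?N * (a * C x)) * \<bar>b\<bar>)" for x
  let ?s = "\<lambda>p x. wedge k (pullback (F p) (DF p) k (A p)) j (W p) UNIV x"
  let ?g = "\<lambda>x. wedge k (pullback f D k \<alpha>) j \<omega> UNIV x"
  have meas: "?s p \<in> borel_measurable (lebesgue_on U)" for p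
    unfolding wedge_def
  proof (rule borel_measurable_sum)
    fix I assume "I \<in> ?S"
    then show "(\<lambda>x. sgn_pair I (UNIV - I) * pullback (F p) (DF p) k (A p) I x * W p (UNIV - I) x) \<in> borel_measurable (lebesgue_on U)"
      by (intro borel_measurable_times borel_measurable_const pullback_measurable F DF A W) auto
  qed
  have lim: "(\<lambda>p. ?s p x) \<longlonglongrightarrow> ?g x" if x: "x \<in> U" for x
    unfolding wedge_def pullback_def
    by (intro tendsto_sum tendsto_mult tendsto_const W_lim[OF x] A_lim[OF x] M_lim[OF x]) auto
  have bd: "norm (?s p x) \<le> w x" for p x
  proof -
    have "norm (?s p x) \<le> (\<Sum>I\<in>?S. \<bar>sgn_pair I (UNIV - I) * pullback (F p) (DF p) k (A p) I x * W p (UNIV - I) x\<bar>)"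
      unfolding wedge_def real_norm_def by (rule sum_abs)
    also have "\<dots> \<le> w x" unfolding w_def
    proof (rule sum_mono)
      fix I assume I: "I \<in> ?S"
      have "\<bar>pullback (F p) (DF p) k (A p) I x\<bar> \<le> ?N * (a * C x)"
        by (rule pullback_bound[OF A_bd(1) M_bd(1) A_bd(2) M_bd(2)]) (use I in auto)
      moreover have "\<bar>W p (UNIV - I) x\<bar> \<le> \<bar>b\<bar>"
        using W_bd[of "UNIV - I" p x] I by auto
      ultimately have "\<bar>pullback (F p) (DF p) k (A p) I x\<bar> * \<bar>W p (UNIV - I) x\<bar> \<le> (?N * (a * C x)) * \<bar>b\<bar>"
        by (intro mult_mono) (use A_bd(2) M_bd(2)[of x] in auto)
      then show "\<bar>sgn_pair I (UNIV - I) * pullback (F p) (DF p) k (A p) I x * W p (UNIV - I) x\<bar> \<le> (?N * (a * C x)) * \<bar>b\<bar>"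
        by (simp add: abs_mult sgn_pair_def)
    qed
    finally show ?thesis .
  qed
  show ?thesis unfolding int_wedge_def
  proof (rule integral_dominated_convergence[where w = w])
    show "?g \<in> borel_measurable (lebesgue_on U)"
      by (rule borel_measurable_LIMSEQ_real[OF _ meas]) (use lim in auto)
    show "integrable (lebesgue_on U) w" unfolding w_def using C by (intro Bochner_Integration.integrable_sum) simp
  qed (use meas lim bd in auto)
qed

lemma finite_uniform_bound:
  fixes P :: "'i::finite \<Rightarrow> bool"
  assumes ex: "\<And>I. P I \<Longrightarrow> \<exists>B. Q I B" and mono: "\<And>I B B'. Q I B \<Longrightarrow> B \<le> B' \<Longrightarrow> Q I (B' :: real)"
  obtains B where "0 \<le> B" "\<And>I. P I \<Longrightarrow> Q I B"
proof -
  obtain b where b: "\<And>I. P I \<Longrightarrow> Q I (b I)" using ex by metis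
  have "b I \<le> (\<Sum>i\<in>UNIV. \<bar>b i\<bar>)" for I
    using member_le_sum[of I UNIV "\<lambda>i. \<bar>b i\<bar>"] by simp
  then show thesis by (intro that[of "\<Sum>i\<in>UNIV. \<bar>b i\<bar>"] sum_nonneg) (auto intro: mono[OF b])
qed

lemma C1b_family_bound:
  fixes h :: "'i::finite \<Rightarrow> (real, 'd::finite) vec \<Rightarrow> real"
  assumes "\<And>I. P I \<Longrightarrow> C1b (h I)"
  obtains B where "0 \<le> B" "\<And>I x. P I \<Longrightarrow> \<bar>h I x\<bar> \<le> B" "\<And>I x i. P I \<Longrightarrow> \<bar>pd (h I) i x\<bar> \<le> B"
proof -
  let ?Q = "\<lambda>I B. \<forall>x. \<bar>h I x\<bar> \<le> B \<and> (\<forall>i. \<bar>pd (h I) i x\<bar> \<le> B)"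
  have ex: "\<exists>B. ?Q I B" if "P I" for I
    using assms[OF that] unfolding C1b_iff by blast
  have mono: "?Q I B'" if "?Q I B" "B \<le> B'" for I B B'
    using that by (meson order_trans)
  show thesis
  proof (rule finite_uniform_bound[of P ?Q])
    show "\<exists>B. ?Q I B" if "P I" for I using ex[OF that] .
    show "?Q I B'" if "?Q I B" "B \<le> B'" for I B B' using mono[OF that] .
    fix B assume B: "0 \<le> B" "\<And>I. P I \<Longrightarrow> ?Q I B"
    show thesis by (rule that[OF B(1)]) (use B(2) in blast)+
  qed
qed

lemma extd_bound:
  fixes \<beta> :: "'d::{finite,linorder} set \<Rightarrow> (real, 'd) vec \<Rightarrow> real"
  assumes "\<And>i. i \<in> K \<Longrightarrow> \<bar>pd (\<beta> (K - {i})) i x\<bar> \<le> a" "0 \<le> a"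
  shows "\<bar>extd \<beta> K x\<bar> \<le> real CARD('d) * a"
proof -
  have "\<bar>extd \<beta> K x\<bar> \<le> (\<Sum>i\<in>K. \<bar>sgn_pair {i} (K - {i}) * pd (\<beta> (K - {i})) i x\<bar>)"
    unfolding extd_def by (rule sum_abs)
  also have "\<dots> \<le> (\<Sum>i\<in>K. a)"
    by (rule sum_mono) (use assms in \<open>simp add: abs_mult sgn_pair_def\<close>)
  also have "\<dots> \<le> real CARD('d) * a"
    using assms(2) card_mono[of UNIV K] by (simp add: mult_right_mono)
  finally show ?thesis .
qed

lemma extd_continuous:
  assumes "\<And>I. card I = k \<Longrightarrow> C1_on S (\<beta> I)" "card K = k + 1"
  shows "continuous_on S (extd \<beta> K)"
  unfolding extd_def[abs_def] using assms
  by (intro continuous_intros C1_on_continuous_pd) auto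

lemma extd_tendsto:
  assumes "\<And>I i. card I = k \<Longrightarrow> (\<lambda>p. pd (\<beta> p I) i x) \<longlonglongrightarrow> pd (\<gamma> I) i x" "card K = k + 1"
  shows "(\<lambda>p. extd (\<beta> p) K x) \<longlonglongrightarrow> extd \<gamma> K x"
  unfolding extd_def using assms by (intro tendsto_intros) auto

section \<open>Localisation and extension by zero\<close>

lemma C1_on_cong_open:
  assumes "open S" "\<And>x. x \<in> S \<Longrightarrow> f x = g x" "C1_on S f" shows "C1_on S g"
proof -
  have "pd f i x = pd g i x" "f differentiable at x \<longleftrightarrow> g differentiable at x" if "x \<in> S" for x i
    using pd_cong_open[OF assms(1) that assms(2)] by auto
  then show ?thesis using assms(3) unfolding C1_on_iff by (auto cong: continuous_on_cong)
qed

lemma C1_on_open_Un: "open S \<Longrightarrow> open T \<Longrightarrow> C1_on S f \<Longrightarrow> C1_on T f \<Longrightarrow> C1_on (S \<union> T) f"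
  unfolding C1_on_iff by (auto intro: continuous_on_open_Un)

text \<open>U and the complement of the support K are open and cover the space; on the first the
  function is a product of C1 functions, on the second it is 0.\<close>

lemma C1_0_cutoff_mult:
  assumes U: "open U" and \<psi>: "C1_0 U \<psi>" and f: "C1_on U f"
  shows "C1_0 U (\<lambda>x. if x \<in> U then \<psi> x * f x else 0)" (is "C1_0 U ?h")
proof -
  obtain K where C: "C1_on UNIV \<psi>" and K: "compact K" "K \<subseteq> U" "\<And>x. x \<notin> K \<Longrightarrow> \<psi> x = 0"
    using \<psi> unfolding C1_0_def by blast
  have "C1_on U \<psi>" using C unfolding C1_on_iff by (auto intro: continuous_on_subset)
  then have "C1_on U (\<lambda>x. \<psi> x * f x)" using f by (rule C1_on_mult)
  then have 1: "C1_on U ?h" by (rule C1_on_cong_open[OF U, rotated]) simp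
  have oK: "open (- K)" using K(1) by (simp add: compact_imp_closed open_Compl)
  have 2: "C1_on (- K) ?h" by (rule C1_on_cong_open[OF oK _ C1_on_const[where c = 0]]) (simp add: K)
  have "U \<union> - K = UNIV" using K(2) by auto
  then have "C1_on UNIV ?h" using C1_on_open_Un[OF U oK 1 2] by simp
  then show ?thesis unfolding C1_0_def using K by auto
qed

section \<open>Passage to the limit\<close>

lemma finite_measure_lebesgue_on_bounded_open: "open U \<Longrightarrow> bounded U \<Longrightarrow> finite_measure (lebesgue_on U)"
  by (intro finite_measure_lebesgue_on lmeasurable_open)

lemma continuous_imp_lebesgue_on_measurable:
  fixes F :: "'a::euclidean_space \<Rightarrow> real"
  assumes "continuous_on UNIV F"
  shows "F \<in> borel_measurable (lebesgue_on U)"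
  by (rule measurable_restrict_space1, rule measurable_completion) (simp add: borel_measurable_continuous_onI[OF assms])

lemma pullback_C1:
  assumes g: "\<And>\<nu>. C1_on UNIV (\<lambda>x. g x $ \<nu>)" "\<And>\<nu> \<mu>. C1_on UNIV (pd (\<lambda>x. g x $ \<nu>) \<mu>)"
    and \<alpha>: "\<And>I. card I = k \<Longrightarrow> C1_on UNIV (\<alpha> I)"
  shows "C1_on UNIV (pullback g (jac g) k \<alpha> J)"
  unfolding pullback_def[abs_def]
  by (rule C1_on_sum, rule C1_on_mult[OF C1_on_compose minor_jac_C1]) (use g \<alpha> in auto)

text \<open>The map g is controlled on U only and may be unbounded there, so it is replaced by a
  compactly supported map agreeing with it near the support of \<phi>. That map can be mollified
  with uniform bounds, and its pullbacks may be exchanged for those of g under the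
  integrals.\<close>

lemma stokes_C1_map:
  fixes g :: "(real, 'm::{finite,linorder}) vec \<Rightarrow> (real, 'n::{finite,linorder}) vec"
  assumes U: "open U" "bounded U" and k: "k + 1 \<le> CARD('m)"
    and g: "C1_map U g" and \<alpha>: "C1b_form k \<alpha>" and \<phi>: "C1_0_form U (CARD('m) - k - 1) \<phi>"
  shows "int_wedge U k (pullback g (jac g) k \<alpha>) (CARD('m) - k) (extd \<phi>)
    = (-1) ^ (k + 1) * int_wedge U (k + 1) (pullback g (jac g) (k + 1) (extd \<alpha>)) (CARD('m) - k - 1) \<phi>"
proof -
  let ?m = "CARD('m)"
  obtain K where K: "compact K" "K \<subseteq> U" "\<And>J x. card J = ?m - k - 1 \<Longrightarrow> x \<notin> K \<Longrightarrow> \<phi> J x = 0"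
    "\<And>J x i. card J = ?m - k - 1 \<Longrightarrow> x \<notin> K \<Longrightarrow> pd (\<phi> J) i x = 0"
    by (rule form_support[OF \<phi>]) blast
  obtain \<psi> V where \<psi>: "C1_0 U \<psi>" "open V" "K \<subseteq> V" "\<And>x. x \<in> V \<Longrightarrow> \<psi> x = 1"
    by (rule C1_cutoff[OF K(1,2) U(1)]) blast
  define h where "h \<nu> x = (if x \<in> U then \<psi> x * g x $ \<nu> else 0)" for \<nu> x
  have h: "C1b (h \<nu>)" for \<nu>
    unfolding h_def
    by (rule C1_0_C1b[OF C1_0_cutoff_mult[OF U(1) \<psi>(1)]]) (use g in \<open>simp add: C1_map_def\<close>)
  have hC: "C1_on UNIV (h \<nu>)" for \<nu> using h unfolding C1b_def by blast
  \<comment> \<open>This E also bounds the Jacobian entries of all mollifications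
    \<open>G p\<close>, since they are mollified partial derivatives of h; the majorants below are
    therefore independent of p.\<close>
  obtain E where E: "0 \<le> E" "\<And>\<nu> x. \<bar>h \<nu> x\<bar> \<le> E" "\<And>\<nu> x i. \<bar>pd (h \<nu>) i x\<bar> \<le> E"
    by (rule C1b_family_bound[of "\<lambda>_. True" h]) (use h in auto)
  define gt where "gt x = (\<chi> \<nu>. h \<nu> x)" for x
  define G where "G p x = (\<chi> \<nu>. moll p (h \<nu>) x)" for p x
  have Gc: "(\<lambda>x. G p x $ \<nu>) = moll p (h \<nu>)" for p \<nu> by (simp add: G_def)
  have jacG: "jac (G p) x $ \<nu> $ \<mu> = moll p (pd (h \<nu>) \<mu>) x" for p x \<nu> \<mu>
    by (simp add: jac_def Gc moll_pd[OF hC])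
  have jact: "jac gt x $ \<nu> $ \<mu> = pd (h \<nu>) \<mu> x" for x \<nu> \<mu>
    by (simp add: jac_def gt_def)
  have G1: "C1_on UNIV (\<lambda>x. G p x $ \<nu>)" and G2: "C1_on UNIV (pd (\<lambda>x. G p x $ \<nu>) \<mu>)" for p \<nu> \<mu>
    unfolding Gc using moll_C1b[OF h] by (auto simp: C1b_def)
  have Gsym: "pd (pd (\<lambda>x. G p x $ \<nu>) i) j x = pd (pd (\<lambda>x. G p x $ \<nu>) j) i x" for p \<nu> i j x
    unfolding Gc by (rule moll_pd_pd_commute[OF hC])
  have \<alpha>C: "C1_on UNIV (\<alpha> I)" if "card I = k" for I using \<alpha> that unfolding C1b_form_def C1b_def by blast
  have \<phi>b: "C1b (\<phi> J)" if "card J = ?m - k - 1" for J using \<phi> that unfolding C1_0_form_def by (auto intro: C1_0_C1b)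
  have \<phi>C: "C1_on UNIV (\<phi> J)" if "card J = ?m - k - 1" for J using \<phi>b[OF that] unfolding C1b_def by blast
  obtain a where a: "0 \<le> a" "\<And>I y. card I = k \<Longrightarrow> \<bar>\<alpha> I y\<bar> \<le> a" "\<And>I y i. card I = k \<Longrightarrow> \<bar>pd (\<alpha> I) i y\<bar> \<le> a"
    by (rule C1b_family_bound[of "\<lambda>I. card I = k" \<alpha>]) (use \<alpha> in \<open>auto simp: C1b_form_def\<close>)
  obtain b where b: "0 \<le> b" "\<And>J x. card J = ?m - k - 1 \<Longrightarrow> \<bar>\<phi> J x\<bar> \<le> b" "\<And>J x i. card J = ?m - k - 1 \<Longrightarrow> \<bar>pd (\<phi> J) i x\<bar> \<le> b"
    by (rule C1b_family_bound[of "\<lambda>J. card J = ?m - k - 1" \<phi>]) (use \<phi>b in auto)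
  \<comment> \<open>Bounded U has finite measure, which makes the constant majorants below
    integrable.\<close>
  interpret finite_measure "lebesgue_on U" by (rule finite_measure_lebesgue_on_bounded_open[OF U])
  have mG: "(\<lambda>x. G p x $ \<nu>) \<in> borel_measurable (lebesgue_on U)"
    and mJ: "(\<lambda>x. jac (G p) x $ \<nu> $ \<mu>) \<in> borel_measurable (lebesgue_on U)" for p \<nu> \<mu>
    using G1 G2 by (auto simp: jac_def intro!: continuous_imp_lebesgue_on_measurable C1_on_continuous)
  have G_lim: "(\<lambda>p. G p x) \<longlonglongrightarrow> gt x" for x
    unfolding G_def gt_def by (intro tendsto_vec_lambda moll_tendsto C1_on_continuous hC)
  have M_lim: "(\<lambda>p. minor (jac (G p) x) I J) \<longlonglongrightarrow> minor (jac gt x) I J" for x I J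
    unfolding minor_def jacG jact
    by (intro tendsto_intros moll_tendsto C1_on_continuous_pd hC)
  have M_bd: "\<bar>minor (jac (G p) x) I J\<bar> \<le> real CARD('m \<Rightarrow> 'n) * E ^ card J" for p x I J
    by (rule minor_bound, unfold jacG, rule moll_bound) (auto intro: C1_on_continuous_pd hC E)
  have ext_card: "?m - k = (?m - k - 1) + 1" using k by simp
  have A_lim: "(\<lambda>p. a' (G p x)) \<longlonglongrightarrow> a' (gt x)" if "continuous_on UNIV a'" for a' :: "_ \<Rightarrow> real" and x
    using that G_lim[of x] by (auto simp: continuous_on_eq_continuous_at intro: isCont_tendsto_compose)
  have L: "(\<lambda>p. int_wedge U k (pullback (G p) (jac (G p)) k \<alpha>) (?m - k) (extd \<phi>))
      \<longlonglongrightarrow> int_wedge U k (pullback gt (jac gt) k \<alpha>) (?m - k) (extd \<phi>)"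
  proof (rule int_wedge_pullback_tendsto[where a = a and b = "real ?m * b" and C = "\<lambda>_. real CARD('m \<Rightarrow> 'n) * E ^ k"])
    show "extd \<phi> J \<in> borel_measurable (lebesgue_on U)" if "card J = ?m - k" for J
      by (rule continuous_imp_lebesgue_on_measurable[OF extd_continuous[OF \<phi>C]]) (use that ext_card in auto)
    show "\<bar>extd \<phi> J x\<bar> \<le> real ?m * b" if "card J = ?m - k" for J x
      by (rule extd_bound[OF b(3) b(1)]) (use that ext_card in auto)
    show "continuous_on UNIV (\<alpha> I)" if "card I = k" for I by (rule C1_on_continuous[OF \<alpha>C[OF that]])
    show "(\<lambda>p. \<alpha> I (G p x)) \<longlonglongrightarrow> \<alpha> I (gt x)" if "card I = k" for I x
      by (rule A_lim[OF C1_on_continuous[OF \<alpha>C[OF that]]])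
    show "\<bar>minor (jac (G p) x) I J\<bar> \<le> real CARD('m \<Rightarrow> 'n) * E ^ k" if "card J = k" for p x I J
      using M_bd[of p x I J] that by simp
  qed (use mG mJ M_lim a E(1) in auto)
  have R: "(\<lambda>p. int_wedge U (k + 1) (pullback (G p) (jac (G p)) (k + 1) (extd \<alpha>)) (?m - k - 1) \<phi>)
      \<longlonglongrightarrow> int_wedge U (k + 1) (pullback gt (jac gt) (k + 1) (extd \<alpha>)) (?m - k - 1) \<phi>"
  proof (rule int_wedge_pullback_tendsto[where a = "real CARD('n) * a" and b = b and C = "\<lambda>_. real CARD('m \<Rightarrow> 'n) * E ^ (k + 1)"])
    show "\<phi> J \<in> borel_measurable (lebesgue_on U)" if "card J = ?m - k - 1" for J
      by (rule continuous_imp_lebesgue_on_measurable[OF C1_on_continuous[OF \<phi>C[OF that]]])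
    show "\<bar>extd \<alpha> I y\<bar> \<le> real CARD('n) * a" if "card I = k + 1" for I y
      by (rule extd_bound[OF a(3) a(1)]) (use that in auto)
    show c: "continuous_on UNIV (extd \<alpha> I)" if "card I = k + 1" for I
      by (rule extd_continuous[OF \<alpha>C that])
    show "(\<lambda>p. extd \<alpha> I (G p x)) \<longlonglongrightarrow> extd \<alpha> I (gt x)" if "card I = k + 1" for I x
      by (rule A_lim[OF c[OF that]])
    show "\<bar>minor (jac (G p) x) I J\<bar> \<le> real CARD('m \<Rightarrow> 'n) * E ^ (k + 1)" if "card J = k + 1" for p x I J
      using M_bd[of p x I J] that by simp
  qed (use mG mJ M_lim a b E(1) in auto)
  have LR: "int_wedge U k (pullback (G p) (jac (G p)) k \<alpha>) (?m - k) (extd \<phi>)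
    = (-1) ^ (k + 1) * int_wedge U (k + 1) (pullback (G p) (jac (G p)) (k + 1) (extd \<alpha>)) (?m - k - 1) \<phi>" for p
  proof -
    have "extd (pullback (G p) (jac (G p)) k \<alpha>) = pullback (G p) (jac (G p)) (k + 1) (extd \<alpha>)"
      by (intro ext extd_pullback G1 G2 Gsym \<alpha>C)
    then show ?thesis
      using stokes_form[OF U(1) k pullback_C1[OF G1[of p] G2[of p] \<alpha>C] \<phi>] by simp
  qed
  have eq: "int_wedge U k (pullback gt (jac gt) k \<alpha>) (?m - k) (extd \<phi>)
    = (-1) ^ (k + 1) * int_wedge U (k + 1) (pullback gt (jac gt) (k + 1) (extd \<alpha>)) (?m - k - 1) \<phi>"
    by (rule LIMSEQ_unique[OF L[unfolded LR] tendsto_mult_left[OF R]])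
  \<comment> \<open>Equality of the Jacobians on K needs equality of the maps on a neighbourhood,
    which is why the cutoff is 1 on an open set V containing K.\<close>
  have on_K: "pullback gt (jac gt) j a' J x = pullback g (jac g) j a' J x" if "x \<in> K" for j a' J x
  proof -
    have xV: "open (V \<inter> U)" "x \<in> V \<inter> U" using that \<psi>(2,3) K(2) U(1) by auto
    have hg: "h \<nu> y = g y $ \<nu>" if "y \<in> V \<inter> U" for y \<nu> using that \<psi>(4) by (simp add: h_def)
    have "gt x = g x" using hg[OF xV(2)] by (simp add: gt_def vec_eq_iff)
    moreover have "jac gt x = jac g x"
      using pd_cong_open(1)[OF xV hg] by (simp add: vec_eq_iff jact) (simp add: jac_def)
    ultimately show ?thesis by (simp add: pullback_def)
  qed
  have extd0: "extd \<phi> J x = 0" if "card J = ?m - k" "x \<notin> K" for J x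
    unfolding extd_def using that ext_card K(4) by (intro sum.neutral) auto
  have "int_wedge U k (pullback gt (jac gt) k \<alpha>) (?m - k) (extd \<phi>) = int_wedge U k (pullback g (jac g) k \<alpha>) (?m - k) (extd \<phi>)"
  proof (rule int_wedge_cong)
    fix I :: "'m set" and x
    assume "card (UNIV - I) = ?m - k"
    then show "pullback gt (jac gt) k \<alpha> I x * extd \<phi> (UNIV - I) x = pullback g (jac g) k \<alpha> I x * extd \<phi> (UNIV - I) x"
      using on_K extd0 by (cases "x \<in> K") simp_all
  qed
  moreover have "int_wedge U (k + 1) (pullback gt (jac gt) (k + 1) (extd \<alpha>)) (?m - k - 1) \<phi>
     = int_wedge U (k + 1) (pullback g (jac g) (k + 1) (extd \<alpha>)) (?m - k - 1) \<phi>"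
  proof (rule int_wedge_cong)
    fix I :: "'m set" and x
    assume "card (UNIV - I) = ?m - k - 1"
    then show "pullback gt (jac gt) (k + 1) (extd \<alpha>) I x * \<phi> (UNIV - I) x = pullback g (jac g) (k + 1) (extd \<alpha>) I x * \<phi> (UNIV - I) x"
      using on_K K(3) by (cases "x \<in> K") simp_all
  qed
  ultimately show ?thesis using eq by simp
qed

lemma pullback_above_dim:
  fixes \<alpha> :: "'n::{finite,linorder} set \<Rightarrow> (real, 'n) vec \<Rightarrow> real"
  assumes "k > CARD('n)"
  shows "pullback f D k \<alpha> J x = 0"
proof -
  have "card I \<noteq> k" for I :: "'n set" using assms card_mono[of UNIV I] by auto
  then show ?thesis by (simp add: pullback_def)
qed

lemma int_wedge_zero: "(\<And>I x. \<beta> I x = 0) \<Longrightarrow> int_wedge U k \<beta> j \<omega> = 0"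
  by (simp add: int_wedge_def wedge_def[abs_def])

text \<open>The added regularity makes both pairs admissible for testing: (\<alpha>, d\<phi>) in
  degree k and (d\<alpha>, \<phi>) in degree k + 1. Along the common sequence the identity holds for
  each C1 map, and both of its sides converge.\<close>

lemma stokes_dagger_stable_regular:
  fixes f :: "(real, 'm::{finite,linorder}) vec \<Rightarrow> (real, 'n::{finite,linorder}) vec"
  assumes U: "open U" "bounded U" and k: "k + 1 \<le> CARD('m)"
    and f: "dagger_stable U k f D"
    and \<alpha>: "C1b_form k \<alpha>" "C1b_form (k + 1) (extd \<alpha>)"
    and \<phi>: "C1_0_form U (CARD('m) - k - 1) \<phi>" "C1_0_form U (CARD('m) - k) (extd \<phi>)"
  shows "int_wedge U k (pullback f D k \<alpha>) (CARD('m) - k) (extd \<phi>)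
    = (-1) ^ (k + 1) * int_wedge U (k + 1) (pullback f D (k + 1) (extd \<alpha>)) (CARD('m) - k - 1) \<phi>"
proof (cases "k < CARD('n)")
  case True
  then obtain fs where fs: "\<And>j. C1_map U (fs j)" "tau_conv U k fs (\<lambda>j. jac (fs j)) f D"
      "tau_conv U (k + 1) fs (\<lambda>j. jac (fs j)) f D"
    using f unfolding dagger_stable_def by auto
  have L: "(\<lambda>j. int_wedge U k (pullback (fs j) (jac (fs j)) k \<alpha>) (CARD('m) - k) (extd \<phi>))
      \<longlonglongrightarrow> int_wedge U k (pullback f D k \<alpha>) (CARD('m) - k) (extd \<phi>)"
    using fs(2) k \<alpha>(1) \<phi>(2) unfolding tau_conv_def by simp
  have R: "(\<lambda>j. int_wedge U (k + 1) (pullback (fs j) (jac (fs j)) (k + 1) (extd \<alpha>)) (CARD('m) - k - 1) \<phi>)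
      \<longlonglongrightarrow> int_wedge U (k + 1) (pullback f D (k + 1) (extd \<alpha>)) (CARD('m) - k - 1) \<phi>"
    using fs(3) k \<alpha>(2) \<phi>(1) unfolding tau_conv_def by simp
  show ?thesis
    by (rule LIMSEQ_unique[OF L[unfolded stokes_C1_map[OF U k fs(1) \<alpha>(1) \<phi>(1)]] tendsto_mult_left[OF R]])
next
  case False
  then have kn: "k = CARD('n)" using f unfolding dagger_stable_def by (auto split: if_splits)
  then obtain fs where fs: "\<And>j. C1_map U (fs j)" "tau_conv U k fs (\<lambda>j. jac (fs j)) f D"
    using f unfolding dagger_stable_def by auto
  \<comment> \<open>The target has no index sets of size k + 1 here, so the right side vanishes for
    the approximating maps as well as for the limit; convergence in degree k alone forces the left
    side to be 0.\<close>
  have 0: "int_wedge U (k + 1) (pullback g E (k + 1) (extd \<alpha>)) j \<phi> = 0" for g :: "(real, 'm) vec \<Rightarrow> (real, 'n) vec" and E j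
    by (intro int_wedge_zero pullback_above_dim) (simp add: kn)
  have L: "(\<lambda>j. int_wedge U k (pullback (fs j) (jac (fs j)) k \<alpha>) (CARD('m) - k) (extd \<phi>))
      \<longlonglongrightarrow> int_wedge U k (pullback f D k \<alpha>) (CARD('m) - k) (extd \<phi>)"
    using fs(2) k \<alpha>(1) \<phi>(2) unfolding tau_conv_def by simp
  have "int_wedge U k (pullback f D k \<alpha>) (CARD('m) - k) (extd \<phi>) = 0"
    by (rule LIMSEQ_unique[OF L[unfolded stokes_C1_map[OF U k fs(1) \<alpha>(1) \<phi>(1)] 0]]) simp
  then show ?thesis unfolding 0 by simp
qed

section \<open>Exterior derivatives as admissible test forms\<close>

lemma C1b_cmult:
  assumes "C1b h" shows "C1b (\<lambda>x. c * h x)"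
proof -
  obtain B where C: "C1_on UNIV h" and B: "\<And>x. \<bar>h x\<bar> \<le> B" "\<And>x i. \<bar>pd h i x\<bar> \<le> B"
    using assms unfolding C1b_iff by blast
  have "\<bar>c * h x\<bar> \<le> \<bar>c\<bar> * B" for x using B(1)[of x] by (simp add: abs_mult mult_left_mono)
  moreover have "\<bar>pd (\<lambda>x. c * h x) i x\<bar> \<le> \<bar>c\<bar> * B" for i x
    using B(2)[of i x] by (simp add: pd_cmult[OF C1_on_differentiable[OF C]] abs_mult mult_left_mono)
  ultimately show ?thesis unfolding C1b_iff using C1_on_mult[OF C1_on_const C] by blast
qed

lemma C1b_sum:
  assumes "\<And>a. a \<in> A \<Longrightarrow> C1b (h a)" shows "C1b (\<lambda>x. \<Sum>a\<in>A. h a x)"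
proof -
  have C: "C1_on UNIV (h a)" if "a \<in> A" for a using assms[OF that] unfolding C1b_def by blast
  have "\<exists>B. \<forall>x. \<bar>h a x\<bar> \<le> B \<and> (\<forall>i. \<bar>pd (h a) i x\<bar> \<le> B)" if "a \<in> A" for a
    using assms[OF that] unfolding C1b_iff by blast
  then obtain B where B: "\<And>a x. a \<in> A \<Longrightarrow> \<bar>h a x\<bar> \<le> B a" "\<And>a x i. a \<in> A \<Longrightarrow> \<bar>pd (h a) i x\<bar> \<le> B a"
    by metis
  have "\<bar>\<Sum>a\<in>A. h a x\<bar> \<le> sum B A" for x
    by (rule order_trans[OF sum_abs sum_mono]) (rule B)
  moreover have "\<bar>pd (\<lambda>x. \<Sum>a\<in>A. h a x) i x\<bar> \<le> sum B A" for i x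
    by (subst pd_sum[OF C1_on_differentiable[OF C UNIV_I]], assumption, rule order_trans[OF sum_abs sum_mono]) (rule B)
  ultimately show ?thesis unfolding C1b_iff
    by (intro conjI C1_on_sum[OF C] exI[of _ "sum B A"] allI)
qed

lemma C1b_form_extd:
  assumes "\<And>I i. card I = k \<Longrightarrow> C1b (pd (\<beta> I) i)"
  shows "C1b_form (k + 1) (extd \<beta>)"
  unfolding C1b_form_def extd_def[abs_def]
  by (intro allI impI C1b_sum C1b_cmult assms) simp

lemma C1_0_form_extd:
  fixes \<beta> :: "'d::{finite,linorder} set \<Rightarrow> (real, 'd) vec \<Rightarrow> real"
  assumes \<beta>: "C1_0_form U k \<beta>" "\<And>I i. card I = k \<Longrightarrow> C1_on UNIV (pd (\<beta> I) i)"
  shows "C1_0_form U (k + 1) (extd \<beta>)"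
  unfolding C1_0_form_def
proof (intro allI impI)
  fix J :: "'d set" assume J: "card J = k + 1"
  obtain K where K: "compact K" "K \<subseteq> U" "\<And>J x. card J = k \<Longrightarrow> x \<notin> K \<Longrightarrow> \<beta> J x = 0"
    "\<And>J x i. card J = k \<Longrightarrow> x \<notin> K \<Longrightarrow> pd (\<beta> J) i x = 0"
    by (rule form_support[OF \<beta>(1)]) blast
  have "C1_on UNIV (extd \<beta> J)"
    unfolding extd_def[abs_def] by (intro C1_on_sum C1_on_mult C1_on_const \<beta>(2)) (use J in simp)
  moreover have "extd \<beta> J x = 0" if "x \<notin> K" for x
    unfolding extd_def using J K(4) that by (intro sum.neutral) auto
  ultimately show "C1_0 U (extd \<beta> J)" unfolding C1_0_def using K(1,2) by blast
qed

section \<open>Integrability of the pullbacks and removal of the mollification\<close>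

theorem theorem1:
  fixes U :: "((real, 'm::{finite,linorder}) vec) set"
    and f :: "(real, 'm) vec \<Rightarrow> (real, 'n::{finite,linorder}) vec"
    and D :: "(real, 'm) vec \<Rightarrow> ((real, 'm) vec, 'n) vec"
    and k :: nat
    and \<alpha> :: "('n set \<Rightarrow> (real, 'n) vec \<Rightarrow> real)"
  assumes "open U" and "connected U" and "bounded U"
    and "k \<le> CARD('n)"
    and "dagger_stable U k f D"
    and "C1b_form k \<alpha>"
  shows "(\<forall>J. card J = k \<longrightarrow> integrable (lebesgue_on U) (pullback f D k \<alpha> J))
       \<and> (\<forall>J. card J = k + 1 \<longrightarrow> integrable (lebesgue_on U) (pullback f D (k + 1) (extd \<alpha>) J))
       \<and> (\<forall>\<phi>. k + 1 \<le> CARD('m) \<longrightarrow> C1_0_form U (CARD('m) - k - 1) \<phi> \<longrightarrow>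
            int_wedge U k (pullback f D k \<alpha>) (CARD('m) - k) (extd \<phi>)
              = (-1) ^ (k + 1) * int_wedge U (k + 1) (pullback f D (k + 1) (extd \<alpha>)) (CARD('m) - k - 1) \<phi>)"
proof -
  let ?m = "CARD('m)"
  note U = assms(1,3) and stable = assms(5)
  have Fk: "Fk U k f D" using stable unfolding dagger_stable_def by (auto split: if_splits)
  have Fk1: "Fk U (k + 1) f D" if "k < CARD('n)" using stable that unfolding dagger_stable_def by simp
  have \<alpha>b: "C1b (\<alpha> I)" if "card I = k" for I using assms(6) that unfolding C1b_form_def by blast
  have \<alpha>C: "C1_on UNIV (\<alpha> I)" if "card I = k" for I using \<alpha>b[OF that] unfolding C1b_def by blast
  obtain a where a: "0 \<le> a" "\<And>I y. card I = k \<Longrightarrow> \<bar>\<alpha> I y\<bar> \<le> a" "\<And>I y i. card I = k \<Longrightarrow> \<bar>pd (\<alpha> I) i y\<bar> \<le> a"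
    by (rule C1b_family_bound[of "\<lambda>I. card I = k" \<alpha>]) (use \<alpha>b in auto)
  have ext_bd: "\<bar>extd \<alpha> I y\<bar> \<le> real CARD('n) * a" if "card I = k + 1" for I y
    by (rule extd_bound[OF a(3) a(1)]) (use that in auto)
  have int0: "integrable (lebesgue_on U) (pullback f D k \<alpha> J)" if "card J = k" for J
    by (rule integrable_pullback[OF Fk C1_on_continuous[OF \<alpha>C] a(2,1) that])
  have int1: "integrable (lebesgue_on U) (pullback f D (k + 1) (extd \<alpha>) J)" if "card J = k + 1" for J
  proof (cases "k < CARD('n)")
    case True
    show ?thesis
      by (rule integrable_pullback[OF Fk1[OF True] extd_continuous[OF \<alpha>C] ext_bd _ that]) (use a in auto)
  next
    case False
    then have "pullback f D (k + 1) (extd \<alpha>) J = (\<lambda>x. 0)"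
      by (intro ext pullback_above_dim) simp
    then show ?thesis by simp
  qed
  have stokes: "int_wedge U k (pullback f D k \<alpha>) (?m - k) (extd \<phi>)
      = (-1) ^ (k + 1) * int_wedge U (k + 1) (pullback f D (k + 1) (extd \<alpha>)) (?m - k - 1) \<phi>"
    if k: "k + 1 \<le> ?m" and \<phi>: "C1_0_form U (?m - k - 1) \<phi>" for \<phi>
  proof -
    have \<phi>b: "C1b (\<phi> J)" if "card J = ?m - k - 1" for J using \<phi> that unfolding C1_0_form_def by (auto intro: C1_0_C1b)
    have \<phi>C: "C1_on UNIV (\<phi> J)" if "card J = ?m - k - 1" for J using \<phi>b[OF that] unfolding C1b_def by blast
    obtain b where b: "0 \<le> b" "\<And>J x. card J = ?m - k - 1 \<Longrightarrow> \<bar>\<phi> J x\<bar> \<le> b" "\<And>J x i. card J = ?m - k - 1 \<Longrightarrow> \<bar>pd (\<phi> J) i x\<bar> \<le> b"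
      by (rule C1b_family_bound[of "\<lambda>J. card J = ?m - k - 1" \<phi>]) (use \<phi>b in auto)
    have ext_card: "?m - k = (?m - k - 1) + 1" using k by simp
    have "\<forall>\<^sub>F p in sequentially. \<forall>J\<in>{J. card J = ?m - k - 1}. C1_0 U (moll p (\<phi> J))"
      using \<phi> U unfolding C1_0_form_def by (intro eventually_ball_finite) (auto intro: moll_C1_0)
    then obtain N where N: "\<And>p J. p \<ge> N \<Longrightarrow> card J = ?m - k - 1 \<Longrightarrow> C1_0 U (moll p (\<phi> J))"
      unfolding eventually_sequentially by blast
    \<comment> \<open>The shift by N makes every mollified \<phi>, not merely the late ones,
      compactly supported in U.\<close>
    define A where "A p I = moll (p + N) (\<alpha> I)" for p I
    define P where "P p J = moll (p + N) (\<phi> J)" for p J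
    have Ab: "C1b (A p I)" "C1b (pd (A p I) i)" if "card I = k" for p I i
      unfolding A_def using moll_C1b[OF \<alpha>b[OF that]] by auto
    have Pb: "C1b (P p J)" "C1b (pd (P p J) i)" if "card J = ?m - k - 1" for p J i
      unfolding P_def using moll_C1b[OF \<phi>b[OF that]] by auto
    have AC: "C1_on UNIV (A p I)" if "card I = k" for p I using Ab(1)[OF that] unfolding C1b_def by blast
    have PC: "C1_on UNIV (P p J)" if "card J = ?m - k - 1" for p J using Pb(1)[OF that] unfolding C1b_def by blast
    have P0: "C1_0_form U (?m - k - 1) (P p)" for p unfolding C1_0_form_def P_def using N by simp
    \<comment> \<open>For each fixed p the limit along the stable sequence is already taken inside
      this identity; from here on only p varies.\<close>
    have eq: "int_wedge U k (pullback f D k (A p)) (?m - k) (extd (P p))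
      = (-1) ^ (k + 1) * int_wedge U (k + 1) (pullback f D (k + 1) (extd (A p))) (?m - k - 1) (P p)" for p
    proof (rule stokes_dagger_stable_regular[OF U k stable])
      show "C1b_form k (A p)" unfolding C1b_form_def using Ab by blast
      show "C1b_form (k + 1) (extd (A p))" by (rule C1b_form_extd[OF Ab(2)])
      have "C1_on UNIV (pd (P p J) i)" if "card J = ?m - k - 1" for J i using Pb(2)[OF that] unfolding C1b_def by blast
      from C1_0_form_extd[OF P0 this] show "C1_0_form U (?m - k) (extd (P p))" using ext_card by simp
    qed (rule P0)
    have A_lim: "(\<lambda>p. A p I y) \<longlonglongrightarrow> \<alpha> I y" "(\<lambda>p. pd (A p I) i y) \<longlonglongrightarrow> pd (\<alpha> I) i y" if "card I = k" for I i y
      unfolding A_def moll_pd[OF \<alpha>C[OF that]]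
      using moll_tendsto[OF C1_on_continuous[OF \<alpha>C[OF that]]] moll_tendsto[OF C1_on_continuous_pd[OF \<alpha>C[OF that]]]
      by (auto intro: LIMSEQ_ignore_initial_segment)
    have P_lim: "(\<lambda>p. P p J y) \<longlonglongrightarrow> \<phi> J y" "(\<lambda>p. pd (P p J) i y) \<longlonglongrightarrow> pd (\<phi> J) i y" if "card J = ?m - k - 1" for J i y
      unfolding P_def moll_pd[OF \<phi>C[OF that]]
      using moll_tendsto[OF C1_on_continuous[OF \<phi>C[OF that]]] moll_tendsto[OF C1_on_continuous_pd[OF \<phi>C[OF that]]]
      by (auto intro: LIMSEQ_ignore_initial_segment)
    \<comment> \<open>These bounds, uniform in p, involve no derivative beyond the first, hence only
      the original bounds of \<alpha>; the same is done for \<phi> below.\<close>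
    have A_bd: "\<bar>A p I y\<bar> \<le> a" "\<bar>pd (A p I) i y\<bar> \<le> a" if "card I = k" for p I i y
      unfolding A_def moll_pd[OF \<alpha>C[OF that]]
      by (rule moll_bound[OF C1_on_continuous[OF \<alpha>C[OF that]] a(2)[OF that]])
        (rule moll_bound[OF C1_on_continuous_pd[OF \<alpha>C[OF that]] a(3)[OF that]])
    have P_bd: "\<bar>P p J y\<bar> \<le> b" "\<bar>pd (P p J) i y\<bar> \<le> b" if "card J = ?m - k - 1" for p J i y
      unfolding P_def moll_pd[OF \<phi>C[OF that]]
      by (rule moll_bound[OF C1_on_continuous[OF \<phi>C[OF that]] b(2)[OF that]])
        (rule moll_bound[OF C1_on_continuous_pd[OF \<phi>C[OF that]] b(3)[OF that]])
    have w: "weak_jacobian U f D" and Lam0: "integrable (lebesgue_on U) (\<lambda>x. Lam k (D x))"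
      using Fk unfolding Fk_def by auto
    have mf: "(\<lambda>x. f x $ \<nu>) \<in> borel_measurable (lebesgue_on U)"
      and mD: "(\<lambda>x. D x $ \<nu> $ \<mu>) \<in> borel_measurable (lebesgue_on U)" for \<nu> \<mu>
      using w unfolding weak_jacobian_def by (auto intro: borel_measurable_integrable)
    \<comment> \<open>The map is fixed, so its \<open>Lam k\<close> dominates all the minors, and
      the mollified coefficients contribute only the uniform constants.\<close>
    have L: "(\<lambda>p. int_wedge U k (pullback f D k (A p)) (?m - k) (extd (P p)))
        \<longlonglongrightarrow> int_wedge U k (pullback f D k \<alpha>) (?m - k) (extd \<phi>)"
    proof (rule int_wedge_pullback_tendsto[where a = a and b = "real ?m * b" and C = "\<lambda>x. Lam k (D x)"])
      show "extd (P p) J \<in> borel_measurable (lebesgue_on U)" if "card J = ?m - k" for p J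
        by (rule continuous_imp_lebesgue_on_measurable[OF extd_continuous[OF PC]]) (use that ext_card in auto)
      show "\<bar>extd (P p) J x\<bar> \<le> real ?m * b" if "card J = ?m - k" for p J x
        by (rule extd_bound[OF P_bd(2) b(1)]) (use that ext_card in auto)
      show "(\<lambda>p. extd (P p) J x) \<longlonglongrightarrow> extd \<phi> J x" if "card J = ?m - k" for J x
        by (rule extd_tendsto[OF P_lim(2)]) (use that ext_card in auto)
      show "continuous_on UNIV (A p I)" if "card I = k" for p I by (rule C1_on_continuous[OF AC[OF that]])
      show "\<bar>minor (D x) I J\<bar> \<le> Lam k (D x)" if "card I = k" "card J = k" for x I J by (rule minor_le_Lam[OF that])
      show "0 \<le> Lam k (D x)" for x by (rule Lam_nonneg)
    qed (use mf mD A_lim A_bd a(1) Lam0 in auto)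
    have R: "(\<lambda>p. int_wedge U (k + 1) (pullback f D (k + 1) (extd (A p))) (?m - k - 1) (P p))
        \<longlonglongrightarrow> int_wedge U (k + 1) (pullback f D (k + 1) (extd \<alpha>)) (?m - k - 1) \<phi>"
    proof (cases "k < CARD('n)")
      case True
      have Lam1: "integrable (lebesgue_on U) (\<lambda>x. Lam (k + 1) (D x))" using Fk1[OF True] unfolding Fk_def by blast
      show ?thesis
      proof (rule int_wedge_pullback_tendsto[where a = "real CARD('n) * a" and b = b and C = "\<lambda>x. Lam (k + 1) (D x)"])
        show "P p J \<in> borel_measurable (lebesgue_on U)" if "card J = ?m - k - 1" for p J
          by (rule continuous_imp_lebesgue_on_measurable[OF C1_on_continuous[OF PC[OF that]]])
        show "\<bar>extd (A p) I y\<bar> \<le> real CARD('n) * a" if "card I = k + 1" for p I y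
          by (rule extd_bound[OF A_bd(2) a(1)]) (use that in auto)
        show "(\<lambda>p. extd (A p) I (f x)) \<longlonglongrightarrow> extd \<alpha> I (f x)" if "card I = k + 1" for I x
          by (rule extd_tendsto[OF A_lim(2) that])
        show "continuous_on UNIV (extd (A p) I)" if "card I = k + 1" for p I
          by (rule extd_continuous[OF AC that])
        show "\<bar>minor (D x) I J\<bar> \<le> Lam (k + 1) (D x)" if "card I = k + 1" "card J = k + 1" for x I J
          by (rule minor_le_Lam[OF that])
        show "0 \<le> Lam (k + 1) (D x)" for x by (rule Lam_nonneg)
      qed (use mf mD P_lim P_bd a(1) Lam1 in auto)
    next
      case False
      then have "int_wedge U (k + 1) (pullback f D (k + 1) \<gamma>) j \<omega> = 0" for \<gamma> j \<omega>
        by (intro int_wedge_zero pullback_above_dim) simp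
      then show ?thesis by simp
    qed
    show ?thesis by (rule LIMSEQ_unique[OF L[unfolded eq] tendsto_mult_left[OF R]])
  qed
  show ?thesis using int0 int1 stokes by blast
qed

end
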